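(* Let $p=p(n)\in[0,1]$ satisfy $p\gg n^{-2/3}$, i.e. $p(n)\,n^{2/3}\to\infty$ as $n\to\infty$. Then there exist real sequences $\varepsilon_n\to 0$ and $\delta_n\to 0$ such that, asymptotically almost surely, the random bipartite graph $G(n,n,p)$ has the following property: every subgraph $G'\subset G(n,n,p)$ with more than $(1+\varepsilon_n)\,n^2p/2$ edges contains a cycle of length $t$ for every even integer $t\in[4,(1+\delta_n)n/30]$.
   Context: $G(n,n,p)$ denotes the random subgraph of the complete bipartite graph $K_{n,n}$ obtained by keeping each edge of $K_{n,n}$ independently with probability $p$. A property holds asymptotically almost surely (a.a.s.) if the probability that it holds tends to $1$ as $n\to\infty$. The length of a cycle is its number of edges. The sequences $\varepsilon_n,\delta_n$ (which may depend on the function $p(n)$) make explicit the $o(1)$ terms in "more than $(1+o(1))n^2p/2$ edges" and "$t\in[4,(1+o(1))n/30]$". *)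

theory Defs
  imports "HOL-Probability.Probability"
begin

datatype 'a ugraph = UGraph (verts: "'a set") (edges: "'a set set")

definition simple_graph :: "'a ugraph \<Rightarrow> bool" where
  "simple_graph G \<longleftrightarrow> (\<forall>e\<in>edges G. e \<subseteq> verts G \<and> card e = 2)"

definition subgraph :: "'a ugraph \<Rightarrow> 'a ugraph \<Rightarrow> bool" where
  "subgraph H G \<longleftrightarrow> simple_graph H \<and> verts H \<subseteq> verts G \<and> edges H \<subseteq> edges G"

text \<open>
  A cycle is given by the list of its vertices in cyclic order. Since it has at least three
  distinct vertices, its consecutive edges (including the closing one) are pairwise distinct,
  so its number of edges is the length of the list.
\<close>
definition is_cycle :: "'a ugraph \<Rightarrow> 'a list \<Rightarrow> bool" where
  "is_cycle G c \<longleftrightarrow> 3 \<le> length c \<and> distinct c \<and> set c \<subseteq> verts G \<and>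
     (\<forall>i<length c. {c ! i, c ! ((i + 1) mod length c)} \<in> edges G)"

definition has_cycle_of_length :: "'a ugraph \<Rightarrow> nat \<Rightarrow> bool" where
  "has_cycle_of_length G t \<longleftrightarrow> (\<exists>c. is_cycle G c \<and> length c = t)"

definition complete_bipartite :: "nat \<Rightarrow> nat \<Rightarrow> (nat + nat) ugraph" where
  "complete_bipartite m n =
     UGraph (Inl ` {..<m} \<union> Inr ` {..<n}) {{Inl i, Inr j} | i j. i < m \<and> j < n}"

definition random_subgraph :: "'a ugraph \<Rightarrow> real \<Rightarrow> 'a ugraph pmf" where
  "random_subgraph G p =
     map_pmf (\<lambda>keep. UGraph (verts G) {e \<in> edges G. keep e})
       (Pi_pmf (edges G) False (\<lambda>_. bernoulli_pmf p))"

definition random_bipartite :: "nat \<Rightarrow> real \<Rightarrow> (nat + nat) ugraph pmf" where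
  "random_bipartite n p = random_subgraph (complete_bipartite n n) p"

definition asymptotically_almost_surely ::
    "(nat \<Rightarrow> 'a pmf) \<Rightarrow> (nat \<Rightarrow> 'a \<Rightarrow> bool) \<Rightarrow> bool" where
  "asymptotically_almost_surely X P \<longleftrightarrow>
     (\<lambda>n. measure_pmf.prob (X n) {x. P n x}) \<longlonglongrightarrow> 1"

end

theory Submission
  imports Defs "HOL-Real_Asymp.Real_Asymp"
begin

text \<open>
The graph is viewed as a random relation \<open>W\<close> on \<open>{..<n}\<close>, and a subgraph with more than
\<open>(1/2 + \<epsilon>) p n\<^sup>2\<close> edges as a relation \<open>E \<subseteq> W\<close>.  It suffices to find, for each fixed \<open>\<epsilon>\<close>, finitely
many properties of \<open>W\<close> that hold with probability tending to one and force all the cycles; a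
diagonal argument then lets \<open>\<epsilon>\<close> tend to zero.

Most of these properties are upper bounds on the number of edges between two vertex sets
(\<open>uniform_above\<close>, \<open>sublinear_uniform_above\<close>, \<open>small_sets_expand\<close>).  They turn minimum degrees of \<open>E\<close>
into expansion: if the edges leaving a set are many, their endpoints cannot be few.  The condition
\<open>p \<gg> n powr (-2/3)\<close> enters here.  A vertex has about \<open>n p\<close> neighbours and about \<open>n\<^sup>2 p\<^sup>2\<close> second
neighbours, and \<open>n\<^sup>2 p\<^sup>2 \<gg> 1/p\<close> is what makes the third neighbourhood occupy a constant fraction of the
other side, namely almost the relative degree (\<open>third_neighbourhood_large\<close>).  Self-intersections of
walks are avoided by colouring the vertices at random and giving each step of a walk its own colour
class (\<open>balanced_colouring\<close>).

Cycles of length 4, 6 and 8 use the majority of edges (\<open>short_cycle\<close>).  Let \<open>(X, Y)\<close> maximise the number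
of \<open>E\<close>-edges minus \<open>d p |X| |Y|\<close> with \<open>d\<close> slightly above a half; then all degrees inside the pair
exceed half of the maximum.  Tiny reserved colour classes supply paths of length 3, 5 or 7 from each
\<open>u \<in> X\<close> to more than half of \<open>Y\<close>.  If no such path closes to a cycle, then \<open>E\<close> avoids more than half of
the pairs in \<open>X \<times> Y\<close>, although it contains more than half of the expected number of edges.  The avoided
set depends on \<open>E\<close>, but only through the few edges that touch the reserve, so a union bound over these
edges is affordable (\<open>random_relation_container\<close>, \<open>unlinked_uniform_above\<close>).

Longer cycles are built in a pair \<open>(X, Y)\<close> maximising \<open>e(X, Y)^4 / (|X| |Y|)^3\<close>.  Such a pair has
large minimum degree, and because the exponent \<open>3/4\<close> of \<open>|X| |Y|\<close> exceeds \<open>1/2\<close> it cannot be split into two parts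
with few edges between them: one of the parts would do better.  Depth-first search finds a path of the wanted
length in one colour class (\<open>long_path_exists\<close>).  The third neighbourhoods of its two ends, taken inside
a second class, are joined by a path of length four: otherwise the vertices near one end and those near
the other would form such a splitting (\<open>closing_vertex_exists\<close>).  The factor 30 leaves room for both
classes.
\<close>

section \<open>Exponential moments of random subsets\<close>

text \<open>
The factor for \<open>F\<close> makes it possible to condition on a prescribed set of elements while estimating the count in a disjoint set \<open>B\<close>: both are products of functions of independent coordinates.
\<close>
lemma Pi_pmf_exp_moment:
  fixes M :: "'b pmf" and C :: "'b set" and s :: real
  assumes fin: "finite A" and F: "F \<subseteq> A" and B: "B \<subseteq> A" and FB: "F \<inter> B = {}"
  defines "q \<equiv> measure_pmf.prob M C"
  shows "measure_pmf.expectation (Pi_pmf A d (\<lambda>_. M))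
           (\<lambda>f. (\<Prod>v\<in>F. indicator C (f v)) * exp (s * real (card {v\<in>B. f v \<in> C}))) =
         q ^ card F * (1 + q * (exp s - 1)) ^ card B"
    and "integrable (Pi_pmf A d (\<lambda>_. M))
           (\<lambda>f. (\<Prod>v\<in>F. indicator C (f v)) * exp (s * real (card {v\<in>B. f v \<in> C})))"
proof -
  define h :: "'b \<Rightarrow> real" where "h x = 1 + (exp s - 1) * indicator C x" for x
  define g :: "'a \<Rightarrow> 'b \<Rightarrow> real" where
    "g v x = (if v \<in> F then indicator C x else if v \<in> B then h x else 1)" for v x
  have finF: "finite F" and finB: "finite B" using fin F B finite_subset by auto
  have h_eq: "h x = (if x \<in> C then exp s else 1)" for x
    by (simp add: h_def)
  have prodB: "(\<Prod>v\<in>B. h (f v)) = exp (s * real (card {v\<in>B. f v \<in> C}))" for f :: "'a \<Rightarrow> 'b"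
  proof -
    have "(\<Prod>v\<in>B. h (f v)) = (\<Prod>v\<in>{v\<in>B. f v \<in> C}. exp s) * (\<Prod>v\<in>B - {v\<in>B. f v \<in> C}. 1)"
      using finB by (subst prod.subset_diff[of "{v\<in>B. f v \<in> C}" B]) (auto simp: h_eq)
    then show ?thesis by (simp add: exp_of_nat_mult[symmetric] mult.commute)
  qed
  have split: "(\<Prod>v\<in>A. G v) = (\<Prod>v\<in>F. G v) * (\<Prod>v\<in>B. G v)"
    if "\<And>v. v \<notin> F \<Longrightarrow> v \<notin> B \<Longrightarrow> G v = 1" for G :: "'a \<Rightarrow> real"
  proof -
    have "(\<Prod>v\<in>A. G v) = (\<Prod>v\<in>F \<union> B. G v)"
      by (rule prod.mono_neutral_right) (use fin F B that in auto)
    then show ?thesis using FB finF finB by (simp add: prod.union_disjoint)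
  qed
  have prodA: "(\<Prod>v\<in>A. g v (f v)) =
      (\<Prod>v\<in>F. indicator C (f v)) * exp (s * real (card {v\<in>B. f v \<in> C}))" for f
  proof -
    have "(\<Prod>v\<in>F. g v (f v)) = (\<Prod>v\<in>F. indicator C (f v))"
      by (intro prod.cong) (auto simp: g_def)
    moreover have "(\<Prod>v\<in>B. g v (f v)) = (\<Prod>v\<in>B. h (f v))"
      using FB by (intro prod.cong) (auto simp: g_def)
    ultimately show ?thesis by (subst split) (auto simp: g_def prodB)
  qed
  have int: "integrable M (g v)" for v
  proof (rule measure_pmf.integrable_const_bound[where B = "max 1 (exp s)"])
    show "AE x in M. norm (g v x) \<le> max 1 (exp s)"
      by (rule AE_pmfI) (auto simp: g_def h_eq indicator_def)
  qed auto
  have intC: "integrable M (indicator C :: 'b \<Rightarrow> real)"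
    by (rule measure_pmf.integrable_const_bound[where B = 1]) (auto simp: indicator_def)
  have Eh: "measure_pmf.expectation M h = 1 + q * (exp s - 1)"
    unfolding h_def using intC by (simp add: q_def mult.commute)
  have "measure_pmf.expectation (Pi_pmf A d (\<lambda>_. M)) (\<lambda>f. \<Prod>v\<in>A. g v (f v)) =
        (\<Prod>v\<in>A. measure_pmf.expectation M (g v))"
  proof (rule expectation_prod_Pi_pmf[OF fin])
    show "integrable M (g v)" for v by (rule int)
    show "0 \<le> g v y" for v y by (simp add: g_def h_eq)
  qed
  also have "\<dots> = (\<Prod>v\<in>F. measure_pmf.expectation M (g v)) * (\<Prod>v\<in>B. measure_pmf.expectation M (g v))"
    by (rule split) (simp add: g_def[abs_def])
  also have "(\<Prod>v\<in>F. measure_pmf.expectation M (g v)) = (\<Prod>v\<in>F. q)"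
    by (intro prod.cong refl) (simp add: g_def[abs_def] q_def)
  also have "(\<Prod>v\<in>B. measure_pmf.expectation M (g v)) = (\<Prod>v\<in>B. 1 + q * (exp s - 1))"
  proof (intro prod.cong refl)
    fix v assume "v \<in> B"
    then have "g v = h" using FB by (auto simp: g_def fun_eq_iff)
    then show "measure_pmf.expectation M (g v) = 1 + q * (exp s - 1)" by (simp add: Eh)
  qed
  finally show "measure_pmf.expectation (Pi_pmf A d (\<lambda>_. M))
           (\<lambda>f. (\<Prod>v\<in>F. indicator C (f v)) * exp (s * real (card {v\<in>B. f v \<in> C}))) =
         q ^ card F * (1 + q * (exp s - 1)) ^ card B"
    by (simp add: prodA)
  show "integrable (Pi_pmf A d (\<lambda>_. M))
           (\<lambda>f. (\<Prod>v\<in>F. indicator C (f v)) * exp (s * real (card {v\<in>B. f v \<in> C})))"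
    using integrable_prod_Pi_pmf[OF fin, of "\<lambda>_. M" g d] int by (simp add: prodA)
qed

text \<open>
Markov's inequality for the exponential moment.  Multiplying the threshold by \<open>s\<close> covers both tails: \<open>s > 0\<close> bounds large counts, \<open>s < 0\<close> small ones.
\<close>
lemma Pi_pmf_tail:
  fixes M :: "'b pmf" and C :: "'b set" and s a :: real
  assumes fin: "finite A" and F: "F \<subseteq> A" and B: "B \<subseteq> A" and FB: "F \<inter> B = {}"
  defines "q \<equiv> measure_pmf.prob M C"
  shows "measure_pmf.prob (Pi_pmf A d (\<lambda>_. M))
           {f. (\<forall>v\<in>F. f v \<in> C) \<and> s * a \<le> s * real (card {v\<in>B. f v \<in> C})}
         \<le> q ^ card F * exp (q * (exp s - 1) * real (card B) - s * a)"
proof -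
  let ?P = "Pi_pmf A d (\<lambda>_. M)"
  let ?S = "{f. (\<forall>v\<in>F. f v \<in> C) \<and> s * a \<le> s * real (card {v\<in>B. f v \<in> C})}"
  let ?g = "\<lambda>f. (\<Prod>v\<in>F. indicator C (f v)) * exp (s * real (card {v\<in>B. f v \<in> C}))"
  have finF: "finite F" using fin F finite_subset by auto
  have int: "integrable ?P (indicator ?S :: _ \<Rightarrow> real)"
    by (rule measure_pmf.integrable_const_bound[where B = 1]) (auto simp: indicator_def)
  have "measure_pmf.prob ?P ?S = measure_pmf.expectation ?P (indicator ?S)" by simp
  also have "\<dots> \<le> measure_pmf.expectation ?P (\<lambda>f. ?g f * exp (- (s * a)))"
  proof (rule integral_mono)
    show "integrable ?P (indicator ?S :: _ \<Rightarrow> real)" by (rule int)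
    show "integrable ?P (\<lambda>f. ?g f * exp (- (s * a)))"
      using Pi_pmf_exp_moment(2)[OF fin F B FB, of d M C s] by simp
    fix f
    show "indicator ?S f \<le> ?g f * exp (- (s * a))"
    proof (cases "f \<in> ?S")
      case True
      then have "(\<Prod>v\<in>F. indicator C (f v)) = (1::real)" by (intro prod.neutral) auto
      then have "?g f * exp (- (s * a)) = exp (s * real (card {v\<in>B. f v \<in> C}) - s * a)"
        by (simp add: exp_diff exp_minus field_simps)
      moreover have "1 \<le> exp (s * real (card {v\<in>B. f v \<in> C}) - s * a)"
        using True by simp
      ultimately show ?thesis using True by simp
    next
      case False
      then show ?thesis by (auto intro!: mult_nonneg_nonneg prod_nonneg)
    qed
  qed
  also have "\<dots> = q ^ card F * (1 + q * (exp s - 1)) ^ card B * exp (- (s * a))"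
    using Pi_pmf_exp_moment(1)[OF fin F B FB, of d M C s] by (simp add: q_def)
  also have "\<dots> \<le> q ^ card F * exp (q * (exp s - 1)) ^ card B * exp (- (s * a))"
  proof (intro mult_right_mono mult_left_mono power_mono)
    show "1 + q * (exp s - 1) \<le> exp (q * (exp s - 1))" by (rule exp_ge_add_one_self)
    have "0 \<le> (1 - q) + q * exp s"
      by (intro add_nonneg_nonneg) (auto simp: q_def)
    then show "0 \<le> 1 + q * (exp s - 1)" by (simp add: algebra_simps)
  qed (auto simp: q_def)
  also have "\<dots> = q ^ card F * exp (q * (exp s - 1) * real (card B) - s * a)"
    by (simp add: exp_of_nat_mult[symmetric] exp_add[symmetric] algebra_simps)
  finally show ?thesis .
qed

definition random_relation :: "nat \<Rightarrow> real \<Rightarrow> (nat \<times> nat) set pmf" where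
  "random_relation n p =
     map_pmf (\<lambda>f. {z \<in> {..<n} \<times> {..<n}. f z})
       (Pi_pmf ({..<n} \<times> {..<n}) False (\<lambda>_. bernoulli_pmf p))"

abbreviation bip_edge :: "nat \<times> nat \<Rightarrow> (nat + nat) set" where
  "bip_edge z \<equiv> {Inl (fst z), Inr (snd z)}"

text \<open>
Reindexing the independent coins by pairs instead of two-element sets.
\<close>
lemma random_bipartite_conv:
  "random_bipartite n p =
     map_pmf (\<lambda>W. UGraph (Inl ` {..<n} \<union> Inr ` {..<n}) (bip_edge ` W)) (random_relation n p)"
proof -
  let ?I = "{..<n} \<times> {..<n}"
  let ?E = "{{Inl i, Inr j} | i j. i < n \<and> j < n} :: (nat + nat) set set"
  have inj: "inj bip_edge" by (rule injI) (auto simp: doubleton_eq_iff prod_eq_iff)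
  have E: "?E = bip_edge ` ?I" by force
  have bij: "bij_betw bip_edge ?I ?E" unfolding E using inj by (auto simp: bij_betw_def inj_on_def inj_def)
  have "Pi_pmf ?I False (\<lambda>_. bernoulli_pmf p) =
        map_pmf (\<lambda>g. g \<circ> bip_edge) (Pi_pmf ?E False (\<lambda>_. bernoulli_pmf p))"
    by (rule Pi_pmf_bij_betw[OF _ bij]) (use inj E in \<open>auto dest: injD\<close>)
  then have "map_pmf (\<lambda>W. UGraph (Inl ` {..<n} \<union> Inr ` {..<n}) (bip_edge ` W)) (random_relation n p) =
     map_pmf (\<lambda>g. UGraph (Inl ` {..<n} \<union> Inr ` {..<n}) (bip_edge ` {z \<in> ?I. g (bip_edge z)}))
       (Pi_pmf ?E False (\<lambda>_. bernoulli_pmf p))"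
    by (simp add: random_relation_def map_pmf_comp o_def)
  also have "(\<lambda>g. UGraph (Inl ` {..<n} \<union> Inr ` {..<n}) (bip_edge ` {z \<in> ?I. g (bip_edge z)})) =
     (\<lambda>g. UGraph (Inl ` {..<n} \<union> Inr ` {..<n}) {e \<in> ?E. g e})"
    unfolding E by (intro ext) auto
  finally show ?thesis
    by (simp add: random_bipartite_def random_subgraph_def complete_bipartite_def)
qed

lemma random_relation_tail:
  fixes a s p :: real
  assumes "0 \<le> p" "p \<le> 1" "F \<subseteq> {..<n} \<times> {..<n}" "B \<subseteq> {..<n} \<times> {..<n}" "F \<inter> B = {}" "0 \<le> s"
  shows "measure_pmf.prob (random_relation n p) {W. F \<subseteq> W \<and> a \<le> real (card (W \<inter> B))}
    \<le> p ^ card F * exp (p * (exp s - 1) * real (card B) - s * a)"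
proof -
  let ?I = "{..<n} \<times> {..<n}"
  have q: "measure_pmf.prob (bernoulli_pmf p) {True} = p"
    using assms by (simp add: measure_pmf_single)
  have "measure_pmf.prob (random_relation n p) {W. F \<subseteq> W \<and> a \<le> real (card (W \<inter> B))} =
    measure_pmf.prob (Pi_pmf ?I False (\<lambda>_. bernoulli_pmf p))
      {f. F \<subseteq> {z \<in> ?I. f z} \<and> a \<le> real (card ({z \<in> ?I. f z} \<inter> B))}"
    unfolding random_relation_def by (simp add: vimage_def)
  also have "\<dots> \<le> measure_pmf.prob (Pi_pmf ?I False (\<lambda>_. bernoulli_pmf p))
      {f. (\<forall>v\<in>F. f v \<in> {True}) \<and> s * a \<le> s * real (card {v\<in>B. f v \<in> {True}})}"
  proof (rule measure_pmf.finite_measure_mono)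
    have "{z \<in> ?I. f z} \<inter> B = {v\<in>B. f v \<in> {True}}" for f using assms(4) by auto
    then show "{f. F \<subseteq> {z \<in> ?I. f z} \<and> a \<le> real (card ({z \<in> ?I. f z} \<inter> B))}
      \<subseteq> {f. (\<forall>v\<in>F. f v \<in> {True}) \<and> s * a \<le> s * real (card {v\<in>B. f v \<in> {True}})}"
      using assms(6) by (auto intro!: mult_left_mono)
  qed auto
  also have "\<dots> \<le> p ^ card F * exp (p * (exp s - 1) * real (card B) - s * a)"
    using Pi_pmf_tail[where A = ?I and F = F and B = B and d = False and M = "bernoulli_pmf p"
        and s = s and a = a and C = "{True}"] assms q by simp
  finally show ?thesis .
qed

lemma exp_le_quadratic: "exp s \<le> 1 + s + s\<^sup>2" if "s \<le> 1" for s :: real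
proof (cases "0 \<le> s")
  case True then show ?thesis using exp_bound that by simp
next
  case False
  define u where "u = - s"
  have u: "u > 0" using False by (simp add: u_def)
  \<comment> \<open>multiplying by the second Taylor polynomial of \<open>exp u\<close> reduces the claim for \<open>exp (- u)\<close> to a polynomial identity\<close>
  have "(1 - u + u\<^sup>2) * (1 + u + u\<^sup>2 / 2) = 1 + u^2 / 2 + u^3 / 2 + u^4 / 2"
    by (simp add: power2_eq_square power3_eq_cube power4_eq_xxxx field_simps)
  then have "1 \<le> (1 - u + u\<^sup>2) * (1 + u + u\<^sup>2 / 2)" using u by simp
  also have "\<dots> \<le> (1 - u + u\<^sup>2) * exp u"
  proof (rule mult_left_mono)
    show "1 + u + u\<^sup>2 / 2 \<le> exp u" using exp_lower_Taylor_quadratic u by simp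
    have "1 - u + u\<^sup>2 = (u - 1/2)\<^sup>2 + 3/4" by (simp add: power2_eq_square algebra_simps)
    then show "0 \<le> 1 - u + u\<^sup>2" by (metis add_nonneg_nonneg divide_nonneg_nonneg zero_le_numeral zero_le_power2)
  qed
  finally have "exp (- u) \<le> 1 - u + u\<^sup>2" by (simp add: exp_minus field_simps)
  then show ?thesis by (simp add: u_def)
qed

text \<open>
Chernoff's inequality for small \<open>p\<close>: the deviation is measured relative to \<open>p m\<close>, where \<open>m\<close> may exceed the size of \<open>B\<close>; this gives additive error terms that stay meaningful for small sets.
\<close>
lemma random_relation_deviation:
  fixes \<eta> p m :: real
  assumes p: "0 \<le> p" "p \<le> 1" and FB: "F \<subseteq> {..<n} \<times> {..<n}" "B \<subseteq> {..<n} \<times> {..<n}" "F \<inter> B = {}"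
    and \<eta>: "0 \<le> \<eta>" "\<eta> \<le> 1" and m: "real (card B) \<le> m"
  shows "measure_pmf.prob (random_relation n p)
      {W. F \<subseteq> W \<and> p * real (card B) + \<eta> * p * m \<le> real (card (W \<inter> B))}
    \<le> p ^ card F * exp (- (\<eta>\<^sup>2 * p * m / 4))"
proof -
  \<comment> \<open>the exponent \<open>s\<^sup>2 - s \<eta>\<close> is minimal at \<open>s = \<eta> / 2\<close>\<close>
  let ?s = "\<eta> / 2" let ?b = "real (card B)"
  have "measure_pmf.prob (random_relation n p)
      {W. F \<subseteq> W \<and> p * ?b + \<eta> * p * m \<le> real (card (W \<inter> B))}
    \<le> p ^ card F * exp (p * (exp ?s - 1) * ?b - ?s * (p * ?b + \<eta> * p * m))"
    by (rule random_relation_tail) (use assms in auto)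
  also have "\<dots> \<le> p ^ card F * exp (- (\<eta>\<^sup>2 * p * m / 4))"
  proof (intro mult_left_mono)
    have "p * (exp ?s - 1) * ?b \<le> p * (?s + ?s\<^sup>2) * ?b"
      using exp_le_quadratic[of ?s] \<eta> p by (intro mult_right_mono mult_left_mono) auto
    moreover have "p * ?s\<^sup>2 * ?b \<le> p * ?s\<^sup>2 * m" using p m by (intro mult_left_mono) auto
    ultimately have "p * (exp ?s - 1) * ?b - ?s * (p * ?b + \<eta> * p * m) \<le> p * ?s\<^sup>2 * m - ?s * \<eta> * p * m"
      by (simp add: algebra_simps)
    also have "\<dots> = - (\<eta>\<^sup>2 * p * m / 4)" by (simp add: power2_eq_square field_simps)
    finally show "exp (p * (exp ?s - 1) * ?b - ?s * (p * ?b + \<eta> * p * m)) \<le> exp (- (\<eta>\<^sup>2 * p * m / 4))"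
      by simp
  qed (use p in auto)
  finally show ?thesis .
qed

text \<open>
The expected number of subsets of \<open>T\<close> contained in a random set of density \<open>p\<close>; it prices the union bound below.
\<close>
lemma sum_power_card_Pow: "finite T \<Longrightarrow> (\<Sum>F\<in>Pow T. p ^ card F) = (1 + p) ^ card T" for p :: real
proof (induction rule: finite_induct)
  case (insert x T)
  have inj: "inj_on (insert x) (Pow T)" using insert by (auto simp: inj_on_def)
  have "(\<Sum>F\<in>Pow (insert x T). p ^ card F) = (\<Sum>F\<in>Pow T. p ^ card F) + (\<Sum>F\<in>insert x ` Pow T. p ^ card F)"
    unfolding Pow_insert by (rule sum.union_disjoint) (use insert in auto)
  also have "(\<Sum>F\<in>insert x ` Pow T. p ^ card F) = (\<Sum>F\<in>Pow T. p * p ^ card F)"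
    unfolding sum.reindex[OF inj] o_def
  proof (rule sum.cong)
    fix F assume "F \<in> Pow T"
    then have "finite F" "x \<notin> F" using insert finite_subset by auto
    then show "p ^ card (insert x F) = p * p ^ card F" by simp
  qed auto
  finally show ?case using insert by (simp add: sum_distrib_left[symmetric] algebra_simps)
qed auto

text \<open>
A union bound in which the tested set \<open>B i F\<close> may depend on the random relation, but only through its
restriction \<open>F\<close> to a small set \<open>T i\<close> of pairs.  Since \<open>B i F\<close> is disjoint from \<open>T i\<close>, the edges in it are
independent of \<open>F\<close>, and summing over all \<open>F\<close> costs only a factor \<open>exp (p |T i|)\<close>.
\<close>
lemma random_relation_container:
  fixes \<eta> p \<gamma> M :: real and m :: "'i \<Rightarrow> real"
  assumes p: "0 \<le> p" "p \<le> 1" and \<eta>: "0 \<le> \<eta>" "\<eta> \<le> 1" and finI: "finite I"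
    and T: "\<And>i. i \<in> I \<Longrightarrow> T i \<subseteq> {..<n} \<times> {..<n} \<and> real (card (T i)) \<le> \<gamma>"
    and B: "\<And>i F. i \<in> I \<Longrightarrow> F \<subseteq> T i \<Longrightarrow> B i F \<subseteq> {..<n} \<times> {..<n} \<and> T i \<inter> B i F = {} \<and> real (card (B i F)) \<le> m i"
    and M: "\<And>i. i \<in> I \<Longrightarrow> M \<le> \<eta>\<^sup>2 * p * m i / 4"
  shows "measure_pmf.prob (random_relation n p)
      {W. \<exists>i\<in>I. \<exists>F. F \<subseteq> T i \<and> F \<subseteq> W \<and>
        p * real (card (B i F)) + \<eta> * p * m i \<le> real (card (W \<inter> B i F))}
    \<le> real (card I) * exp (p * \<gamma> - M)" (is "measure_pmf.prob ?P ?S \<le> _")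
proof -
  let ?X = "\<lambda>i F. {W. F \<subseteq> W \<and> p * real (card (B i F)) + \<eta> * p * m i \<le> real (card (W \<inter> B i F))}"
  have finT: "finite (T i)" if "i \<in> I" for i using T[OF that] finite_subset by blast
  have "measure_pmf.prob ?P ?S \<le> measure_pmf.prob ?P (\<Union>i\<in>I. \<Union>F\<in>Pow (T i). ?X i F)"
    by (rule measure_pmf.finite_measure_mono) auto
  also have "\<dots> \<le> (\<Sum>i\<in>I. measure_pmf.prob ?P (\<Union>F\<in>Pow (T i). ?X i F))"
    by (rule measure_pmf.finite_measure_subadditive_finite) (use finI in auto)
  also have "\<dots> \<le> (\<Sum>i\<in>I. exp (p * \<gamma> - M))"
  proof (rule sum_mono)
    fix i assume i: "i \<in> I"
    have "measure_pmf.prob ?P (\<Union>F\<in>Pow (T i). ?X i F) \<le> (\<Sum>F\<in>Pow (T i). measure_pmf.prob ?P (?X i F))"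
      by (rule measure_pmf.finite_measure_subadditive_finite) (use finT i in auto)
    also have "\<dots> \<le> (\<Sum>F\<in>Pow (T i). p ^ card F * exp (- (\<eta>\<^sup>2 * p * m i / 4)))"
    proof (rule sum_mono)
      fix F assume "F \<in> Pow (T i)"
      then show "measure_pmf.prob ?P (?X i F) \<le> p ^ card F * exp (- (\<eta>\<^sup>2 * p * m i / 4))"
        using T[OF i] B[OF i, of F] by (intro random_relation_deviation p \<eta>) auto
    qed
    also have "\<dots> = (1 + p) ^ card (T i) * exp (- (\<eta>\<^sup>2 * p * m i / 4))"
      using finT[OF i] by (simp add: sum_distrib_right[symmetric] sum_power_card_Pow)
    also have "\<dots> \<le> exp p ^ card (T i) * exp (- (\<eta>\<^sup>2 * p * m i / 4))"
      using p exp_ge_add_one_self[of p] by (intro mult_right_mono power_mono) auto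
    also have "\<dots> = exp (p * real (card (T i)) - \<eta>\<^sup>2 * p * m i / 4)"
      by (simp add: exp_of_nat_mult[symmetric] exp_add[symmetric] algebra_simps)
    also have "\<dots> \<le> exp (p * \<gamma> - M)"
      using T[OF i] M[OF i] p mult_left_mono[of "real (card (T i))" \<gamma> p] by auto
    finally show "measure_pmf.prob ?P (\<Union>F\<in>Pow (T i). ?X i F) \<le> exp (p * \<gamma> - M)" .
  qed
  also have "\<dots> = real (card I) * exp (p * \<gamma> - M)" by simp
  finally show ?thesis .
qed

section \<open>Balanced colourings\<close>

text \<open>
The probabilistic method: in a random colouring with distribution \<open>M\<close> each colour class hits each member of \<open>\<S>\<close> in the expected proportion, unless one of few unlikely events occurs.
\<close>
lemma balanced_colouring:
  fixes M :: "'c pmf" and \<zeta> m :: real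
  assumes fin: "finite V" "finite \<S>" "finite J" and \<zeta>: "0 < \<zeta>" "\<zeta> \<le> 1"
    and S: "\<And>S. S \<in> \<S> \<Longrightarrow> S \<subseteq> V \<and> m \<le> real (card S)"
    and small: "2 * real (card \<S>) * real (card J) * exp (- (\<zeta>\<^sup>2 * m / 4)) < 1"
  shows "\<exists>f :: 'a \<Rightarrow> 'c. \<forall>S\<in>\<S>. \<forall>i\<in>J.
    \<bar>real (card {v\<in>S. f v = i}) - pmf M i * real (card S)\<bar> \<le> \<zeta> * real (card S)"
proof -
  let ?P = "Pi_pmf V undefined (\<lambda>_. M)"
  define bad where "bad S i = {f :: 'a \<Rightarrow> 'c. (pmf M i + \<zeta>) * real (card S) \<le> real (card {v\<in>S. f v = i})} \<union>
    {f. real (card {v\<in>S. f v = i}) \<le> (pmf M i - \<zeta>) * real (card S)}" for S i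
  have bad: "measure_pmf.prob ?P (bad S i) \<le> 2 * exp (- (\<zeta>\<^sup>2 * m / 4))" if S': "S \<in> \<S>" for S i
  proof -
    let ?q = "pmf M i" and ?c = "real (card S)"
    have SV: "S \<subseteq> V" and mS: "m \<le> ?c" using S[OF S'] by auto
    have q: "measure_pmf.prob M {i} = ?q" by (simp add: measure_pmf_single)
    \<comment> \<open>both tails at once: \<open>s = \<zeta>/2\<close> for large counts, \<open>s = -\<zeta>/2\<close> for small ones\<close>
    have key: "measure_pmf.prob ?P {f. s * a \<le> s * real (card {v\<in>S. f v = i})} \<le> exp (- (\<zeta>\<^sup>2 * m / 4))"
      if s: "\<bar>s\<bar> = \<zeta> / 2" and a: "s * a = (s * ?q + \<zeta>\<^sup>2 / 2) * ?c" for s a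
    proof -
      have "s\<^sup>2 = \<bar>s\<bar>\<^sup>2" by simp
      also have "\<dots> = \<zeta>\<^sup>2 / 4" by (simp only: s power_divide) simp
      finally have s2: "s\<^sup>2 = \<zeta>\<^sup>2 / 4" .
      have "measure_pmf.prob ?P {f. s * a \<le> s * real (card {v\<in>S. f v = i})}
         \<le> exp (?q * (exp s - 1) * ?c - s * a)"
        using Pi_pmf_tail[where A = V and F = "{}" and B = S and d = undefined and M = M
            and s = s and a = a and C = "{i}"] fin SV q by simp
      also have "\<dots> \<le> exp (?q * (s + s\<^sup>2) * ?c - s * a)"
      proof -
        have "s \<le> 1" using s \<zeta> by linarith
        then have "exp s - 1 \<le> s + s\<^sup>2" using exp_le_quadratic[of s] by linarith
        then have "?q * (exp s - 1) * ?c \<le> ?q * (s + s\<^sup>2) * ?c"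
          by (intro mult_right_mono mult_left_mono) auto
        then show ?thesis by simp
      qed
      also have "\<dots> = exp ((?q * s\<^sup>2 - \<zeta>\<^sup>2 / 2) * ?c)" by (simp only: a) (simp add: algebra_simps)
      also have "\<dots> \<le> exp ((- (\<zeta>\<^sup>2 / 4)) * ?c)"
      proof -
        have "?q * s\<^sup>2 \<le> 1 * s\<^sup>2" by (intro mult_right_mono) (auto simp: pmf_le_1)
        then have "?q * s\<^sup>2 - \<zeta>\<^sup>2 / 2 \<le> - (\<zeta>\<^sup>2 / 4)" using s2 by linarith
        then have "(?q * s\<^sup>2 - \<zeta>\<^sup>2 / 2) * ?c \<le> (- (\<zeta>\<^sup>2 / 4)) * ?c" by (intro mult_right_mono) auto
        then show ?thesis by simp
      qed
      also have "\<dots> \<le> exp (- (\<zeta>\<^sup>2 * m / 4))"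
        using mult_left_mono[OF mS, of "\<zeta>\<^sup>2 / 4"] by simp
      finally show ?thesis .
    qed
    have "measure_pmf.prob ?P (bad S i) \<le>
        measure_pmf.prob ?P {f. (pmf M i + \<zeta>) * ?c \<le> real (card {v\<in>S. f v = i})} +
        measure_pmf.prob ?P {f. real (card {v\<in>S. f v = i}) \<le> (pmf M i - \<zeta>) * ?c}"
      unfolding bad_def by (rule measure_Un_le) auto
    moreover have "measure_pmf.prob ?P {f. (pmf M i + \<zeta>) * ?c \<le> real (card {v\<in>S. f v = i})}
        \<le> exp (- (\<zeta>\<^sup>2 * m / 4))"
    proof -
      have iff: "\<zeta> / 2 * x \<le> \<zeta> / 2 * y \<longleftrightarrow> x \<le> y" for x y using \<zeta> by simp
      have eq: "\<zeta> / 2 * ((?q + \<zeta>) * ?c) = (\<zeta> / 2 * ?q + \<zeta>\<^sup>2 / 2) * ?c"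
        by (simp add: power2_eq_square field_simps)
      have "measure_pmf.prob ?P {f. \<zeta> / 2 * ((?q + \<zeta>) * ?c) \<le> \<zeta> / 2 * real (card {v\<in>S. f v = i})} \<le> exp (- (\<zeta>\<^sup>2 * m / 4))"
        by (rule key) (use \<zeta> eq in auto)
      then show ?thesis by (simp only: iff)
    qed
    moreover have "measure_pmf.prob ?P {f. real (card {v\<in>S. f v = i}) \<le> (pmf M i - \<zeta>) * ?c}
        \<le> exp (- (\<zeta>\<^sup>2 * m / 4))"
    proof -
      have iff: "- \<zeta> / 2 * x \<le> - \<zeta> / 2 * y \<longleftrightarrow> y \<le> x" for x y using \<zeta> by simp
      have eq: "- \<zeta> / 2 * ((?q - \<zeta>) * ?c) = (- \<zeta> / 2 * ?q + \<zeta>\<^sup>2 / 2) * ?c"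
        by (simp add: power2_eq_square field_simps)
      have "measure_pmf.prob ?P {f. - \<zeta> / 2 * ((?q - \<zeta>) * ?c) \<le> - \<zeta> / 2 * real (card {v\<in>S. f v = i})} \<le> exp (- (\<zeta>\<^sup>2 * m / 4))"
        by (rule key) (use \<zeta> eq in auto)
      then show ?thesis by (simp only: iff)
    qed
    ultimately show ?thesis by simp
  qed
  have "measure_pmf.prob ?P (\<Union>(S, i)\<in>\<S> \<times> J. bad S i) \<le> (\<Sum>(S, i)\<in>\<S> \<times> J. measure_pmf.prob ?P (bad S i))"
    using measure_pmf.finite_measure_subadditive_finite[of "\<S> \<times> J" "\<lambda>(S, i). bad S i" ?P] fin
    by (simp add: case_prod_unfold)
  also have "\<dots> \<le> (\<Sum>(S, i)\<in>\<S> \<times> J. 2 * exp (- (\<zeta>\<^sup>2 * m / 4)))"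
    by (rule sum_mono) (use bad in auto)
  also have "\<dots> < 1" using small by (simp add: card_cartesian_product mult_ac)
  finally have "measure_pmf.prob ?P (\<Union>(S, i)\<in>\<S> \<times> J. bad S i) \<noteq> measure_pmf.prob ?P UNIV" by simp
  then have "(\<Union>(S, i)\<in>\<S> \<times> J. bad S i) \<noteq> UNIV" by metis
  then obtain f where f: "f \<notin> (\<Union>(S, i)\<in>\<S> \<times> J. bad S i)" by blast
  have "\<bar>real (card {v\<in>S. f v = i}) - pmf M i * real (card S)\<bar> \<le> \<zeta> * real (card S)"
    if "S \<in> \<S>" "i \<in> J" for S i
  proof -
    have "f \<notin> bad S i" using f that by auto
    then show ?thesis by (auto simp: bad_def abs_le_iff algebra_simps)
  qed
  then show ?thesis by blast
qed


section \<open>Typical properties of the random bipartite graph\<close>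

text \<open>
Each such set is the set of entries below \<open>n\<close> of a list of length \<open>k\<close> over \<open>{..n}\<close>; the entry \<open>n\<close> serves as padding.
\<close>
lemma card_small_subsets:
  "finite {A. A \<subseteq> {..<n} \<and> card A \<le> k}" "card {A. A \<subseteq> {..<n} \<and> card A \<le> k} \<le> (n + 1) ^ k"
proof -
  let ?L = "{xs. set xs \<subseteq> {..n} \<and> length xs = k}"
  have sub: "{A. A \<subseteq> {..<n} \<and> card A \<le> k} \<subseteq> (\<lambda>xs. set xs \<inter> {..<n}) ` ?L"
  proof
    fix A assume A: "A \<in> {A. A \<subseteq> {..<n} \<and> card A \<le> k}"
    then have "finite A" using finite_subset by auto
    then obtain xs where xs: "set xs = A" "distinct xs" using finite_distinct_list by blast
    have len: "length xs \<le> k" using A xs distinct_card by fastforce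
    define ys where "ys = xs @ replicate (k - length xs) n"
    have "ys \<in> ?L" "set ys \<inter> {..<n} = A" using A xs len by (auto simp: ys_def)
    then show "A \<in> (\<lambda>xs. set xs \<inter> {..<n}) ` ?L" by (intro image_eqI[where x = ys]) auto
  qed
  have fin: "finite ?L" by (rule finite_lists_length_eq) simp
  show "finite {A. A \<subseteq> {..<n} \<and> card A \<le> k}" using sub fin finite_surj by blast
  have "card {A. A \<subseteq> {..<n} \<and> card A \<le> k} \<le> card ((\<lambda>xs. set xs \<inter> {..<n}) ` ?L)"
    using sub fin by (intro card_mono) auto
  also have "\<dots> \<le> card ?L" by (rule card_image_le) (rule fin)
  also have "\<dots> = (n + 1) ^ k" by (simp add: card_lists_length_eq)
  finally show "card {A. A \<subseteq> {..<n} \<and> card A \<le> k} \<le> (n + 1) ^ k" .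
qed

definition uniform_above :: "nat \<Rightarrow> real \<Rightarrow> real \<Rightarrow> (nat \<times> nat) set \<Rightarrow> bool" where
  "uniform_above n p \<eta> W \<longleftrightarrow> (\<forall>A\<subseteq>{..<n}. \<forall>B\<subseteq>{..<n}.
     real (card (W \<inter> A \<times> B)) \<le> p * real (card A) * real (card B) + \<eta> * p * (real n)\<^sup>2)"

definition sublinear_uniform_above :: "nat \<Rightarrow> real \<Rightarrow> real \<Rightarrow> real \<Rightarrow> (nat \<times> nat) set \<Rightarrow> bool" where
  "sublinear_uniform_above n p K \<eta> W \<longleftrightarrow> (\<forall>A\<subseteq>{..<n}. \<forall>B\<subseteq>{..<n}. K \<le> p * real (card A) \<longrightarrow>
     real (card (W \<inter> A \<times> B)) \<le> p * real (card A) * real (card B) + \<eta> * p * real n * real (card A))"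

text \<open>
The size of \<open>B\<close> is fixed because it is applied to part of the neighbourhood of one vertex; a larger \<open>B\<close> may be shrunk.
\<close>
definition small_sets_expand :: "nat \<Rightarrow> real \<Rightarrow> real \<Rightarrow> real \<Rightarrow> (nat \<times> nat) set \<Rightarrow> bool" where
  "small_sets_expand n p c K W \<longleftrightarrow> (\<forall>A\<subseteq>{..<n}. \<forall>B\<subseteq>{..<n}.
     p * real (card A) \<le> K \<and> card B = nat \<lceil>c * real n * p\<rceil> \<longrightarrow>
     real (card (W \<inter> A \<times> B)) < c * real n * p * real (card B))"

text \<open>
Paths of length \<open>2 r + 1\<close> from the left to the right whose inner vertices have colours \<open>r, r, \<dots>, 1, 1\<close>.
\<close>
fun linked :: "(nat \<times> nat) set \<Rightarrow> (nat \<Rightarrow> nat) \<Rightarrow> (nat \<Rightarrow> nat) \<Rightarrow> nat \<Rightarrow> (nat \<times> nat) set" where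
  "linked F f g 0 = F"
| "linked F f g (Suc r) =
     {(u, v). \<exists>a b. f a = Suc r \<and> g b = Suc r \<and> (u, b) \<in> F \<and> (a, b) \<in> F \<and> (a, v) \<in> linked F f g r}"

text \<open>
Colours 1, 2 and 3 are reserved for inner vertices, 0 is the main class, and 4 marks vertices outside the core.
\<close>
definition reserve_pairs :: "nat \<Rightarrow> (nat \<Rightarrow> nat) \<Rightarrow> (nat \<Rightarrow> nat) \<Rightarrow> (nat \<times> nat) set" where
  "reserve_pairs n f g = {(i, j). i < n \<and> j < n \<and> (f i \<in> {1,2,3} \<or> g j \<in> {1,2,3})}"

definition unlinked_pairs :: "nat \<Rightarrow> (nat \<Rightarrow> nat) \<Rightarrow> (nat \<Rightarrow> nat) \<Rightarrow> (nat \<times> nat) set \<Rightarrow> nat \<Rightarrow> (nat \<times> nat) set" where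
  "unlinked_pairs n f g F r = {(i, j). i < n \<and> j < n \<and> f i = 0 \<and> g j = 0 \<and> (i, j) \<notin> linked F f g r}"

definition unlinked_uniform_above :: "nat \<Rightarrow> real \<Rightarrow> real \<Rightarrow> real \<Rightarrow> (nat \<times> nat) set \<Rightarrow> bool" where
  "unlinked_uniform_above n p \<rho> \<eta> W \<longleftrightarrow>
    (\<forall>f\<in>{..<n} \<rightarrow>\<^sub>E {..<5}. \<forall>g\<in>{..<n} \<rightarrow>\<^sub>E {..<5}. \<forall>r\<in>{1,2,3}. \<forall>F\<subseteq>W \<inter> reserve_pairs n f g.
      real (card {i. i < n \<and> f i \<in> {1,2,3}}) \<le> \<rho> * real n \<longrightarrow>
      real (card {i. i < n \<and> g i \<in> {1,2,3}}) \<le> \<rho> * real n \<longrightarrow>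
      real (card (W \<inter> unlinked_pairs n f g F r))
        \<le> p * real (card (unlinked_pairs n f g F r)) + \<eta> * p * (real n)\<^sup>2)"

lemma power_le_exp: "real k ^ n \<le> exp (real n * L)" if "real k \<le> exp L"
proof -
  have "real k ^ n \<le> exp L ^ n" using that by (intro power_mono) auto
  then show ?thesis by (simp add: exp_of_nat_mult)
qed

lemma prob_tendsto_0I:
  fixes P :: "nat \<Rightarrow> 'a pmf"
  assumes "\<forall>\<^sub>F n in sequentially. measure_pmf.prob (P n) (S n) \<le> g n" "g \<longlonglongrightarrow> 0"
  shows "(\<lambda>n. measure_pmf.prob (P n) (S n)) \<longlonglongrightarrow> 0"
  by (rule tendsto_sandwich[OF _ assms(1) tendsto_const assms(2)]) auto

lemma uniform_above_whp:
  fixes p :: "nat \<Rightarrow> real"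
  assumes p: "\<And>n. 0 \<le> p n \<and> p n \<le> 1" and np: "filterlim (\<lambda>n. real n * p n) at_top sequentially"
    and \<eta>: "0 < \<eta>" "\<eta> \<le> 1"
  shows "(\<lambda>n. measure_pmf.prob (random_relation n (p n)) {W. \<not> uniform_above n (p n) \<eta> W}) \<longlonglongrightarrow> 0"
proof (rule prob_tendsto_0I)
  show "(\<lambda>n. exp (- real n)) \<longlonglongrightarrow> 0" by real_asymp
  have "\<forall>\<^sub>F n in sequentially. 16 / \<eta>\<^sup>2 \<le> real n * p n"
    using np by (simp add: filterlim_at_top)
  then show "\<forall>\<^sub>F n in sequentially.
      measure_pmf.prob (random_relation n (p n)) {W. \<not> uniform_above n (p n) \<eta> W} \<le> exp (- real n)"
  proof eventually_elim
    case (elim n)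
    let ?I = "Pow {..<n} \<times> Pow {..<n}"
    have "measure_pmf.prob (random_relation n (p n)) {W. \<not> uniform_above n (p n) \<eta> W} \<le>
       measure_pmf.prob (random_relation n (p n)) {W. \<exists>i\<in>?I. \<exists>F. F \<subseteq> {} \<and> F \<subseteq> W \<and>
        p n * real (card (fst i \<times> snd i)) + \<eta> * p n * (real n)\<^sup>2 \<le> real (card (W \<inter> fst i \<times> snd i))}"
    proof (rule measure_pmf.finite_measure_mono, rule subsetI)
      fix W assume "W \<in> {W. \<not> uniform_above n (p n) \<eta> W}"
      then obtain A B where AB: "A \<subseteq> {..<n}" "B \<subseteq> {..<n}"
        "p n * real (card A) * real (card B) + \<eta> * p n * (real n)\<^sup>2 < real (card (W \<inter> A \<times> B))"
        unfolding uniform_above_def by (auto simp: not_le)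
      then have "(A, B) \<in> ?I" "p n * real (card (fst (A, B) \<times> snd (A, B))) + \<eta> * p n * (real n)\<^sup>2
          \<le> real (card (W \<inter> fst (A, B) \<times> snd (A, B)))"
        by (auto simp: card_cartesian_product mult.assoc)
      then show "W \<in> {W. \<exists>i\<in>?I. \<exists>F. F \<subseteq> {} \<and> F \<subseteq> W \<and>
        p n * real (card (fst i \<times> snd i)) + \<eta> * p n * (real n)\<^sup>2 \<le> real (card (W \<inter> fst i \<times> snd i))}" by blast
    qed auto
    also have "\<dots> \<le> real (card ?I) * exp (p n * 0 - 4 * real n)"
    proof (rule random_relation_container)
      fix i :: "nat set \<times> nat set" and F assume i: "i \<in> ?I"
      then have "card (fst i) \<le> n" "card (snd i) \<le> n" using subset_eq_atLeast0_lessThan_card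
        by (auto simp: lessThan_atLeast0)
      then have "card (fst i) * card (snd i) \<le> n * n" by (intro mult_le_mono)
      then show "fst i \<times> snd i \<subseteq> {..<n} \<times> {..<n} \<and> {} \<inter> fst i \<times> snd i = {} \<and>
        real (card (fst i \<times> snd i)) \<le> (real n)\<^sup>2"
        using i by (auto simp: card_cartesian_product power2_eq_square simp flip: of_nat_mult)
    next
      fix i :: "nat set \<times> nat set"
      have "16 \<le> \<eta>\<^sup>2 * (real n * p n)" using elim \<eta> by (simp add: field_simps)
      then have "16 * real n \<le> \<eta>\<^sup>2 * (real n * p n) * real n" by (rule mult_right_mono) auto
      then show "4 * real n \<le> \<eta>\<^sup>2 * p n * (real n)\<^sup>2 / 4" by (simp add: power2_eq_square mult_ac)
    qed (use p \<eta> in auto)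
    also have "real (card ?I) \<le> exp (real n * 3)"
    proof -
      have "real (card ?I) = real 4 ^ n"
        by (simp add: card_cartesian_product card_Pow power_mult_distrib[symmetric])
      also have "\<dots> \<le> exp (real n * 3)"
        by (rule power_le_exp) (use exp_ge_add_one_self[of "3::real"] in simp)
      finally show ?thesis .
    qed
    also have "exp (real n * 3) * exp (p n * 0 - 4 * real n) = exp (- real n)"
      by (simp add: exp_add[symmetric])
    finally show ?case by (simp add: mult_right_mono)
  qed
qed

lemma sublinear_uniform_above_whp:
  fixes p :: "nat \<Rightarrow> real"
  assumes p: "\<And>n. 0 \<le> p n \<and> p n \<le> 1"
    and \<eta>: "0 < \<eta>" "\<eta> \<le> 1" and K: "16 / \<eta>\<^sup>2 \<le> K"
  shows "(\<lambda>n. measure_pmf.prob (random_relation n (p n)) {W. \<not> sublinear_uniform_above n (p n) K \<eta> W}) \<longlonglongrightarrow> 0"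
proof (rule prob_tendsto_0I)
  show "(\<lambda>n. exp (- real n)) \<longlonglongrightarrow> 0" by real_asymp
  show "\<forall>\<^sub>F n in sequentially.
      measure_pmf.prob (random_relation n (p n)) {W. \<not> sublinear_uniform_above n (p n) K \<eta> W} \<le> exp (- real n)"
  proof (rule always_eventually, rule allI)
    fix n
    let ?I = "{i \<in> Pow {..<n} \<times> Pow {..<n}. K \<le> p n * real (card (fst i))}"
    have "measure_pmf.prob (random_relation n (p n)) {W. \<not> sublinear_uniform_above n (p n) K \<eta> W} \<le>
       measure_pmf.prob (random_relation n (p n)) {W. \<exists>i\<in>?I. \<exists>F. F \<subseteq> {} \<and> F \<subseteq> W \<and>
        p n * real (card (fst i \<times> snd i)) + \<eta> * p n * (real n * real (card (fst i))) \<le> real (card (W \<inter> fst i \<times> snd i))}"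
    proof (rule measure_pmf.finite_measure_mono, rule subsetI)
      fix W assume "W \<in> {W. \<not> sublinear_uniform_above n (p n) K \<eta> W}"
      then obtain A B where AB: "A \<subseteq> {..<n}" "B \<subseteq> {..<n}" "K \<le> p n * real (card A)"
        "p n * real (card A) * real (card B) + \<eta> * p n * real n * real (card A) < real (card (W \<inter> A \<times> B))"
        unfolding sublinear_uniform_above_def by (auto simp: not_le)
      then have "(A, B) \<in> ?I" "p n * real (card (fst (A, B) \<times> snd (A, B))) +
          \<eta> * p n * (real n * real (card (fst (A, B)))) \<le> real (card (W \<inter> fst (A, B) \<times> snd (A, B)))"
        by (auto simp: card_cartesian_product mult.assoc)
      then show "W \<in> {W. \<exists>i\<in>?I. \<exists>F. F \<subseteq> {} \<and> F \<subseteq> W \<and>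
        p n * real (card (fst i \<times> snd i)) + \<eta> * p n * (real n * real (card (fst i))) \<le> real (card (W \<inter> fst i \<times> snd i))}" by blast
    qed auto
    also have "\<dots> \<le> real (card ?I) * exp (p n * 0 - 4 * real n)"
    proof (rule random_relation_container)
      fix i :: "nat set \<times> nat set" and F assume i: "i \<in> ?I"
      then have "card (snd i) \<le> n" using subset_eq_atLeast0_lessThan_card
        by (auto simp: lessThan_atLeast0)
      then have "card (fst i) * card (snd i) \<le> n * card (fst i)" by (simp add: mult.commute)
      then show "fst i \<times> snd i \<subseteq> {..<n} \<times> {..<n} \<and> {} \<inter> fst i \<times> snd i = {} \<and>
        real (card (fst i \<times> snd i)) \<le> real n * real (card (fst i))"
        using i by (auto simp: card_cartesian_product simp flip: of_nat_mult)
    next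
      fix i :: "nat set \<times> nat set" assume i: "i \<in> ?I"
      have "16 \<le> \<eta>\<^sup>2 * K" using K \<eta> by (simp add: field_simps)
      also have "\<dots> \<le> \<eta>\<^sup>2 * (p n * real (card (fst i)))" using i by (intro mult_left_mono) auto
      finally have "16 * real n \<le> \<eta>\<^sup>2 * (p n * real (card (fst i))) * real n" by (rule mult_right_mono) auto
      then show "4 * real n \<le> \<eta>\<^sup>2 * p n * (real n * real (card (fst i))) / 4" by (simp add: mult_ac)
    qed (use p \<eta> in auto)
    also have "real (card ?I) \<le> exp (real n * 3)"
    proof -
      have "card ?I \<le> card (Pow {..<n} \<times> Pow {..<n})" by (intro card_mono) auto
      then have "real (card ?I) \<le> real (card (Pow {..<n} \<times> Pow {..<n}))" by (rule of_nat_mono)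
      also have "\<dots> = real 4 ^ n"
        by (simp add: card_cartesian_product card_Pow power_mult_distrib[symmetric])
      also have "\<dots> \<le> exp (real n * 3)"
        by (rule power_le_exp) (use exp_ge_add_one_self[of "3::real"] in simp)
      finally show ?thesis .
    qed
    also have "exp (real n * 3) * exp (p n * 0 - 4 * real n) = exp (- real n)"
      by (simp add: exp_add[symmetric])
    finally show "measure_pmf.prob (random_relation n (p n)) {W. \<not> sublinear_uniform_above n (p n) K \<eta> W} \<le> exp (- real n)"
      by (simp add: mult_right_mono)
  qed
qed


text \<open>
The pairs whose number is bounded are determined by two colourings, the index \<open>r\<close> and the edges at the reserve.  The latter come from at most \<open>2 \<rho> n\<^sup>2\<close> pairs, and \<open>2 \<rho> p n\<^sup>2\<close> is at most half of the deviation exponent \<open>\<eta>\<^sup>2 p n\<^sup>2 / 4\<close>.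
\<close>
lemma unlinked_uniform_above_whp:
  fixes p :: "nat \<Rightarrow> real"
  assumes p: "\<And>n. 0 \<le> p n \<and> p n \<le> 1" and np: "filterlim (\<lambda>n. real n * p n) at_top sequentially"
    and \<eta>: "0 < \<eta>" "\<eta> \<le> 1" and \<rho>: "0 \<le> \<rho>" "\<rho> \<le> \<eta>\<^sup>2 / 16"
  shows "(\<lambda>n. measure_pmf.prob (random_relation n (p n)) {W. \<not> unlinked_uniform_above n (p n) \<rho> \<eta> W}) \<longlonglongrightarrow> 0"
proof (rule prob_tendsto_0I)
  show "(\<lambda>n. 3 * exp (- real n)) \<longlonglongrightarrow> 0" by real_asymp
  have "\<forall>\<^sub>F n in sequentially. 80 / \<eta>\<^sup>2 \<le> real n * p n"
    using np by (simp add: filterlim_at_top)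
  then show "\<forall>\<^sub>F n in sequentially.
      measure_pmf.prob (random_relation n (p n)) {W. \<not> unlinked_uniform_above n (p n) \<rho> \<eta> W} \<le> 3 * exp (- real n)"
  proof eventually_elim
    case (elim n)
    let ?C = "{..<n} \<rightarrow>\<^sub>E {..<5::nat}"
    let ?res = "\<lambda>f. {i. i < n \<and> f i \<in> {1,2,3::nat}}"
    define I where "I = {(f, g, r). f \<in> ?C \<and> g \<in> ?C \<and> r \<in> {1,2,3::nat} \<and>
       real (card (?res f)) \<le> \<rho> * real n \<and> real (card (?res g)) \<le> \<rho> * real n}"
    define T where "T i = (case i of (f, g, r :: nat) \<Rightarrow> reserve_pairs n f g)" for i
    define B where "B i F = (case i of (f, g, r) \<Rightarrow> unlinked_pairs n f g F r)" for i F
    have Isub: "I \<subseteq> ?C \<times> ?C \<times> {1,2,3}" by (auto simp: I_def)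
    have finC: "finite ?C" by (intro finite_PiE) auto
    have finI: "finite I" by (rule finite_subset[OF Isub]) (use finC in auto)
    have cardI: "real (card I) \<le> 3 * exp (real n * 8)"
    proof -
      have "card I \<le> card (?C \<times> ?C \<times> {1,2,3::nat})" by (rule card_mono[OF _ Isub]) (use finC in auto)
      also have "\<dots> = 3 * 25 ^ n"
      proof -
        have "card ?C = 5 ^ n" by (simp add: card_PiE)
        moreover have "(25::nat) ^ n = 5 ^ n * 5 ^ n" by (simp add: power_mult_distrib[symmetric])
        ultimately show ?thesis by (simp add: card_cartesian_product)
      qed
      finally have "real (card I) \<le> real (3 * 25 ^ n)" by (rule of_nat_mono)
      also have "\<dots> = 3 * real 25 ^ n" by simp
      also have "real 25 ^ n \<le> exp (real n * 8)"
      proof (rule power_le_exp)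
        have "real 25 \<le> (1 + 4) ^ 2" by simp
        also have "\<dots> \<le> exp 4 ^ 2" using exp_ge_add_one_self[of "4::real"] by (intro power_mono) auto
        also have "\<dots> = exp 8" by (simp add: exp_of_nat_mult[symmetric])
        finally show "real 25 \<le> exp 8" .
      qed
      finally show ?thesis by simp
    qed
    have "measure_pmf.prob (random_relation n (p n)) {W. \<not> unlinked_uniform_above n (p n) \<rho> \<eta> W} \<le>
       measure_pmf.prob (random_relation n (p n)) {W. \<exists>i\<in>I. \<exists>F. F \<subseteq> T i \<and> F \<subseteq> W \<and>
        p n * real (card (B i F)) + \<eta> * p n * (real n)\<^sup>2 \<le> real (card (W \<inter> B i F))}"
    proof (rule measure_pmf.finite_measure_mono, rule subsetI)
      fix W assume "W \<in> {W. \<not> unlinked_uniform_above n (p n) \<rho> \<eta> W}"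
      then obtain f g r F where *: "f \<in> ?C" "g \<in> ?C" "r \<in> {1,2,3}" "F \<subseteq> W \<inter> reserve_pairs n f g"
        "real (card (?res f)) \<le> \<rho> * real n" "real (card (?res g)) \<le> \<rho> * real n"
        "\<not> real (card (W \<inter> unlinked_pairs n f g F r))
          \<le> p n * real (card (unlinked_pairs n f g F r)) + \<eta> * p n * (real n)\<^sup>2"
        unfolding unlinked_uniform_above_def by blast
      then have "(f, g, r) \<in> I" "F \<subseteq> T (f, g, r)" "F \<subseteq> W"
        "p n * real (card (B (f, g, r) F)) + \<eta> * p n * (real n)\<^sup>2 \<le> real (card (W \<inter> B (f, g, r) F))"
        by (auto simp: I_def T_def B_def)
      then show "W \<in> {W. \<exists>i\<in>I. \<exists>F. F \<subseteq> T i \<and> F \<subseteq> W \<and>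
        p n * real (card (B i F)) + \<eta> * p n * (real n)\<^sup>2 \<le> real (card (W \<inter> B i F))}" by blast
    qed auto
    also have "\<dots> \<le> real (card I) * exp (p n * (2 * \<rho> * (real n)\<^sup>2) - \<eta>\<^sup>2 * p n * (real n)\<^sup>2 / 4)"
    proof (rule random_relation_container[OF _ _ _ _ finI])
      fix i assume i: "i \<in> I"
      obtain f g r where fgr: "i = (f, g, r)" by (cases i)
      have 1: "real (card (?res f)) \<le> \<rho> * real n" "real (card (?res g)) \<le> \<rho> * real n"
        using i by (auto simp: I_def fgr)
      have "T i \<subseteq> ?res f \<times> {..<n} \<union> {..<n} \<times> ?res g" by (auto simp: T_def fgr reserve_pairs_def)
      then have "card (T i) \<le> card (?res f \<times> {..<n} \<union> {..<n} \<times> ?res g)" by (intro card_mono) auto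
      also have "\<dots> \<le> card (?res f \<times> {..<n}) + card ({..<n} \<times> ?res g)" by (rule card_Un_le)
      also have "\<dots> = card (?res f) * n + n * card (?res g)" by (simp only: card_cartesian_product card_lessThan)
      finally have "real (card (T i)) \<le> real (card (?res f)) * real n + real n * real (card (?res g))"
        using of_nat_mono by fastforce
      also have "\<dots> \<le> (\<rho> * real n) * real n + real n * (\<rho> * real n)"
        using 1 by (intro add_mono mult_left_mono mult_right_mono) auto
      finally show "T i \<subseteq> {..<n} \<times> {..<n} \<and> real (card (T i)) \<le> 2 * \<rho> * (real n)\<^sup>2"
        by (auto simp: T_def fgr reserve_pairs_def power2_eq_square algebra_simps)
    next
      fix i F assume i: "i \<in> I"
      obtain f g r where fgr: "i = (f, g, r)" by (cases i)
      have sub: "B i F \<subseteq> {..<n} \<times> {..<n}" by (auto simp: B_def fgr unlinked_pairs_def)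
      then have "card (B i F) \<le> card ({..<n} \<times> {..<n})" by (intro card_mono) auto
      then have "real (card (B i F)) \<le> (real n)\<^sup>2"
        by (simp add: card_cartesian_product power2_eq_square flip: of_nat_mult)
      then show "B i F \<subseteq> {..<n} \<times> {..<n} \<and> T i \<inter> B i F = {} \<and> real (card (B i F)) \<le> (real n)\<^sup>2"
        using sub by (auto simp: B_def T_def fgr unlinked_pairs_def reserve_pairs_def)
    qed (use p \<eta> in auto)
    also have "\<dots> \<le> (3 * exp (real n * 8)) * exp (- 9 * real n)"
    proof (intro mult_mono cardI)
      have "80 \<le> \<eta>\<^sup>2 * (real n * p n)" using elim \<eta> by (simp add: field_simps)
      then have "80 * real n \<le> \<eta>\<^sup>2 * (real n * p n) * real n" by (rule mult_right_mono) auto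
      then have 1: "10 * real n \<le> \<eta>\<^sup>2 / 8 * (p n * (real n)\<^sup>2)" by (simp add: power2_eq_square mult_ac)
      have "2 * \<rho> * (p n * (real n)\<^sup>2) \<le> \<eta>\<^sup>2 / 8 * (p n * (real n)\<^sup>2)"
        using \<rho> p by (intro mult_right_mono) auto
      with 1 have "p n * (2 * \<rho> * (real n)\<^sup>2) - \<eta>\<^sup>2 * p n * (real n)\<^sup>2 / 4 \<le> - 10 * real n"
        by (simp add: algebra_simps)
      then show "exp (p n * (2 * \<rho> * (real n)\<^sup>2) - \<eta>\<^sup>2 * p n * (real n)\<^sup>2 / 4) \<le> exp (- 9 * real n)"
        by simp
    qed auto
    also have "\<dots> = 3 * exp (- real n)" by (simp add: exp_add[symmetric])
    finally show ?case .
  qed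
qed

text \<open>
Here the expected number of edges is smaller than the threshold by a factor of order \<open>n p\<close>, so the exponential
tilt is taken to be unbounded, \<open>e\<^sup>s = sqrt (n p)\<close>.  The resulting bound has to beat the number of sets \<open>A\<close> of size
\<open>K / p\<close>, and this is where \<open>n\<^sup>2 p\<^sup>3 \<longlonglongrightarrow> \<infinity>\<close> is needed.
\<close>
lemma small_sets_expand_whp:
  fixes p :: "nat \<Rightarrow> real"
  assumes p: "\<And>n. 0 \<le> p n \<and> p n \<le> 1" and np: "filterlim (\<lambda>n. real n * p n) at_top sequentially"
    and n2p3: "filterlim (\<lambda>n. (real n)\<^sup>2 * p n ^ 3) at_top sequentially"
    and ln_np: "\<forall>\<^sub>F n in sequentially. ln (real n + 1) \<le> 4 * ln (real n * p n)"
    and c: "0 < c" and K: "0 < K"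
  shows "(\<lambda>n. measure_pmf.prob (random_relation n (p n)) {W. \<not> small_sets_expand n (p n) c K W}) \<longlonglongrightarrow> 0"
proof (rule prob_tendsto_0I)
  let ?D = "\<lambda>n. real n * p n"
  show "(\<lambda>n. exp (- (c / 8 * ?D n))) \<longlonglongrightarrow> 0"
  proof -
    have "filterlim (\<lambda>n. c / 8 * ?D n) at_top sequentially"
      using c by (intro filterlim_tendsto_pos_mult_at_top[OF tendsto_const _ np]) auto
    then have "filterlim (\<lambda>n. - (c / 8 * ?D n)) at_bot sequentially"
      by (subst filterlim_uminus_at_bot) (simp only: minus_minus)
    then show ?thesis by (rule filterlim_compose[OF exp_at_bot])
  qed
  have sl: "filterlim (\<lambda>x::real. ln x * sqrt x) at_top at_top" by real_asymp
  have e1: "\<forall>\<^sub>F n in sequentially. max (exp 1) (32 / c) \<le> ?D n"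
    using np unfolding filterlim_at_top by blast
  have e2: "\<forall>\<^sub>F n in sequentially. 32 * K / c\<^sup>2 \<le> (real n)\<^sup>2 * p n ^ 3"
    using n2p3 unfolding filterlim_at_top by blast
  have e3: "\<forall>\<^sub>F n in sequentially. 8 * K / c \<le> ln (?D n) * sqrt (?D n)"
    using filterlim_compose[OF sl np] unfolding filterlim_at_top by blast
  show "\<forall>\<^sub>F n in sequentially.
      measure_pmf.prob (random_relation n (p n)) {W. \<not> small_sets_expand n (p n) c K W} \<le> exp (- (c / 8 * ?D n))"
    using e1 e2 e3 ln_np
  proof eventually_elim
    case (elim n)
    define P where "P = p n"
    define D where "D = real n * P"
    define y where "y = nat \<lceil>c * real n * P\<rceil>"
    define k where "k = nat \<lfloor>K / P\<rfloor>"
    have D1: "exp 1 \<le> D" "32 / c \<le> D" using elim by (auto simp: D_def P_def)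
    have D0: "D > 0" using D1(1) exp_gt_zero[of "1::real"] by linarith
    have P0: "P > 0" using D0 p[of n] by (cases "P = 0") (auto simp: D_def P_def)
    have P1: "P \<le> 1" using p by (simp add: P_def)
    have lnD: "1 \<le> ln D" using D1(1) D0 by (simp add: ln_ge_iff)
    have Dge1: "1 \<le> D" using D1(1) exp_ge_add_one_self[of "1::real"] by linarith
    have y_ge: "c * D \<le> real y" unfolding y_def D_def by (simp add: mult.assoc) linarith
    have y1: "1 \<le> real y"
    proof -
      have "32 \<le> c * D" using D1(2) c by (simp add: field_simps)
      then show ?thesis using y_ge by simp
    qed
    have kle: "real k \<le> K / P" using P0 K by (simp add: k_def)
    define s where "s = ln D / 2"
    have exps: "exp s = sqrt D"
      using D0 by (simp add: s_def powr_half_sqrt[symmetric] powr_def)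
    define I where "I = {A. A \<subseteq> {..<n} \<and> card A \<le> k} \<times> {B. B \<subseteq> {..<n} \<and> card B \<le> y}"
    let ?J = "{(A, B) \<in> I. P * real (card A) \<le> K \<and> card B = y}"
    let ?S = "\<lambda>(A, B). {W. {} \<subseteq> W \<and> c * D * real y \<le> real (card (W \<inter> A \<times> B))}"
    have finI: "finite I" unfolding I_def using card_small_subsets(1) by blast
    have finJ: "finite ?J" by (rule finite_subset[OF _ finI]) auto
    have "measure_pmf.prob (random_relation n P) {W. \<not> small_sets_expand n P c K W} \<le>
        measure_pmf.prob (random_relation n P) (\<Union>i\<in>?J. ?S i)"
    proof (rule measure_pmf.finite_measure_mono, rule subsetI)
      fix W assume "W \<in> {W. \<not> small_sets_expand n P c K W}"
      then obtain A B where AB: "A \<subseteq> {..<n}" "B \<subseteq> {..<n}" "P * real (card A) \<le> K" "card B = y"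
        "c * D * real y \<le> real (card (W \<inter> A \<times> B))"
        unfolding small_sets_expand_def y_def D_def by (auto simp: not_less mult.assoc)
      have "real (card A) \<le> K / P" using AB(3) P0 by (simp add: field_simps)
      then have "card A \<le> k" unfolding k_def by linarith
      then have "(A, B) \<in> ?J" using AB by (auto simp: I_def)
      then show "W \<in> (\<Union>i\<in>?J. ?S i)" using AB(5) by (auto intro!: bexI[of _ "(A, B)"])
    qed auto
    also have "\<dots> \<le> (\<Sum>i\<in>?J. measure_pmf.prob (random_relation n P) (?S i))"
      by (rule measure_pmf.finite_measure_subadditive_finite[OF finJ]) auto
    also have "\<dots> \<le> (\<Sum>i\<in>?J. exp (K * sqrt D * real y - ln D / 2 * c * D * real y))"
    proof (rule sum_mono)
      fix i assume i: "i \<in> ?J"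
      obtain A B where AB: "i = (A, B)" by (cases i)
      have sub: "A \<subseteq> {..<n}" "B \<subseteq> {..<n}" "P * real (card A) \<le> K" "card B = y"
        using i by (auto simp: AB I_def)
      have "measure_pmf.prob (random_relation n P) (?S i) \<le>
         P ^ card ({} :: (nat \<times> nat) set) * exp (P * (exp s - 1) * real (card (A \<times> B)) - s * (c * D * real y))"
        unfolding AB prod.case by (rule random_relation_tail) (use P0 P1 sub lnD in \<open>auto simp: s_def\<close>)
      also have "\<dots> = exp (P * (exp s - 1) * real (card (A \<times> B)) - s * (c * D * real y))" by simp
      also have "\<dots> \<le> exp (K * sqrt D * real y - ln D / 2 * c * D * real y)"
      proof -
        have "P * (exp s - 1) * real (card (A \<times> B)) = (P * real (card A)) * ((sqrt D - 1) * real y)"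
          by (simp add: card_cartesian_product sub exps)
        also have "\<dots> \<le> (P * real (card A)) * (sqrt D * real y)"
          using P0 by (intro mult_left_mono mult_right_mono) auto
        also have "\<dots> \<le> K * (sqrt D * real y)" using sub D0 by (intro mult_right_mono) auto
        finally show ?thesis by (simp add: s_def mult_ac)
      qed
      finally show "measure_pmf.prob (random_relation n P) (?S i) \<le> exp (K * sqrt D * real y - ln D / 2 * c * D * real y)" .
    qed
    also have "\<dots> = real (card ?J) * exp (K * sqrt D * real y - ln D / 2 * c * D * real y)" by simp
    also have "\<dots> \<le> exp (real (k + y) * ln (real n + 1)) * exp (K * sqrt D * real y - ln D / 2 * c * D * real y)"
    proof (rule mult_right_mono)
      have "card ?J \<le> card I" by (rule card_mono[OF finI]) auto
      also have "\<dots> \<le> (n + 1) ^ k * (n + 1) ^ y"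
        unfolding I_def card_cartesian_product by (intro mult_le_mono card_small_subsets)
      finally have "card ?J \<le> (n + 1) ^ (k + y)" by (simp add: power_add)
      then have "real (card ?J) \<le> real ((n + 1) ^ (k + y))" by (rule of_nat_mono)
      also have "\<dots> = real (n + 1) ^ (k + y)" by (rule of_nat_power)
      also have "real (n + 1) ^ (k + y) \<le> exp (real (k + y) * ln (real n + 1))"
        by (rule power_le_exp) (simp add: add.commute)
      finally show "real (card ?J) \<le> exp (real (k + y) * ln (real n + 1))" .
    qed simp
    also have "\<dots> \<le> exp (- (c / 8 * D))"
    proof -
      \<comment> \<open>each of the error terms is at most a quarter of the gain \<open>c / 2 * ln D * D * y\<close>, which leaves one quarter over\<close>
      let ?M = "c / 8 * ln D * D * real y"
      have ln4: "ln (real n + 1) \<le> 4 * ln D" using elim by (simp add: D_def P_def)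
      have "real k * ln (real n + 1) \<le> (K / P) * (4 * ln D)"
        using kle ln4 K P0 by (intro mult_mono) auto
      also have "\<dots> \<le> (c / 8 * D * (c * D)) * ln D"
      proof -
        have "32 * K \<le> c\<^sup>2 * ((real n)\<^sup>2 * P ^ 3)" using elim(2) c by (simp add: P_def field_simps)
        also have "\<dots> = c\<^sup>2 * D\<^sup>2 * P" by (simp add: D_def power2_eq_square power3_eq_cube)
        finally have "4 * K / P \<le> c / 8 * D * (c * D)" using P0 by (simp add: field_simps power2_eq_square)
        then have "4 * K / P * ln D \<le> (c / 8 * D * (c * D)) * ln D" using lnD by (intro mult_right_mono) auto
        then show ?thesis by simp
      qed
      also have "\<dots> \<le> (c / 8 * D * real y) * ln D"
        using y_ge c Dge1 lnD by (intro mult_right_mono mult_left_mono) auto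
      finally have b1: "real k * ln (real n + 1) \<le> ?M" by (simp add: mult_ac)
      have "real y * ln (real n + 1) \<le> real y * (4 * ln D)" using ln4 by (intro mult_left_mono) auto
      also have "\<dots> \<le> real y * ((c / 8 * D) * ln D)"
      proof (intro mult_left_mono mult_right_mono)
        show "4 \<le> c / 8 * D" using D1(2) c by (simp add: field_simps)
      qed (use Dge1 in auto)
      finally have b2: "real y * ln (real n + 1) \<le> ?M" by (simp add: mult_ac)
      have "8 * K / c \<le> ln D * sqrt D" using elim by (simp add: D_def P_def)
      then have "K \<le> c / 8 * (ln D * sqrt D)" using c by (simp add: field_simps)
      then have "K * (sqrt D * real y) \<le> c / 8 * (ln D * sqrt D) * (sqrt D * real y)"
        using D0 by (intro mult_right_mono) auto
      also have "\<dots> = ?M" using D0 by (simp add: mult_ac)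
      finally have b3: "K * sqrt D * real y \<le> ?M" by (simp add: mult_ac)
      have "1 * 1 \<le> ln D * real y" using lnD y1 by (intro mult_mono) auto
      then have "c / 8 * D * (1 * 1) \<le> c / 8 * D * (ln D * real y)"
        using c D0 by (intro mult_left_mono) auto
      then have b4: "c / 8 * D \<le> ?M" by (simp add: mult_ac)
      have "real (k + y) * ln (real n + 1) + (K * sqrt D * real y - ln D / 2 * c * D * real y) \<le> - (c / 8 * D)"
        using b1 b2 b3 b4 by (simp add: algebra_simps)
      then show ?thesis by (simp add: exp_add[symmetric])
    qed
    finally show ?case by (simp add: P_def D_def)
  qed
qed

section \<open>Paths and cycles in bipartite graphs\<close>

fun bip_adj :: "(nat \<times> nat) set \<Rightarrow> nat + nat \<Rightarrow> nat + nat \<Rightarrow> bool" where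
  "bip_adj E (Inl i) (Inr j) \<longleftrightarrow> (i, j) \<in> E"
| "bip_adj E (Inr j) (Inl i) \<longleftrightarrow> (i, j) \<in> E"
| "bip_adj E _ _ \<longleftrightarrow> False"

lemma bip_adj_sym: "bip_adj E x y \<Longrightarrow> bip_adj E y x"
  by (cases x; cases y) auto

lemma bip_adj_isl: "bip_adj E x y \<Longrightarrow> isl y \<longleftrightarrow> \<not> isl x"
  by (cases x; cases y) auto

text \<open>
Depth-first search, in the form of an extremal choice.  A state consists of the current path \<open>p\<close> and the set \<open>S\<close> of
abandoned vertices, which have no neighbours outside \<open>S\<close> and \<open>p\<close>.  As long as \<open>S\<close> is small on both sides the
search can go on, by extending the path or by abandoning its first vertex, and both increase \<open>2 |S| + |p|\<close>.
\<close>
lemma maximal_search_path: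
  fixes adj :: "'a \<Rightarrow> 'a \<Rightarrow> bool"
  assumes fin: "finite X" "finite Y" and sym: "\<And>x y. adj x y \<Longrightarrow> adj y x" and s: "s \<le> card X"
  shows "\<exists>p S. distinct p \<and> set p \<subseteq> X \<union> Y \<and> S \<subseteq> X \<union> Y \<and> S \<inter> set p = {} \<and> successively adj p \<and>
     (\<forall>x\<in>S. \<forall>y\<in>X \<union> Y - S - set p. \<not> adj x y) \<and>
     (card (S \<inter> X) = s \<and> card (S \<inter> Y) \<le> s \<or> card (S \<inter> Y) = s \<and> card (S \<inter> X) \<le> s)"
proof -
  let ?V = "X \<union> Y"
  define state where "state = (\<lambda>(p, S). distinct p \<and> set p \<subseteq> ?V \<and> S \<subseteq> ?V \<and> S \<inter> set p = {} \<and>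
     successively adj p \<and> (\<forall>x\<in>S. \<forall>y\<in>?V - S - set p. \<not> adj x y) \<and>
     card (S \<inter> X) \<le> s \<and> card (S \<inter> Y) \<le> s)"
  define prog where "prog = (\<lambda>(p :: 'a list, S :: 'a set). 2 * card S + length p)"
  have finV: "finite ?V" using fin by simp
  have start: "state ([], {})" by (simp add: state_def)
  have bound: "\<forall>z. state z \<longrightarrow> prog z < Suc (3 * card ?V)"
  proof (intro allI impI)
    fix z assume z: "state z"
    obtain p S where zS: "z = (p, S)" by (cases z)
    note z' = z[unfolded zS state_def prod.case]
    note st = z'[THEN conjunct1] z'[THEN conjunct2, THEN conjunct1] z'[THEN conjunct2, THEN conjunct2, THEN conjunct1]
    have "card S \<le> card ?V" using st finV by (intro card_mono)
    moreover have "length p \<le> card ?V"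
      using st card_mono[OF finV, of "set p"] by (simp add: distinct_card)
    ultimately show "prog z < Suc (3 * card ?V)" by (simp add: prog_def zS)
  qed
  from ex_has_greatest_nat[OF start bound]
  obtain z where z: "state z" and max: "\<And>z'. state z' \<Longrightarrow> prog z' \<le> prog z" by auto
  obtain p S where zS: "z = (p, S)" by (cases z)
  have st: "distinct p" "set p \<subseteq> ?V" "S \<subseteq> ?V" "S \<inter> set p = {}" "successively adj p"
     "\<forall>x\<in>S. \<forall>y\<in>?V - S - set p. \<not> adj x y" "card (S \<inter> X) \<le> s" "card (S \<inter> Y) \<le> s"
    using z[unfolded zS state_def prod.case] by blast+
  have finS: "finite S" using st(3) finV finite_subset by blast
  have "card (S \<inter> X) = s \<or> card (S \<inter> Y) = s"
  proof (rule ccontr)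
    assume "\<not> ?thesis"
    then have lt: "card (S \<inter> X) < s" "card (S \<inter> Y) < s" using st by auto
    show False
    proof (cases p)
      case Nil
      have "\<not> X \<subseteq> S" using lt s by (metis inf.absorb_iff2 leD)
      then obtain v where v: "v \<in> X" "v \<notin> S" by blast
      have "state ([v], S)" using st v lt by (auto simp: state_def Nil)
      from max[OF this] show False by (simp add: prog_def zS Nil)
    next
      case (Cons x q)
      show False
      proof (cases "\<exists>y\<in>?V - S - set p. adj x y")
        case True
        then obtain y where y: "y \<in> ?V - S - set p" "adj x y" by blast
        have "state (y # p, S)" using st y sym[OF y(2)] unfolding state_def
          by (auto simp: Cons)
        from max[OF this] show False by (simp add: prog_def zS)
      next
        case False
        have "card (insert x S \<inter> X) \<le> Suc (card (S \<inter> X))" "card (insert x S \<inter> Y) \<le> Suc (card (S \<inter> Y))"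
          using finS by (auto simp: Int_insert_left card_insert_if)
        then have "state (q, insert x S)" using st False lt unfolding state_def
          by (auto simp: Cons successively_Cons)
        from max[OF this] show False using finS st by (simp add: prog_def zS Cons)
      qed
    qed
  qed
  then show ?thesis using st by blast
qed

lemma bip_path_alternates:
  assumes "successively (bip_adj E) p" "i < length p"
  shows "isl (p ! i) \<longleftrightarrow> (isl (hd p) \<longleftrightarrow> even i)"
  using assms(2)
proof (induction i)
  case 0 then show ?case by (cases p) auto
next
  case (Suc i)
  have "bip_adj E (p ! i) (p ! Suc i)" using successively_nth[OF assms(1)] Suc by auto
  then show ?case using Suc bip_adj_isl by fastforce
qed

lemma bip_path_sides:
  assumes "successively (bip_adj E) p" "p \<noteq> []"
  shows "if isl (hd p) then length (filter (\<lambda>a. \<not> isl a) p) \<le> length (filter isl p) \<and> length (filter isl p) \<le> Suc (length (filter (\<lambda>a. \<not> isl a) p))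
     else length (filter isl p) \<le> length (filter (\<lambda>a. \<not> isl a) p) \<and> length (filter (\<lambda>a. \<not> isl a) p) \<le> Suc (length (filter isl p))"
  using assms
proof (induction p)
  case (Cons x p)
  show ?case
  proof (cases p)
    case Nil then show ?thesis by auto
  next
    case (Cons y q)
    have "bip_adj E x y" "successively (bip_adj E) p" using Cons.prems Cons by auto
    then show ?thesis using Cons.IH Cons bip_adj_isl[of E x y] by (auto split: if_splits)
  qed
qed simp

text \<open>
A path alternates between the two sides, so it is almost twice as long as its part on either side.
\<close>
lemma bip_path_length_ge:
  assumes "successively (bip_adj E) p" "distinct p"
  shows "2 * card {i. Inl i \<in> set p} \<le> length p + 1" "2 * card {j. Inr j \<in> set p} \<le> length p + 1"
proof -
  have len: "length p = length (filter isl p) + length (filter (\<lambda>a. \<not> isl a) p)"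
    using sum_length_filter_compl[of isl p] by simp
  have "x \<in> Inl ` {i. Inl i \<in> set p} \<longleftrightarrow> x \<in> set (filter isl p)" for x :: "nat + nat"
    by (cases x) auto
  then have "Inl ` {i. Inl i \<in> set p} = set (filter isl p)" by blast
  then have l: "card {i. Inl i \<in> set p} = length (filter isl p)"
    using assms(2) by (metis card_image distinct_card distinct_filter inj_Inl inj_on_subset subset_UNIV)
  have "x \<in> Inr ` {i. Inr i \<in> set p} \<longleftrightarrow> x \<in> set (filter (\<lambda>a. \<not> isl a) p)" for x :: "nat + nat"
    by (cases x) auto
  then have "Inr ` {i. Inr i \<in> set p} = set (filter (\<lambda>a. \<not> isl a) p)" by blast
  then have r: "card {i. Inr i \<in> set p} = length (filter (\<lambda>a. \<not> isl a) p)"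
    using assms(2) by (metis card_image distinct_card distinct_filter inj_Inr inj_on_subset subset_UNIV)
  have "p = [] \<or> (length (filter isl p) \<le> length (filter (\<lambda>a. \<not> isl a) p) + 1 \<and> length (filter (\<lambda>a. \<not> isl a) p) \<le> length (filter isl p) + 1)"
    using bip_path_sides[OF assms(1)] by (auto split: if_splits)
  then show "2 * card {i. Inl i \<in> set p} \<le> length p + 1" "2 * card {j. Inr j \<in> set p} \<le> length p + 1"
    unfolding l r len by auto
qed

lemma bip_subpath:
  assumes p: "successively (bip_adj E) p" "distinct p" and l: "even l" "l + 2 \<le> length p"
  shows "\<exists>q. successively (bip_adj E) q \<and> distinct q \<and> set q \<subseteq> set p \<and> length q = l + 1 \<and>
    isl (hd q) \<and> isl (last q)"
proof -
  define r where "r = (if isl (hd p) then p else tl p)"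
  have r: "successively (bip_adj E) r" "distinct r" "set r \<subseteq> set p" "l + 1 \<le> length r"
    using p l by (cases p; auto simp: r_def successively_Cons)+
  have "isl (hd r)"
  proof (cases "isl (hd p)")
    case False
    obtain x y q where "p = x # y # q" using l by (cases p; cases "tl p") auto
    then show ?thesis using p False bip_adj_isl[of E x y] by (simp add: r_def)
  qed (simp add: r_def)
  define q where "q = take (l + 1) r"
  have app: "r = q @ drop (l + 1) r" by (simp add: q_def)
  have q: "successively (bip_adj E) q" "distinct q" "set q \<subseteq> set p" "length q = l + 1"
  proof -
    show "successively (bip_adj E) q" using r(1) by (subst (asm) app) (simp add: successively_append_iff)
    show "set q \<subseteq> set p" using r(3) by (auto simp: q_def dest: in_set_takeD)
  qed (use r in \<open>auto simp: q_def\<close>)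
  moreover have "hd q = hd r" using r by (auto simp: q_def hd_take)
  moreover have "last q = q ! l" using q by (metis add_diff_cancel_right' last_conv_nth list.size(3) nat.distinct(1) add.commute plus_1_eq_Suc)
  ultimately show ?thesis using bip_path_alternates[OF q(1), of l] \<open>isl (hd r)\<close> l by (intro exI[of _ q]) auto
qed

definition bip_rel :: "(nat + nat) ugraph \<Rightarrow> (nat \<times> nat) set" where
  "bip_rel G = {(i, j). {Inl i, Inr j} \<in> edges G}"

lemma bip_adj_edge: "bip_adj (bip_rel G) x y \<Longrightarrow> {x, y} \<in> edges G"
  by (cases x; cases y) (auto simp: bip_rel_def insert_commute)

lemma bip_cycle:
  assumes G: "simple_graph G" and c: "3 \<le> length c" "distinct c" "successively (bip_adj (bip_rel G)) c"
    and close: "bip_adj (bip_rel G) (last c) (hd c)"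
  shows "has_cycle_of_length G (length c)"
proof -
  have edge: "{c ! i, c ! ((i + 1) mod length c)} \<in> edges G" if i: "i < length c" for i
  proof (cases "i + 1 < length c")
    case True
    then show ?thesis using successively_nth[OF c(3), of i] by (auto intro: bip_adj_edge)
  next
    case False
    then have "i + 1 = length c" using i by simp
    moreover have "last c = c ! (length c - 1)" "hd c = c ! 0"
      using c(1) last_conv_nth[of c] hd_conv_nth[of c] by fastforce+
    ultimately show ?thesis using bip_adj_edge[OF close] by (metis add_diff_cancel_right' mod_self)
  qed
  have "set c \<subseteq> verts G"
  proof
    fix x assume "x \<in> set c"
    then obtain i where "i < length c" "x = c ! i" by (auto simp: in_set_conv_nth)
    then show "x \<in> verts G" using edge[of i] G by (auto simp: simple_graph_def)
  qed
  then show ?thesis using c edge unfolding has_cycle_of_length_def is_cycle_def by blast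
qed

section \<open>Counting edges, growing neighbourhoods and dense cores\<close>

abbreviation deg_row :: "('a \<times> 'b) set \<Rightarrow> 'b set \<Rightarrow> 'a \<Rightarrow> nat" where
  "deg_row E B i \<equiv> card {j \<in> B. (i, j) \<in> E}"

abbreviation deg_col :: "('a \<times> 'b) set \<Rightarrow> 'a set \<Rightarrow> 'b \<Rightarrow> nat" where
  "deg_col E A j \<equiv> card {i \<in> A. (i, j) \<in> E}"

lemma edges_between_by_rows:
  "finite A \<Longrightarrow> finite B \<Longrightarrow> card (E \<inter> A \<times> B) = (\<Sum>i\<in>A. deg_row E B i)"
proof -
  assume fin: "finite A" "finite B"
  have "E \<inter> A \<times> B = Sigma A (\<lambda>i. {j\<in>B. (i, j) \<in> E})" by auto
  then show ?thesis using fin by simp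
qed

lemma edges_between_by_columns:
  "finite A \<Longrightarrow> finite B \<Longrightarrow> card (E \<inter> A \<times> B) = (\<Sum>j\<in>B. deg_col E A j)"
proof -
  assume fin: "finite A" "finite B"
  have "E \<inter> A \<times> B = prod.swap ` Sigma B (\<lambda>j. {i\<in>A. (i, j) \<in> E})" by force
  then have "card (E \<inter> A \<times> B) = card (Sigma B (\<lambda>j. {i\<in>A. (i, j) \<in> E}))"
    by (simp add: card_image)
  then show ?thesis using fin by simp
qed

lemma edges_between_ge_rows:
  assumes "finite A" "finite B" "\<And>i. i \<in> A \<Longrightarrow> d \<le> real (deg_row E B i)"
  shows "d * real (card A) \<le> real (card (E \<inter> A \<times> B))"
  using sum_mono[of A "\<lambda>_. d" "\<lambda>i. real (deg_row E B i)"] assms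
  by (simp add: edges_between_by_rows mult.commute)

lemma edges_between_ge_columns:
  assumes "finite A" "finite B" "\<And>j. j \<in> B \<Longrightarrow> d \<le> real (deg_col E A j)"
  shows "d * real (card B) \<le> real (card (E \<inter> A \<times> B))"
  using sum_mono[of B "\<lambda>_. d" "\<lambda>j. real (deg_col E A j)"] assms
  by (simp add: edges_between_by_columns mult.commute)

lemma edges_between_le_columns:
  assumes "finite A" "finite B" "\<And>j. j \<in> B \<Longrightarrow> real (deg_col E A j) \<le> d"
  shows "real (card (E \<inter> A \<times> B)) \<le> d * real (card B)"
  using sum_mono[of B "\<lambda>j. real (deg_col E A j)" "\<lambda>_. d"] assms
  by (simp add: edges_between_by_columns mult.commute)

lemma edges_between_le_rows:
  assumes "finite A" "finite B" "\<And>i. i \<in> A \<Longrightarrow> real (deg_row E B i) \<le> d"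
  shows "real (card (E \<inter> A \<times> B)) \<le> d * real (card A)"
  using sum_mono[of A "\<lambda>i. real (deg_row E B i)" "\<lambda>_. d"] assms
  by (simp add: edges_between_by_rows mult.commute)

lemma edges_between_mono:
  "finite A' \<Longrightarrow> finite B' \<Longrightarrow> E \<subseteq> E' \<Longrightarrow> A \<subseteq> A' \<Longrightarrow> B \<subseteq> B' \<Longrightarrow> card (E \<inter> A \<times> B) \<le> card (E' \<inter> A' \<times> B')"
  by (rule card_mono) auto

text \<open>
The first step reaches \<open>c n p\<close> vertices, the second more than \<open>K / p\<close> of them by \<open>small_sets_expand\<close>, and from
there on the edge distribution is regular enough that the third neighbourhood has almost the relative size \<open>d\<close> of
a neighbourhood.
\<close>
lemma third_neighbourhood_large:
  fixes p c K \<eta> d :: real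
  assumes EW: "E \<subseteq> W" and sub: "sublinear_uniform_above n p K \<eta> W"
    and exp: "small_sets_expand n p c K W" and pos: "0 < p" "0 \<le> K"
    and AB: "A \<subseteq> {..<n}" "B \<subseteq> {..<n}" "Z \<subseteq> {..<n}"
    and w: "c * real n * p \<le> real (deg_row E B w)"
    and b: "\<And>b. b \<in> B \<Longrightarrow> c * real n * p \<le> real (deg_col E A b)"
    and a: "\<And>a. a \<in> A \<Longrightarrow> d * p * real n \<le> real (deg_row E Z a)"
  shows "(d - \<eta>) * real n \<le> real (card {z\<in>Z. \<exists>b\<in>B. \<exists>a\<in>A. (w, b) \<in> E \<and> (a, b) \<in> E \<and> (a, z) \<in> E})"
proof -
  have fin: "finite A" "finite B" "finite Z" using AB finite_subset by blast+
  let ?y = "nat \<lceil>c * real n * p\<rceil>"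
  have "?y \<le> deg_row E B w" using w by linarith
  then obtain N1 where N1: "N1 \<subseteq> {b\<in>B. (w, b) \<in> E}" "card N1 = ?y" "finite N1"
    using obtain_subset_with_card_n by blast
  define N2 where "N2 = {a\<in>A. \<exists>b\<in>N1. (a, b) \<in> E}"
  have N2: "N2 \<subseteq> A" "finite N2" using fin by (auto simp: N2_def)
  have "c * real n * p * real (card N1) \<le> real (card (E \<inter> N2 \<times> N1))"
  proof (rule edges_between_ge_columns)
    fix j assume j: "j \<in> N1"
    then have "{a\<in>A. (a, j) \<in> E} = {a\<in>N2. (a, j) \<in> E}" by (auto simp: N2_def)
    moreover have "c * real n * p \<le> real (deg_col E A j)" using b j N1 by auto
    ultimately show "c * real n * p \<le> real (deg_col E N2 j)" by simp
  qed (use N1 N2 in auto)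
  also have "card (E \<inter> N2 \<times> N1) \<le> card (W \<inter> N2 \<times> N1)"
    using N1 N2 EW by (intro edges_between_mono) auto
  finally have many: "c * real n * p * real (card N1) \<le> real (card (W \<inter> N2 \<times> N1))" by simp
  have "\<not> p * real (card N2) \<le> K"
  proof
    assume "p * real (card N2) \<le> K"
    then have "real (card (W \<inter> N2 \<times> N1)) < c * real n * p * real (card N1)"
      using exp[unfolded small_sets_expand_def, rule_format, of N2 N1] N1 N2 AB by force
    then show False using many by simp
  qed
  then have big: "K \<le> p * real (card N2)" "0 < p * real (card N2)" using pos by auto
  define N3 where "N3 = {z\<in>Z. \<exists>a\<in>N2. (a, z) \<in> E}"
  have N3: "N3 \<subseteq> Z" "finite N3" using fin by (auto simp: N3_def)
  have "d * p * real n * real (card N2) \<le> real (card (E \<inter> N2 \<times> N3))"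
  proof (rule edges_between_ge_rows)
    fix i assume i: "i \<in> N2"
    then have "{z\<in>Z. (i, z) \<in> E} = {z\<in>N3. (i, z) \<in> E}" by (auto simp: N3_def)
    moreover have "d * p * real n \<le> real (deg_row E Z i)" using a i N2 by auto
    ultimately show "d * p * real n \<le> real (deg_row E N3 i)" by simp
  qed (use N3 N2 in auto)
  also have "real (card (E \<inter> N2 \<times> N3)) \<le> real (card (W \<inter> N2 \<times> N3))"
    using N3 N2 EW by (intro of_nat_mono edges_between_mono) auto
  also have "\<dots> \<le> p * real (card N2) * real (card N3) + \<eta> * p * real n * real (card N2)"
    using sub[unfolded sublinear_uniform_above_def, rule_format, of N2 N3] big N2 N3 AB by force
  finally have "(p * real (card N2)) * (d * real n) \<le> (p * real (card N2)) * (real (card N3) + \<eta> * real n)"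
    by (simp add: algebra_simps)
  then have "d * real n \<le> real (card N3) + \<eta> * real n"
    using big(2) mult_le_cancel_left_pos by blast
  then have "(d - \<eta>) * real n \<le> real (card N3)" by (simp add: algebra_simps)
  also have "card N3 \<le> card {z\<in>Z. \<exists>b\<in>B. \<exists>a\<in>A. (w, b) \<in> E \<and> (a, b) \<in> E \<and> (a, z) \<in> E}"
    using N1 N2 fin by (intro card_mono) (auto simp: N3_def N2_def)
  finally show ?thesis by simp
qed

lemma finite_has_max:
  fixes h :: "'a \<Rightarrow> real"
  assumes "finite S" "S \<noteq> {}"
  shows "\<exists>x\<in>S. \<forall>y\<in>S. h y \<le> h x"
proof -
  have "Max (h ` S) \<in> h ` S" using assms by (intro Max_in) auto
  then obtain x where x: "x \<in> S" "h x = Max (h ` S)" by (metis imageE)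
  have "h y \<le> h x" if "y \<in> S" for y
    unfolding x(2) using that assms by (intro Max_ge) auto
  then show ?thesis using x(1) by blast
qed

lemma card_edges_remove_row:
  assumes "finite X" "finite Y" "i \<in> X"
  shows "card (E \<inter> X \<times> Y) = card (E \<inter> (X - {i}) \<times> Y) + deg_row E Y i"
  using assms by (simp add: edges_between_by_rows sum.remove[of X i])

lemma card_edges_remove_column:
  assumes "finite X" "finite Y" "j \<in> Y"
  shows "card (E \<inter> X \<times> Y) = card (E \<inter> X \<times> (Y - {j})) + deg_col E X j"
  using assms by (simp add: edges_between_by_columns sum.remove[of Y j])

text \<open>
Removing a vertex of low degree from a maximiser of \<open>e(X, Y) - d |X| |Y|\<close> would increase this quantity.
\<close>
lemma dense_core:
  fixes d :: real
  shows "\<exists>X Y. X \<subseteq> {..<n} \<and> Y \<subseteq> {..<n} \<and>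
    real (card (E \<inter> {..<n} \<times> {..<n})) - d * (real n)\<^sup>2 \<le> real (card (E \<inter> X \<times> Y)) - d * real (card X) * real (card Y) \<and>
    (\<forall>i\<in>X. d * real (card Y) \<le> real (deg_row E Y i)) \<and>
    (\<forall>j\<in>Y. d * real (card X) \<le> real (deg_col E X j))"
proof -
  define h where "h = (\<lambda>(X, Y). real (card (E \<inter> X \<times> Y)) - d * real (card X) * real (card Y))"
  have "\<exists>z\<in>Pow {..<n} \<times> Pow {..<n}. \<forall>z'\<in>Pow {..<n} \<times> Pow {..<n}. h z' \<le> h z"
    by (rule finite_has_max) auto
  then obtain X Y where XY: "X \<subseteq> {..<n}" "Y \<subseteq> {..<n}"
    and max: "\<And>A B. A \<subseteq> {..<n} \<Longrightarrow> B \<subseteq> {..<n} \<Longrightarrow> h (A, B) \<le> h (X, Y)" by auto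
  have fin: "finite X" "finite Y" using XY finite_subset by blast+
  have rows: "d * real (card Y) \<le> real (deg_row E Y i)" if i: "i \<in> X" for i
  proof -
    have "real (card X) = real (card (X - {i})) + 1" using card.remove[OF fin(1) i] by simp
    moreover have "h (X - {i}, Y) \<le> h (X, Y)" using XY by (intro max) auto
    ultimately show ?thesis using card_edges_remove_row[OF fin i, of E]
      by (simp add: h_def algebra_simps)
  qed
  have cols: "d * real (card X) \<le> real (deg_col E X j)" if j: "j \<in> Y" for j
  proof -
    have "real (card Y) = real (card (Y - {j})) + 1" using card.remove[OF fin(2) j] by simp
    moreover have "h (X, Y - {j}) \<le> h (X, Y)" using XY by (intro max) auto
    ultimately show ?thesis using card_edges_remove_column[OF fin j, of E]
      by (simp add: h_def algebra_simps)
  qed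
  show ?thesis using XY rows cols max[of "{..<n}" "{..<n}"]
    by (intro exI[of _ X] exI[of _ Y]) (simp add: h_def power2_eq_square)
qed

lemma side_colouring:
  fixes M :: "nat pmf" and \<zeta> m :: real
  assumes XY: "X \<subseteq> {..<n}" "Y \<subseteq> {..<n}" and \<zeta>: "0 < \<zeta>" "\<zeta> \<le> 1"
    and rows: "\<And>i. i \<in> X \<Longrightarrow> m \<le> real (deg_row E Y i)" and Y: "m \<le> real (card Y)"
    and small: "8 * (real n + 1) * exp (- (\<zeta>\<^sup>2 * m / 4)) < 1"
  shows "\<exists>g. (\<forall>i\<in>X. \<forall>k\<le>3. \<bar>real (deg_row E {j\<in>Y. g j = k} i) - pmf M k * real (deg_row E Y i)\<bar>
        \<le> \<zeta> * real (deg_row E Y i)) \<and>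
     (\<forall>k\<le>3. \<bar>real (card {j\<in>Y. g j = k}) - pmf M k * real (card Y)\<bar> \<le> \<zeta> * real (card Y))"
proof -
  let ?S = "insert Y ((\<lambda>i. {j\<in>Y. (i, j) \<in> E}) ` X)"
  have fin: "finite X" "finite Y" using XY finite_subset by blast+
  have "card ?S \<le> Suc (card ((\<lambda>i. {j\<in>Y. (i, j) \<in> E}) ` X))" by (rule card_insert_le_m1) auto
  also have "\<dots> \<le> Suc (card X)" using card_image_le[OF fin(1)] by auto
  also have "\<dots> \<le> Suc n" using XY card_mono[of "{..<n}" X] by simp
  finally have cS: "real (card ?S) \<le> real n + 1" by linarith
  have "\<exists>g. \<forall>S\<in>?S. \<forall>k\<in>{..3::nat}. \<bar>real (card {v\<in>S. g v = k}) - pmf M k * real (card S)\<bar> \<le> \<zeta> * real (card S)"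
  proof (rule balanced_colouring[where V = Y])
    have "8 * real (card ?S) * exp (- (\<zeta>\<^sup>2 * m / 4)) \<le> 8 * (real n + 1) * exp (- (\<zeta>\<^sup>2 * m / 4))"
      using cS by (intro mult_right_mono mult_left_mono) auto
    then have "8 * real (card ?S) * exp (- (\<zeta>\<^sup>2 * m / 4)) < 1" using small by linarith
    then show "2 * real (card ?S) * real (card {..3::nat}) * exp (- (\<zeta>\<^sup>2 * m / 4)) < 1" by simp
    show "S \<subseteq> Y \<and> m \<le> real (card S)" if "S \<in> ?S" for S using that rows Y by auto
  qed (use fin \<zeta> in auto)
  then obtain g where g: "\<forall>S\<in>?S. \<forall>k\<in>{..3::nat}. \<bar>real (card {v\<in>S. g v = k}) - pmf M k * real (card S)\<bar> \<le> \<zeta> * real (card S)"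
    by blast
  have "\<bar>real (deg_row E {j\<in>Y. g j = k} i) - pmf M k * real (deg_row E Y i)\<bar> \<le> \<zeta> * real (deg_row E Y i)"
    if "i \<in> X" "k \<in> {..3}" for i k
  proof -
    have eq: "{v \<in> {j\<in>Y. (i, j) \<in> E}. g v = k} = {j \<in> {j\<in>Y. g j = k}. (i, j) \<in> E}" by auto
    have "{j\<in>Y. (i, j) \<in> E} \<in> ?S" using that by auto
    from g[rule_format, OF this that(2)] show ?thesis unfolding eq .
  qed
  moreover have "\<bar>real (card {j\<in>Y. g j = k}) - pmf M k * real (card Y)\<bar> \<le> \<zeta> * real (card Y)" if "k \<in> {..3}" for k
    using g that by blast
  ultimately show ?thesis by (intro exI[of _ g]) simp
qed

definition balanced_classes ::
    "(nat \<times> nat) set \<Rightarrow> nat set \<Rightarrow> nat set \<Rightarrow> nat pmf \<Rightarrow> real \<Rightarrow> (nat \<Rightarrow> nat) \<Rightarrow> (nat \<Rightarrow> nat) \<Rightarrow> bool" where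
  "balanced_classes E X Y M \<zeta> f g \<longleftrightarrow> (\<forall>k\<le>3.
     (\<forall>i\<in>X. (pmf M k - \<zeta>) * real (deg_row E Y i) \<le> real (deg_row E {j\<in>Y. g j = k} i)) \<and>
     (\<forall>j\<in>Y. (pmf M k - \<zeta>) * real (deg_col E X j) \<le> real (deg_col E {i\<in>X. f i = k} j)) \<and>
     (pmf M k - \<zeta>) * real (card X) \<le> real (card {i\<in>X. f i = k}) \<and>
     real (card {i\<in>X. f i = k}) \<le> (pmf M k + \<zeta>) * real (card X) \<and>
     real (card {j\<in>Y. g j = k}) \<le> (pmf M k + \<zeta>) * real (card Y))"

lemma balanced_classesD:
  assumes "balanced_classes E X Y M \<zeta> f g" "k \<le> 3"
  shows "i \<in> X \<Longrightarrow> (pmf M k - \<zeta>) * real (deg_row E Y i) \<le> real (deg_row E {j\<in>Y. g j = k} i)"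
    and "j \<in> Y \<Longrightarrow> (pmf M k - \<zeta>) * real (deg_col E X j) \<le> real (deg_col E {i\<in>X. f i = k} j)"
    and "(pmf M k - \<zeta>) * real (card X) \<le> real (card {i\<in>X. f i = k})"
    and "real (card {i\<in>X. f i = k}) \<le> (pmf M k + \<zeta>) * real (card X)"
    and "real (card {j\<in>Y. g j = k}) \<le> (pmf M k + \<zeta>) * real (card Y)"
  using assms unfolding balanced_classes_def by simp_all

lemma balanced_classes_exist:
  fixes M :: "nat pmf" and \<zeta> m :: real
  assumes XY: "X \<subseteq> {..<n}" "Y \<subseteq> {..<n}" and \<zeta>: "0 < \<zeta>" "\<zeta> \<le> 1"
    and rows: "\<And>i. i \<in> X \<Longrightarrow> m \<le> real (deg_row E Y i)" and cols: "\<And>j. j \<in> Y \<Longrightarrow> m \<le> real (deg_col E X j)"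
    and sizes: "m \<le> real (card X)" "m \<le> real (card Y)"
    and small: "8 * (real n + 1) * exp (- (\<zeta>\<^sup>2 * m / 4)) < 1"
  obtains f g where "balanced_classes E X Y M \<zeta> f g"
proof -
  obtain g where g: "\<forall>i\<in>X. \<forall>k\<le>3. \<bar>real (deg_row E {j\<in>Y. g j = k} i) - pmf M k * real (deg_row E Y i)\<bar>
        \<le> \<zeta> * real (deg_row E Y i)"
     "\<forall>k\<le>3. \<bar>real (card {j\<in>Y. g j = k}) - pmf M k * real (card Y)\<bar> \<le> \<zeta> * real (card Y)"
    using side_colouring[OF XY \<zeta> rows sizes(2) small] by blast
  have "m \<le> real (deg_row (E\<inverse>) X j)" if "j \<in> Y" for j using cols[OF that] by simp
  from side_colouring[OF XY(2,1) \<zeta> this sizes(1) small, where M = M]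
  obtain f where f: "\<forall>j\<in>Y. \<forall>k\<le>3. \<bar>real (deg_col E {i\<in>X. f i = k} j) - pmf M k * real (deg_col E X j)\<bar>
        \<le> \<zeta> * real (deg_col E X j)"
     "\<forall>k\<le>3. \<bar>real (card {i\<in>X. f i = k}) - pmf M k * real (card X)\<bar> \<le> \<zeta> * real (card X)" by auto
  have share: "(a - \<zeta>) * t \<le> u" "u \<le> (a + \<zeta>) * t" if "\<bar>u - a * t\<bar> \<le> \<zeta> * t" for u a t :: real
    using that unfolding abs_le_iff by (simp_all add: algebra_simps)
  show ?thesis
    by (rule that[of f g]) (use f g in \<open>auto simp: balanced_classes_def intro!: share\<close>)
qed

text \<open>
Distinctness of the vertices is automatic because each step of the path uses its own colour.
\<close>
lemma linked_path:
  assumes "(u, v) \<in> linked F f g r" "g v = 0" "f u \<notin> {1..r}"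
  shows "\<exists>q. successively (bip_adj F) q \<and> distinct q \<and> q \<noteq> [] \<and> hd q = Inl u \<and> last q = Inr v \<and> length q = 2 * r + 2 \<and>
    set q \<subseteq> {Inl u, Inr v} \<union> Inl ` {a. f a \<in> {1..r}} \<union> Inr ` {b. g b \<in> {1..r}}"
  using assms
proof (induction r arbitrary: u)
  case 0
  then show ?case by (intro exI[of _ "[Inl u, Inr v]"]) auto
next
  case (Suc r)
  from Suc.prems(1) obtain a b where ab: "f a = Suc r" "g b = Suc r" "(u, b) \<in> F" "(a, b) \<in> F" "(a, v) \<in> linked F f g r"
    by auto
  have "f a \<notin> {1..r}" using ab by simp
  from Suc.IH[OF ab(5) Suc.prems(2) this] obtain q where q: "successively (bip_adj F) q" "distinct q" "q \<noteq> []"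
    "hd q = Inl a" "last q = Inr v" "length q = 2 * r + 2"
    "set q \<subseteq> {Inl a, Inr v} \<union> Inl ` {a. f a \<in> {1..r}} \<union> Inr ` {b. g b \<in> {1..r}}" by blast
  have "Inl u \<notin> set q" using q(7) Suc.prems(3) ab by auto
  moreover have "Inr b \<notin> set q" using q(7) Suc.prems(2) ab by auto
  moreover have "set q \<subseteq> {Inl u, Inr v} \<union> Inl ` {a. f a \<in> {1..Suc r}} \<union> Inr ` {b. g b \<in> {1..Suc r}}"
    
  proof
    fix x assume "x \<in> set q"
    then consider "x = Inl a" | "x = Inr v" | i where "x = Inl i" "f i \<in> {1..r}" | j where "x = Inr j" "g j \<in> {1..r}"
      using q(7) by blast
    then show "x \<in> {Inl u, Inr v} \<union> Inl ` {a. f a \<in> {1..Suc r}} \<union> Inr ` {b. g b \<in> {1..Suc r}}"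
      using ab by cases auto
  qed
  ultimately show ?case using q(1-6) ab(1-4)
    by (intro exI[of _ "Inl u # Inr b # q"]) (simp add: successively_Cons)
qed

lemma linked_mono: "F \<subseteq> F' \<Longrightarrow> linked F f g r \<subseteq> linked F' f g r"
  by (induction r) (simp, force)

lemma has_short_cycleI:
  assumes G: "simple_graph G" and uv: "(u, v) \<in> linked (bip_rel G) f g r" "(u, v) \<in> bip_rel G" "f u = 0" "g v = 0" "1 \<le> r"
  shows "has_cycle_of_length G (2 * r + 2)"
proof -
  obtain q where q: "successively (bip_adj (bip_rel G)) q" "distinct q" "q \<noteq> []" "hd q = Inl u" "last q = Inr v"
    "length q = 2 * r + 2" using linked_path[OF uv(1) uv(4)] uv(3) by auto
  show ?thesis using bip_cycle[OF G, of q] q uv by simp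
qed

section \<open>Cycles of length four, six and eight\<close>

lemma reserve_colours:
  fixes \<gamma> :: real
  assumes "0 \<le> \<gamma>" "3 * \<gamma> \<le> 1"
  obtains M :: "nat pmf" where "pmf M 0 = 1 - 3 * \<gamma>" "\<And>k. k \<in> {1,2,3} \<Longrightarrow> pmf M k = \<gamma>"
proof -
  define xs where "xs = [(0::nat, 1 - 3 * \<gamma>), (1, \<gamma>), (2, \<gamma>), (3, \<gamma>)]"
  have wf: "pmf_of_list_wf xs" using assms by (intro pmf_of_list_wfI) (auto simp: xs_def)
  show ?thesis
    by (rule that[of "pmf_of_list xs"]) (auto simp: pmf_pmf_of_list[OF wf], auto simp: xs_def)
qed

text \<open>
If there were no cycle of length \<open>2 r + 2\<close>, then all edges of the core between the two main colour classes would be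
unlinked pairs.  These make up less than a fraction \<open>1/2\<close> of all pairs, so they carry at most about
\<open>(1 - d) p |X| |Y|\<close> edges, whereas the minimum degrees give almost \<open>d p |X| |Y|\<close> edges with \<open>d > 1/2\<close>.
\<close>
lemma short_cycle:
  fixes p \<epsilon> \<gamma> \<eta> c K :: real
  assumes G: "simple_graph G" and E: "E = bip_rel G" and EW: "E \<subseteq> W" and W: "W \<subseteq> {..<n} \<times> {..<n}"
    and edges: "(1/2 + \<epsilon>) * p * (real n)\<^sup>2 < real (card E)"
    and \<epsilon>: "0 < \<epsilon>" "\<epsilon> \<le> 1/2" and p: "0 < p" "p \<le> 1" and K: "0 \<le> K"
    and \<gamma>: "0 < \<gamma>" "\<gamma> \<le> \<epsilon>^4 / 24576" and \<eta>: "\<eta> = \<epsilon>\<^sup>2 / 16" and c: "c = \<gamma> * \<epsilon> / 8"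
    and uni: "uniform_above n p \<eta> W" and sub: "sublinear_uniform_above n p K \<eta> W"
    and exp: "small_sets_expand n p c K W" and unl: "unlinked_uniform_above n p (6 * \<gamma>) \<eta> W"
    and small: "8 * (real n + 1) * exp (- ((\<gamma> / 2)\<^sup>2 * (\<epsilon> / 4 * p * real n) / 4)) < 1"
    and r: "r \<in> {1,2,3}"
  shows "has_cycle_of_length G (2 * r + 2)"
proof -
  define N where "N = real n"
  have N: "0 < N"
  proof -
    have "n \<noteq> 0"
    proof
      assume "n = 0"
      then have "E = {}" using EW W by auto
      then show False using edges \<open>n = 0\<close> by simp
    qed
    then show ?thesis by (simp add: N_def)
  qed
  have \<epsilon>4: "\<epsilon>^4 \<le> \<epsilon>"
    using \<epsilon> power_decreasing[of 1 4 \<epsilon>] by simp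
  have \<gamma>\<epsilon>: "24 * \<gamma> \<le> \<epsilon>" "\<gamma> \<le> 1/100" using \<gamma> \<epsilon>4 \<epsilon> by auto
  have \<eta>\<epsilon>: "\<eta> \<le> \<epsilon> / 4" "0 < \<eta>" "\<eta> \<le> 1/64"
  proof -
    have "\<epsilon> * \<epsilon> \<le> \<epsilon> * (1/2)" using \<epsilon> by (intro mult_left_mono) auto
    moreover have "\<epsilon> * (1/2) \<le> 1/4" using \<epsilon> by simp
    ultimately show "\<eta> \<le> \<epsilon> / 4" "0 < \<eta>" "\<eta> \<le> 1/64" using \<epsilon> unfolding \<eta> power2_eq_square
      by (linarith, simp, linarith)
  qed
  define d where "d = 1/2 + \<epsilon>/2"
  have d: "1/2 < d" "d \<le> 3/4" using \<epsilon> by (auto simp: d_def)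
  from dense_core[of n E "d * p"] obtain X Y where XY: "X \<subseteq> {..<n}" "Y \<subseteq> {..<n}"
    and core: "real (card (E \<inter> {..<n} \<times> {..<n})) - d * p * (real n)\<^sup>2 \<le> real (card (E \<inter> X \<times> Y)) - d * p * real (card X) * real (card Y)"
    and rows: "\<And>i. i \<in> X \<Longrightarrow> d * p * real (card Y) \<le> real (deg_row E Y i)"
    and cols: "\<And>j. j \<in> Y \<Longrightarrow> d * p * real (card X) \<le> real (deg_col E X j)" by blast
  have fin: "finite X" "finite Y" using XY finite_subset by blast+
  define a b where "a = real (card X)" and "b = real (card Y)"
  have aN: "0 \<le> a" "a \<le> N" "0 \<le> b" "b \<le> N"
    using card_mono[OF _ XY(1)] card_mono[OF _ XY(2)] by (auto simp: a_def b_def N_def)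
  have eXY: "real (card (E \<inter> X \<times> Y)) \<le> p * a * b + \<eta> * p * N\<^sup>2"
  proof -
    have "real (card (E \<inter> X \<times> Y)) \<le> real (card (W \<inter> X \<times> Y))"
      using fin EW by (intro of_nat_mono edges_between_mono) auto
    also have "\<dots> \<le> p * a * b + \<eta> * p * N\<^sup>2"
      using uni[unfolded uniform_above_def, rule_format, OF XY] by (simp add: a_def b_def N_def)
    finally show ?thesis .
  qed
  have "E \<inter> {..<n} \<times> {..<n} = E" using EW W by auto
  with core edges have "(1/2 + \<epsilon>) * p * N\<^sup>2 - d * p * N\<^sup>2 \<le> real (card (E \<inter> X \<times> Y)) - d * p * a * b"
    by (simp add: N_def a_def b_def)
  with eXY have "p * ((\<epsilon> / 2 - \<eta>) * N\<^sup>2) \<le> p * ((1 - d) * (a * b))"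
    by (simp add: d_def algebra_simps)
  then have "(\<epsilon> / 2 - \<eta>) * N\<^sup>2 \<le> (1 - d) * (a * b)" using p by simp
  also have "\<dots> \<le> 1/2 * (a * b)" using d aN by (intro mult_right_mono) auto
  finally have "(\<epsilon> - 2 * \<eta>) * N\<^sup>2 \<le> a * b" by (simp add: algebra_simps)
  moreover have "(\<epsilon> / 2) * N\<^sup>2 \<le> (\<epsilon> - 2 * \<eta>) * N\<^sup>2" using \<eta>\<epsilon> by (intro mult_right_mono) auto
  ultimately have ab: "\<epsilon> / 2 * N\<^sup>2 \<le> a * b" by simp
  have a_ge: "\<epsilon> / 2 * N \<le> a"
  proof -
    have "a * b \<le> a * N" using aN by (intro mult_left_mono)
    then have "(\<epsilon> / 2 * N) * N \<le> a * N" using ab by (simp add: power2_eq_square)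
    then show ?thesis using N by simp
  qed
  have b_ge: "\<epsilon> / 2 * N \<le> b"
  proof -
    have "a * b \<le> N * b" using aN by (intro mult_right_mono)
    then have "(\<epsilon> / 2 * N) * N \<le> b * N" using ab by (simp add: power2_eq_square mult_ac)
    then show ?thesis using N by simp
  qed
  have deg_large: "\<epsilon> / 4 * p * N \<le> d * p * x" if "\<epsilon> / 2 * N \<le> x" for x
  proof -
    have "1/2 * (\<epsilon> / 2 * N) \<le> d * x" using d that N \<epsilon> by (intro mult_mono) auto
    then have "p * (1/2 * (\<epsilon> / 2 * N)) \<le> p * (d * x)" using p by (intro mult_left_mono) auto
    then show ?thesis by (simp add: mult_ac)
  qed
  have size_large: "\<epsilon> / 4 * p * N \<le> x" if "\<epsilon> / 2 * N \<le> x" for x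
  proof -
    have "\<epsilon> / 4 * N * p \<le> \<epsilon> / 4 * N * 1" using p \<epsilon> N by (intro mult_left_mono) auto
    moreover have "\<epsilon> / 4 * N \<le> \<epsilon> / 2 * N" using \<epsilon> N by (intro mult_right_mono) auto
    ultimately show ?thesis using that by (simp add: mult_ac)
  qed
  obtain M :: "nat pmf" where M: "pmf M 0 = 1 - 3 * \<gamma>" "\<And>k. k \<in> {1,2,3} \<Longrightarrow> pmf M k = \<gamma>"
    using reserve_colours[of \<gamma>] \<gamma> \<gamma>\<epsilon> by auto
  obtain f g where fg: "balanced_classes E X Y M (\<gamma> / 2) f g"
  proof (rule balanced_classes_exist[OF XY])
    show "\<epsilon> / 4 * p * real n \<le> real (deg_row E Y i)" if "i \<in> X" for i
      using rows[OF that] deg_large[OF b_ge] by (simp add: N_def b_def)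
    show "\<epsilon> / 4 * p * real n \<le> real (deg_col E X j)" if "j \<in> Y" for j
      using cols[OF that] deg_large[OF a_ge] by (simp add: N_def a_def)
  qed (use small size_large[OF a_ge] size_large[OF b_ge] \<gamma> \<gamma>\<epsilon> in \<open>auto simp: N_def a_def b_def\<close>)
  note cl = balanced_classesD[OF fg]
  \<comment> \<open>colour 4 marks the vertices that belong to no class of the core\<close>
  define f' g' where "f' = (\<lambda>i\<in>{..<n}. if i \<in> X \<and> f i \<le> 3 then f i else 4)"
    and "g' = (\<lambda>j\<in>{..<n}. if j \<in> Y \<and> g j \<le> 3 then g j else 4)"
  have f': "i < n \<and> f' i = k \<longleftrightarrow> i \<in> X \<and> f i = k" if "k \<le> 3" for i k
    using that XY by (auto simp: f'_def split: if_splits)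
  have g': "j < n \<and> g' j = k \<longleftrightarrow> j \<in> Y \<and> g j = k" if "k \<le> 3" for j k
    using that XY by (auto simp: g'_def split: if_splits)
  define X' Y' where "X' k = {i\<in>X. f i = k}" and "Y' k = {j\<in>Y. g j = k}" for k
  have fin': "finite (X' k)" "finite (Y' k)" for k using fin by (auto simp: X'_def Y'_def)
  have sub': "X' k \<subseteq> {..<n}" "Y' k \<subseteq> {..<n}" for k using XY by (auto simp: X'_def Y'_def)
  define F where "F = E \<inter> reserve_pairs n f' g'"
  have FE: "F \<subseteq> E" by (simp add: F_def)
  have inF: "(i, j) \<in> F" if "(i, j) \<in> E" "i \<in> X' k \<or> j \<in> Y' k" "k \<in> {1,2,3}" for i j k
  proof -
    have "i < n" "j < n" using that(1) EW W by auto
    moreover have "f' i = k \<or> g' j = k"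
      using that f'[of k i] g'[of k j] by (auto simp: X'_def Y'_def)
    ultimately show ?thesis using that by (auto simp: F_def reserve_pairs_def)
  qed
  define q where "q = 1 - 4 * \<gamma>"
  have q: "0 < q" "q \<le> 1" using \<gamma> \<gamma>\<epsilon> by (auto simp: q_def)
  have res_lower: "c * N * p \<le> s" if "(\<gamma> - \<gamma> / 2) * t \<le> s" "d * p * x \<le> t" "\<epsilon> / 2 * N \<le> x" for s t x
  proof -
    have "(\<gamma> - \<gamma> / 2) * (\<epsilon> / 4 * p * N) \<le> (\<gamma> - \<gamma> / 2) * t"
      using deg_large[OF that(3)] that(2) \<gamma> by (intro mult_left_mono) auto
    moreover have "c * N * p = (\<gamma> - \<gamma> / 2) * (\<epsilon> / 4 * p * N)" by (simp add: c)
    ultimately show ?thesis using that(1) by linarith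
  qed
  have main_lower: "q * t \<le> s" if "(1 - 3 * \<gamma> - \<gamma> / 2) * t \<le> s" "0 \<le> t" for s t
  proof -
    have "q * t \<le> (1 - 3 * \<gamma> - \<gamma> / 2) * t" using that \<gamma> by (intro mult_right_mono) (auto simp: q_def)
    then show ?thesis using that by linarith
  qed
  have rowk: "c * N * p \<le> real (deg_row E (Y' k) i)" if "i \<in> X" "k \<in> {1,2,3}" for i k
  proof -
    have k: "pmf M k = \<gamma>" "k \<le> 3" using M(2) that by auto
    show ?thesis by (rule res_lower[OF cl(1)[OF k(2) that(1), folded Y'_def, unfolded k(1)] rows[OF that(1), folded b_def] b_ge])
  qed
  have colk: "c * N * p \<le> real (deg_col E (X' k) j)" if "j \<in> Y" "k \<in> {1,2,3}" for j k
  proof -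
    have k: "pmf M k = \<gamma>" "k \<le> 3" using M(2) that by auto
    show ?thesis by (rule res_lower[OF cl(2)[OF k(2) that(1), folded X'_def, unfolded k(1)] cols[OF that(1), folded a_def] a_ge])
  qed
  have row0: "q * (d * p * b) \<le> real (deg_row E (Y' 0) i)" if "i \<in> X" for i
  proof -
    have "q * (d * p * b) \<le> q * real (deg_row E Y i)"
      using rows[OF that] q by (intro mult_left_mono) (auto simp: b_def)
    also have "\<dots> \<le> real (deg_row E (Y' 0) i)"
      using cl(1)[OF _ that, of 0] unfolding Y'_def by (intro main_lower) (auto simp: M)
    finally show ?thesis .
  qed
  have X0: "q * a \<le> real (card (X' 0))"
    using cl(3)[of 0] aN unfolding X'_def a_def by (intro main_lower) (auto simp: M)
  have cNp: "0 < c * N * p" using \<gamma> \<epsilon> N p by (simp add: c)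
  \<comment> \<open>all but the last three steps of the path may be chosen arbitrarily; only these three need expansion\<close>
  have reach: "(q * d * b / N - \<eta>) * N \<le> real (card {v\<in>Y' 0. (u, v) \<in> linked F f' g' s})"
    if "u \<in> X" "1 \<le> s" "s \<le> 3" for u s
    using that(2,3,1)
  proof (induction s arbitrary: u rule: nat_induct_at_least)
    case base
    have "(q * d * b / N - \<eta>) * real n \<le> real (card {v\<in>Y' 0. \<exists>b\<in>Y' 1. \<exists>a\<in>X' 1. (u, b) \<in> E \<and> (a, b) \<in> E \<and> (a, v) \<in> E})"
    proof (rule third_neighbourhood_large[OF EW sub exp p(1) K sub'(1) sub'(2) sub'(2)])
      show "c * real n * p \<le> real (deg_row E (Y' 1) u)"
        using rowk[of u 1] base by (simp add: N_def)
      show "c * real n * p \<le> real (deg_col E (X' 1) b)" if "b \<in> Y' 1" for b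
        using colk[of b 1] that by (simp add: N_def Y'_def)
      show "q * d * b / N * p * real n \<le> real (deg_row E (Y' 0) a)" if "a \<in> X' 1" for a
        using row0[of a] that N by (simp add: N_def X'_def mult_ac)
    qed
    also have "\<dots> \<le> real (card {v\<in>Y' 0. (u, v) \<in> linked F f' g' 1})"
    proof (intro of_nat_mono card_mono subsetI)
      fix v assume "v \<in> {v\<in>Y' 0. \<exists>b\<in>Y' 1. \<exists>a\<in>X' 1. (u, b) \<in> E \<and> (a, b) \<in> E \<and> (a, v) \<in> E}"
      then obtain y x where xy: "v \<in> Y' 0" "y \<in> Y' 1" "x \<in> X' 1" "(u, y) \<in> E" "(x, y) \<in> E" "(x, v) \<in> E" by blast
      have "(u, y) \<in> F" "(x, y) \<in> F" "(x, v) \<in> F" using xy inF[of _ _ 1] by auto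
      moreover have "f' x = 1" "g' y = 1" using f'[of 1 x] g'[of 1 y] xy by (auto simp: X'_def Y'_def)
      ultimately show "v \<in> {v\<in>Y' 0. (u, v) \<in> linked F f' g' 1}" using xy by auto
    qed (use fin' in auto)
    finally show ?case by (simp add: N_def)
  next
    case (Suc s)
    have k: "Suc s \<in> {1,2,3}" using Suc by auto
    have "0 < real (card {j\<in>Y' (Suc s). (u, j) \<in> E})" using rowk[OF Suc.prems(2) k] cNp by linarith
    then have "{j\<in>Y' (Suc s). (u, j) \<in> E} \<noteq> {}" by (metis card.empty less_irrefl of_nat_0)
    then obtain y where y: "y \<in> Y' (Suc s)" "(u, y) \<in> E" by blast
    have yY: "y \<in> Y" using y by (simp add: Y'_def)
    have "0 < real (card {i\<in>X' (Suc s). (i, y) \<in> E})" using colk[OF yY k] cNp by linarith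
    then have "{i\<in>X' (Suc s). (i, y) \<in> E} \<noteq> {}" by (metis card.empty less_irrefl of_nat_0)
    then obtain x where x: "x \<in> X' (Suc s)" "(x, y) \<in> E" by blast
    have cols: "f' x = Suc s" "g' y = Suc s" using f'[of "Suc s" x] g'[of "Suc s" y] x y k by (auto simp: X'_def Y'_def)
    have F: "(u, y) \<in> F" "(x, y) \<in> F" using inF[OF y(2) _ k] inF[OF x(2) _ k] y x by auto
    have "(q * d * b / N - \<eta>) * N \<le> real (card {v\<in>Y' 0. (x, v) \<in> linked F f' g' s})"
      using x Suc by (intro Suc.IH) (auto simp: X'_def)
    also have "\<dots> \<le> real (card {v\<in>Y' 0. (u, v) \<in> linked F f' g' (Suc s)})"
      using cols F fin' by (intro of_nat_mono card_mono) auto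
    finally show ?case .
  qed
  have eta_eq: "(q * d * b / N - \<eta>) * N = q * d * b - \<eta> * N" using N by (simp add: field_simps)
  show ?thesis
  proof (rule ccontr)
    assume no: "\<not> ?thesis"
    have avoid: "(u, v) \<notin> linked F f' g' r" if "(u, v) \<in> E" "u \<in> X' 0" "v \<in> Y' 0" for u v
    proof
      assume "(u, v) \<in> linked F f' g' r"
      then have "(u, v) \<in> linked (bip_rel G) f' g' r" using linked_mono FE E by blast
      moreover have "1 \<le> r" using r by auto
      moreover have "f' u = 0" "g' v = 0" using f'[of 0 u] g'[of 0 v] that by (auto simp: X'_def Y'_def)
      ultimately have "has_cycle_of_length G (2 * r + 2)"
        using has_short_cycleI[OF G, of u v f' g' r] that(1) unfolding E by blast
      then show False using no by simp
    qed
    let ?U = "unlinked_pairs n f' g' F r"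
    have U: "?U = Sigma (X' 0) (\<lambda>u. {v\<in>Y' 0. (u, v) \<notin> linked F f' g' r})"
    proof -
      have "(u, v) \<in> ?U \<longleftrightarrow> u \<in> X' 0 \<and> v \<in> Y' 0 \<and> (u, v) \<notin> linked F f' g' r" for u v
        unfolding unlinked_pairs_def X'_def Y'_def using f'[of 0 u] g'[of 0 v] by auto
      then show ?thesis by auto
    qed
    have cardU: "real (card ?U) \<le> a * (b - q * d * b + \<eta> * N)"
    proof -
      have rest: "real (card {v\<in>Y' 0. (u, v) \<notin> linked F f' g' r}) \<le> b - q * d * b + \<eta> * N" if u: "u \<in> X' 0" for u
      proof -
        have "{v\<in>Y' 0. (u, v) \<notin> linked F f' g' r} \<union> {v\<in>Y' 0. (u, v) \<in> linked F f' g' r} = Y' 0" by auto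
        then have "card {v\<in>Y' 0. (u, v) \<notin> linked F f' g' r} + card {v\<in>Y' 0. (u, v) \<in> linked F f' g' r} = card (Y' 0)"
          using fin'(2)[of 0] by (subst card_Un_disjoint[symmetric]) auto
        moreover have "real (card (Y' 0)) \<le> b" unfolding b_def
          using fin by (intro of_nat_mono card_mono) (auto simp: Y'_def)
        moreover have "q * d * b - \<eta> * N \<le> real (card {v\<in>Y' 0. (u, v) \<in> linked F f' g' r})"
          unfolding eta_eq[symmetric] using u r by (intro reach) (auto simp: X'_def)
        ultimately show ?thesis by linarith
      qed
      have "real (card ?U) = (\<Sum>u\<in>X' 0. real (card {v\<in>Y' 0. (u, v) \<notin> linked F f' g' r}))"
        unfolding U using fin' by simp
      also have "\<dots> \<le> (\<Sum>u\<in>X' 0. b - q * d * b + \<eta> * N)" by (rule sum_mono) (rule rest)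
      also have "\<dots> = real (card (X' 0)) * (b - q * d * b + \<eta> * N)" by simp
      also have "\<dots> \<le> a * (b - q * d * b + \<eta> * N)"
      proof (rule mult_right_mono)
        show "real (card (X' 0)) \<le> a" unfolding a_def using fin by (intro of_nat_mono card_mono) (auto simp: X'_def)
        have "q * d * b \<le> 1 * 1 * b" using q d aN by (intro mult_mono) auto
        then show "0 \<le> b - q * d * b + \<eta> * N" using \<eta>\<epsilon> N by (simp add: mult_nonneg_nonneg add_nonneg_nonneg)
      qed
      finally show ?thesis .
    qed
    have "q * (d * p * b) * (q * a) \<le> q * (d * p * b) * real (card (X' 0))"
      using X0 q d p aN by (intro mult_left_mono) auto
    also have "\<dots> \<le> real (card (E \<inter> X' 0 \<times> Y' 0))"
      by (rule edges_between_ge_rows) (use fin' row0 in \<open>auto simp: X'_def\<close>)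
    also have "\<dots> \<le> real (card (W \<inter> ?U))"
    proof (intro of_nat_mono card_mono)
      show "finite (W \<inter> ?U)" using fin' U by auto
      show "E \<inter> X' 0 \<times> Y' 0 \<subseteq> W \<inter> ?U" using avoid EW U by auto
    qed
    also have "\<dots> \<le> p * real (card ?U) + \<eta> * p * (real n)\<^sup>2"
    proof (rule unl[unfolded unlinked_uniform_above_def, rule_format])
      show "f' \<in> {..<n} \<rightarrow>\<^sub>E {..<5}" "g' \<in> {..<n} \<rightarrow>\<^sub>E {..<5}"
        by (auto simp: f'_def g'_def)
      show "F \<subseteq> W \<inter> reserve_pairs n f' g'" using EW by (auto simp: F_def)
      have res: "s \<le> 2 * \<gamma> * N" if "s \<le> (\<gamma> + \<gamma> / 2) * t" "0 \<le> t" "t \<le> N" for s t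
      proof -
        have "(\<gamma> + \<gamma> / 2) * t \<le> (2 * \<gamma>) * N" using that \<gamma> by (intro mult_mono) auto
        then show ?thesis using that(1) by simp
      qed
      have three: "real (card S) \<le> 6 * \<gamma> * N" if "S = S1 \<union> S2 \<union> S3" "real (card S1) \<le> 2 * \<gamma> * N" "real (card S2) \<le> 2 * \<gamma> * N"
        "real (card S3) \<le> 2 * \<gamma> * N" for S S1 S2 S3 :: "nat set"
      proof -
        have "card S \<le> card S1 + card S2 + card S3"
          unfolding that(1) by (metis card_Un_le add_le_mono1 le_trans)
        then show ?thesis using that(2-4) by linarith
      qed
      have resX: "real (card (X' k)) \<le> 2 * \<gamma> * N" if "k \<in> {1,2,3}" for k
        unfolding X'_def using cl(4)[of k] M(2) that aN by (intro res[of _ a]) (auto simp: a_def)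
      have "i < n \<and> f' i \<in> {1,2,3} \<longleftrightarrow> i \<in> X' 1 \<union> X' 2 \<union> X' 3" for i
        using f'[of 1 i] f'[of 2 i] f'[of 3 i] by (auto simp: X'_def)
      then have "{i. i < n \<and> f' i \<in> {1,2,3}} = X' 1 \<union> X' 2 \<union> X' 3" by blast
      then show "real (card {i. i < n \<and> f' i \<in> {1,2,3}}) \<le> 6 * \<gamma> * real n"
        unfolding N_def[symmetric] by (rule three) (auto intro: resX)
      have resY: "real (card (Y' k)) \<le> 2 * \<gamma> * N" if "k \<in> {1,2,3}" for k
        unfolding Y'_def using cl(5)[of k] M(2) that aN by (intro res[of _ b]) (auto simp: b_def)
      have "i < n \<and> g' i \<in> {1,2,3} \<longleftrightarrow> i \<in> Y' 1 \<union> Y' 2 \<union> Y' 3" for i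
        using g'[of 1 i] g'[of 2 i] g'[of 3 i] by (auto simp: Y'_def)
      then have "{i. i < n \<and> g' i \<in> {1,2,3}} = Y' 1 \<union> Y' 2 \<union> Y' 3" by blast
      then show "real (card {i. i < n \<and> g' i \<in> {1,2,3}}) \<le> 6 * \<gamma> * real n"
        unfolding N_def[symmetric] by (rule three) (auto intro: resY)
    qed (use r in auto)
    also have "\<dots> \<le> p * (a * (b - q * d * b + \<eta> * N)) + \<eta> * p * N\<^sup>2"
      using cardU p \<eta>\<epsilon> by (intro add_mono mult_left_mono) (auto simp: N_def)
    finally have "p * (q\<^sup>2 * d * (a * b)) \<le> p * (a * (b - q * d * b + \<eta> * N) + \<eta> * N\<^sup>2)"
      by (simp add: power2_eq_square algebra_simps)
    then have "q\<^sup>2 * d * (a * b) \<le> a * (b - q * d * b + \<eta> * N) + \<eta> * N\<^sup>2" using p by simp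
    moreover have "a * (\<eta> * N) \<le> N * (\<eta> * N)" using aN \<eta>\<epsilon> N by (intro mult_right_mono) auto
    ultimately have "(q\<^sup>2 * d + q * d - 1) * (a * b) \<le> 2 * \<eta> * N\<^sup>2"
      by (simp add: power2_eq_square algebra_simps)
    \<comment> \<open>for \<open>q = 1\<close> the right-hand side is \<open>2 * d - 1 = \<epsilon>\<close>\<close>
    moreover have "\<epsilon> / 2 \<le> q\<^sup>2 * d + q * d - 1"
    proof -
      have "q\<^sup>2 + q = 2 - 12 * \<gamma> + 16 * \<gamma>\<^sup>2" by (simp add: q_def power2_eq_square algebra_simps)
      then have "2 - 12 * \<gamma> \<le> q\<^sup>2 + q" by simp
      then have "(2 - 12 * \<gamma>) * d \<le> (q\<^sup>2 + q) * d" using d by (intro mult_right_mono) auto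
      moreover have "12 * \<gamma> * d \<le> 12 * \<gamma> * 1" using d \<gamma> by (intro mult_left_mono) auto
      ultimately show ?thesis using \<gamma>\<epsilon> by (simp add: algebra_simps d_def)
    qed
    then have "\<epsilon> / 2 * (a * b) \<le> (q\<^sup>2 * d + q * d - 1) * (a * b)" using aN by (intro mult_right_mono) auto
    moreover have "\<epsilon> / 2 * (\<epsilon> / 2 * N\<^sup>2) \<le> \<epsilon> / 2 * (a * b)" using ab \<epsilon> by (intro mult_left_mono) auto
    ultimately have "\<epsilon> / 2 * (\<epsilon> / 2 * N\<^sup>2) \<le> 2 * \<eta> * N\<^sup>2" by linarith
    then have "\<epsilon>\<^sup>2 / 4 * N\<^sup>2 \<le> 2 * \<eta> * N\<^sup>2" by (simp add: power2_eq_square)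
    then have "\<epsilon>\<^sup>2 * N\<^sup>2 \<le> 0" unfolding \<eta> by (simp add: mult.commute)
    moreover have "0 < \<epsilon>\<^sup>2 * N\<^sup>2" using \<epsilon> N by simp
    ultimately show False by linarith
  qed
qed

section \<open>A core that is extremal at every scale\<close>

text \<open>
For \<open>t \<le> 1\<close> this is the weighted inequality between arithmetic and geometric means, with weight \<open>3/4\<close> on
\<open>1 - t\<close> and weight \<open>1/4\<close> on \<open>1\<close>.  In general, the difference is \<open>t\<^sup>2\<close> times a positive quadratic polynomial.
\<close>
lemma cube_le_fourth_power:
  fixes t :: real
  shows "(1 - t)^3 \<le> (1 - 3 * t / 4)^4"
proof -
  have "(1 - 3 * t / 4)^4 - (1 - t)^3 = t\<^sup>2 * (81/256 * (t - 88/81)\<^sup>2 + 1/648)"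
    by (simp add: power2_eq_square power3_eq_cube power4_eq_xxxx field_simps)
  also have "0 \<le> \<dots>" by (intro mult_nonneg_nonneg add_nonneg_nonneg) auto
  finally show ?thesis by simp
qed

text \<open>
Removing a vertex from a set of size \<open>s\<close> in a maximiser of \<open>e^4 / s^3\<close> must cost at least three quarters of the average degree.
\<close>
lemma quarter_loss_degree:
  fixes e \<delta> s :: real
  assumes "0 < e" "\<delta> \<le> e" "1 \<le> s" "(e - \<delta>)^4 * s^3 \<le> e^4 * (s - 1)^3"
  shows "3/4 * e / s \<le> \<delta>"
proof (rule ccontr)
  assume "\<not> ?thesis"
  then have lt: "\<delta> < 3/4 * e / s" by simp
  define t where "t = 1 / s"
  have t: "0 < t" "t \<le> 1" using assms by (auto simp: t_def)
  have "e * (1 - 3 * t / 4) < e - \<delta>" using lt by (simp add: t_def algebra_simps)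
  moreover have "0 \<le> e * (1 - 3 * t / 4)" using assms t by (intro mult_nonneg_nonneg) auto
  ultimately have "(e * (1 - 3 * t / 4))^4 < (e - \<delta>)^4" by (intro power_strict_mono) auto
  then have "(e * (1 - 3 * t / 4))^4 * s^3 < (e - \<delta>)^4 * s^3" using assms by simp
  also have "\<dots> \<le> e^4 * (s - 1)^3" by fact
  also have "(s - 1)^3 = (1 - t)^3 * s^3"
  proof -
    have "s - 1 = (1 - t) * s" using assms by (simp add: t_def field_simps)
    then show ?thesis by (simp add: power_mult_distrib)
  qed
  finally have "e^4 * s^3 * (1 - 3 * t / 4)^4 < e^4 * s^3 * (1 - t)^3" by (simp add: power_mult_distrib mult_ac)
  then have "(1 - 3 * t / 4)^4 < (1 - t)^3" using assms by (simp add: mult_less_cancel_left_pos)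
  then show False using cube_le_fourth_power[of t] by simp
qed

text \<open>
The pair maximises \<open>e(A, B)^4 / (|A| |B|)^3\<close> among pairs of sets that are not too small.  Because \<open>E\<close> has at
least half of the expected edges and \<open>e(X, Y)\<close> is at most about \<open>p |X| |Y|\<close>, the maximiser satisfies
\<open>|X| |Y| \<ge> n\<^sup>2 / 16\<close> up to a small error.  So it lies well above the size restriction, and single vertices
may be removed without violating it.
\<close>
lemma scale_invariant_core:
  fixes p \<eta> :: real
  assumes EW: "E \<subseteq> W" and W: "W \<subseteq> {..<n} \<times> {..<n}" and p: "0 < p" and n: "100 \<le> n"
    and \<eta>: "\<eta> = 1 / 10^10" and uni: "uniform_above n p \<eta> W"
    and edges: "1/2 * p * (real n)\<^sup>2 \<le> real (card E)"
  obtains X Y where "X \<subseteq> {..<n}" "Y \<subseteq> {..<n}"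
    "62499/10^6 * real n \<le> real (card X)" "62499/10^6 * real n \<le> real (card Y)"
    "(real (card X) * real (card Y))^3 * (p^4 * (real n)\<^sup>2) / 16 \<le> real (card (E \<inter> X \<times> Y))^4"
    "\<And>i. i \<in> X \<Longrightarrow> 3/4 * real (card (E \<inter> X \<times> Y)) / real (card X) \<le> real (deg_row E Y i)"
    "\<And>j. j \<in> Y \<Longrightarrow> 3/4 * real (card (E \<inter> X \<times> Y)) / real (card Y) \<le> real (deg_col E X j)"
    "\<And>A B. A \<subseteq> {..<n} \<Longrightarrow> B \<subseteq> {..<n} \<Longrightarrow> real n / 100 \<le> real (card A) \<Longrightarrow> real n / 100 \<le> real (card B) \<Longrightarrow>
       real (card (E \<inter> A \<times> B))^4 * (real (card X) * real (card Y))^3 \<le>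
       real (card (E \<inter> X \<times> Y))^4 * (real (card A) * real (card B))^3"
proof -
  define N where "N = real n"
  have N: "100 \<le> N" using n by (simp add: N_def)
  define S where "S = {(A, B). A \<subseteq> {..<n} \<and> B \<subseteq> {..<n} \<and> N / 100 \<le> real (card A) \<and> N / 100 \<le> real (card B)}"
  define h where "h = (\<lambda>(A, B). real (card (E \<inter> A \<times> B))^4 / (real (card A) * real (card B))^3)"
  have full: "({..<n}, {..<n}) \<in> S" by (simp add: S_def N_def)
  have finS: "finite S" by (rule finite_subset[of _ "Pow {..<n} \<times> Pow {..<n}"]) (auto simp: S_def)
  have neS: "S \<noteq> {}" using full by blast
  obtain z where z: "z \<in> S" "\<forall>z'\<in>S. h z' \<le> h z" using finite_has_max[OF finS neS] by blast
  obtain X Y where zXY: "z = (X, Y)" by (cases z)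
  have XY: "X \<subseteq> {..<n}" "Y \<subseteq> {..<n}" "N / 100 \<le> real (card X)" "N / 100 \<le> real (card Y)"
    using z(1) by (auto simp: S_def zXY)
  have fin: "finite X" "finite Y" using XY finite_subset by blast+
  define a b e where "a = real (card X)" and "b = real (card Y)" and "e = real (card (E \<inter> X \<times> Y))"
  have a: "N / 100 \<le> a" "0 < a" "a \<le> N" using XY N card_mono[OF _ XY(1)] by (auto simp: a_def N_def)
  have b: "N / 100 \<le> b" "0 < b" "b \<le> N" using XY N card_mono[OF _ XY(2)] by (auto simp: b_def N_def)
  have max: "real (card (E \<inter> A \<times> B))^4 * (a * b)^3 \<le> e^4 * (real (card A) * real (card B))^3"
    if "(A, B) \<in> S" for A B
  proof -
    have "0 < real (card A)" "0 < real (card B)" using that N by (auto simp: S_def)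
    moreover have "h (A, B) \<le> h (X, Y)" using z that zXY by auto
    ultimately show ?thesis using a b by (simp add: h_def a_def b_def e_def field_simps)
  qed
  have EE: "E \<inter> {..<n} \<times> {..<n} = E" using EW W by auto
  have e_low: "(a * b)^3 * (p^4 * N\<^sup>2) / 16 \<le> e^4"
  proof -
    have "(1/2 * p * N\<^sup>2)^4 * (a * b)^3 \<le> real (card E)^4 * (a * b)^3"
      using edges p a b by (intro mult_right_mono power_mono) (auto simp: N_def)
    also have "\<dots> \<le> e^4 * (N * N)^3" using max[OF full] EE by (simp add: N_def)
    also have "(N * N)^3 = N^6" by (simp add: power_mult_distrib flip: power_add)
    also have "(1/2 * p * N\<^sup>2)^4 * (a * b)^3 = N^6 * ((a * b)^3 * (p^4 * N\<^sup>2) / 16)"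
    proof -
      have "(N\<^sup>2)^4 = N^6 * N\<^sup>2" by (simp flip: power_add power_mult)
      then show ?thesis by (simp add: power_mult_distrib power_divide)
    qed
    finally have "N^6 * ((a * b)^3 * (p^4 * N\<^sup>2) / 16) \<le> N^6 * e^4" by (simp add: mult.commute)
    then show ?thesis using N by simp
  qed
  have e_up: "e \<le> p * (a * b + \<eta> * N\<^sup>2)"
  proof -
    have "e \<le> real (card (W \<inter> X \<times> Y))" unfolding e_def
      using fin EW by (intro of_nat_mono edges_between_mono) auto
    also have "\<dots> \<le> p * a * b + \<eta> * p * N\<^sup>2"
      using uni[unfolded uniform_above_def, rule_format, OF XY(1,2)] by (simp add: a_def b_def N_def)
    finally show ?thesis by (simp add: algebra_simps)
  qed
  define w where "w = a * b / N\<^sup>2"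
  have ab: "a * b = w * N\<^sup>2" using N by (simp add: w_def)
  have w_low: "1 / 10^4 \<le> w"
  proof -
    have "(N / 100) * (N / 100) \<le> a * b" using a b N by (intro mult_mono) auto
    then show ?thesis using N by (simp add: w_def field_simps power2_eq_square)
  qed
  have "w \<ge> 62499/10^6"
  proof -
    have "\<eta> \<le> w / 10^6" using w_low by (simp add: \<eta>)
    have "w^3 * (p^4 * N^8) / 16 \<le> e^4"
      using e_low unfolding ab by (simp add: power_mult_distrib mult_ac flip: power_add power_mult)
    also have "\<dots> \<le> (p * (a * b + \<eta> * N\<^sup>2))^4" using e_up by (intro power_mono) (auto simp: e_def)
    also have "p * (a * b + \<eta> * N\<^sup>2) = (w + \<eta>) * (p * N\<^sup>2)" by (simp add: ab algebra_simps)
    also have "((w + \<eta>) * (p * N\<^sup>2))^4 \<le> ((w + w / 10^6) * (p * N\<^sup>2))^4"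
      using \<open>\<eta> \<le> w / 10^6\<close> w_low p by (intro power_mono mult_right_mono) (auto simp: \<eta>)
    also have "\<dots> = (1 + 1/10^6)^4 * w^3 * w * (p^4 * N^8)"
    proof -
      have "((w + w / 10^6) * (p * N\<^sup>2))^4 = ((1 + 1/10^6) * w * (p * N\<^sup>2))^4" by (simp add: algebra_simps)
      also have "\<dots> = (1 + 1/10^6)^4 * (w^3 * w) * (p^4 * N^8)"
        by (simp only: power_mult_distrib power_mult[symmetric]) (simp add: power_Suc2[symmetric] del: power_Suc)
      finally show ?thesis by (simp add: mult_ac)
    qed
    finally have "(w^3 * (p^4 * N^8)) * (1/16) \<le> (w^3 * (p^4 * N^8)) * ((1 + 1/10^6)^4 * w)" by (simp add: mult_ac)
    then have "1/16 \<le> (1 + 1/10^6)^4 * w" using w_low p N by (subst (asm) mult_le_cancel_left_pos) auto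
    then show ?thesis by (simp add: power4_eq_xxxx)
  qed
  then have ab_low: "62499/10^6 * N\<^sup>2 \<le> a * b" unfolding ab by (intro mult_right_mono) auto
  have a_low: "62499/10^6 * N \<le> a"
  proof -
    have "a * b \<le> a * N" using a b by (intro mult_left_mono) auto
    then have "(62499/10^6 * N) * N \<le> a * N" using ab_low by (simp add: power2_eq_square)
    then show ?thesis using N by simp
  qed
  have b_low: "62499/10^6 * N \<le> b"
  proof -
    have "a * b \<le> N * b" using a b by (intro mult_right_mono) auto
    then have "(62499/10^6 * N) * N \<le> b * N" using ab_low by (simp add: power2_eq_square mult_ac)
    then show ?thesis using N by simp
  qed
  have e0: "0 < e"
  proof -
    have "0 < (a * b)^3 * (p^4 * N\<^sup>2) / 16" using a b p N by auto
    then have "e^4 > 0" using e_low by linarith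
    then show ?thesis by (cases "e = 0") (auto simp: e_def)
  qed
  have rows: "3/4 * e / a \<le> real (deg_row E Y i)" if i: "i \<in> X" for i
  proof (rule quarter_loss_degree[OF e0])
    let ?d = "real (deg_row E Y i)"
    have rem: "e - ?d = real (card (E \<inter> (X - {i}) \<times> Y))"
      using card_edges_remove_row[OF fin i, of E] by (simp add: e_def)
    then show "?d \<le> e" by linarith
    have a1: "a - 1 = real (card (X - {i}))" using card.remove[OF fin(1) i] by (simp add: a_def)
    have S: "(X - {i}, Y) \<in> S" using XY a_low N a1 by (auto simp: S_def)
    show "1 \<le> a" using a1 by simp
    have "(e - ?d)^4 * (a * b)^3 \<le> e^4 * ((a - 1) * b)^3" using max[OF S] unfolding rem a1 b_def .
    then have "b^3 * ((e - ?d)^4 * a^3) \<le> b^3 * (e^4 * (a - 1)^3)" by (simp add: power_mult_distrib mult_ac)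
    then show "(e - ?d)^4 * a^3 \<le> e^4 * (a - 1)^3" using b by simp
  qed
  have cols: "3/4 * e / b \<le> real (deg_col E X j)" if j: "j \<in> Y" for j
  proof (rule quarter_loss_degree[OF e0])
    let ?d = "real (deg_col E X j)"
    have rem: "e - ?d = real (card (E \<inter> X \<times> (Y - {j})))"
      using card_edges_remove_column[OF fin j, of E] by (simp add: e_def)
    then show "?d \<le> e" by linarith
    have b1: "b - 1 = real (card (Y - {j}))" using card.remove[OF fin(2) j] by (simp add: b_def)
    have S: "(X, Y - {j}) \<in> S" using XY b_low N b1 by (auto simp: S_def)
    show "1 \<le> b" using b1 by simp
    have "(e - ?d)^4 * (a * b)^3 \<le> e^4 * (a * (b - 1))^3" using max[OF S] unfolding rem b1 a_def .
    then have "a^3 * ((e - ?d)^4 * b^3) \<le> a^3 * (e^4 * (b - 1)^3)" by (simp add: power_mult_distrib mult_ac)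
    then show "(e - ?d)^4 * b^3 \<le> e^4 * (b - 1)^3" using a by simp
  qed
  show ?thesis
    by (rule that[of X Y])
      (use XY a_low b_low e_low rows cols max in \<open>auto simp: a_def b_def e_def N_def S_def\<close>)
qed

text \<open>
The arithmetic of the splitting, in units of \<open>n\<close> for sets and \<open>p n\<^sup>2\<close> for edges.  The variables stand for the parts
of a hypothetical splitting \<open>(l1, r1)\<close>, \<open>(l2, r2)\<close> of a colour class of proportion \<open>T\<close>: \<open>m\<close> and \<open>w\<close> are overlaps and
\<open>l0\<close> is a remainder.  Every part inherits at least the relative minimum degree \<open>3/8\<close>, and three disjoint
neighbourhoods do not fit because \<open>3 * 3/8 > 1\<close>; so the remainder is negligible.
\<close>
lemma two_part_sizes:
  fixes x y e dL dR T T' \<eta> :: real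
  assumes T: "T = 62999/10^5" "T' = 63001/10^5" and \<eta>: "\<eta> = 1/10^10"
    and xy: "624/10^4 \<le> x" "624/10^4 \<le> y"
    and dL: "3/8 * y \<le> dL" "468/10^4 \<le> dL" and dR: "468/10^4 \<le> dR"
    and yw: "T * dL - \<eta> \<le> yw" "T * dL - \<eta> \<le> yx" and nonneg: "0 \<le> w" "0 \<le> m" "0 \<le> l0"
    and m: "m * (T * dL) \<le> \<eta>"
    and w: "w * (T * dR) \<le> 3 * \<eta> + m * w"
    and l0: "l0 * (T * dL) \<le> 3 * \<eta> + l0 * (T' * y - yw - yx + w)"
    and l: "yw * (T * dR) \<le> 2 * \<eta> + l1 * yw" "yx * (T * dR) \<le> 2 * \<eta> + l2 * yx"
    and r: "l1 * (T * dL) \<le> l1 * r1 + 2 * \<eta>" "l2 * (T * dL) \<le> l2 * r2 + 2 * \<eta>"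
  shows "m \<le> 1/10^8" "l0 \<le> 1/10^7" "T * dR - 1/10^8 \<le> l1" "T * dR - 1/10^8 \<le> l2"
    "T * dL - 1/10^8 \<le> r1" "T * dL - 1/10^8 \<le> r2"
proof -
  have TdL: "294/10^4 \<le> T * dL" and TdR: "294/10^4 \<le> T * dR" using dL dR by (auto simp: T)
  have "m * (294/10^4) \<le> m * (T * dL)" using TdL nonneg by (intro mult_left_mono) auto
  then have m4: "m \<le> 4/10^9" using m by (simp add: \<eta>)
  then show "m \<le> 1/10^8" by simp
  have "w * (294/10^4 - 4/10^9) \<le> w * (T * dR - m)" using TdR m4 nonneg by (intro mult_left_mono) auto
  also have "\<dots> \<le> 3 * \<eta>" using w by (simp add: algebra_simps)
  finally have w2: "w \<le> 2/10^8" by (simp add: \<eta>)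
  have "T * dL \<ge> T * (3/8 * y)" using dL by (intro mult_left_mono) (auto simp: T)
  then have "4/10^3 \<le> T * dL - (T' * y - yw - yx + w)"
    using yw w2 xy by (simp add: T \<eta>)
  then have "l0 * (4/10^3) \<le> l0 * (T * dL - (T' * y - yw - yx + w))" using nonneg by (intro mult_left_mono) auto
  also have "\<dots> \<le> 3 * \<eta>" using l0 by (simp add: algebra_simps)
  finally show "l0 \<le> 1/10^7" by (simp add: \<eta>)
  have lower: "c - 1/10^8 \<le> z" if "s * c \<le> s * z + 2 * \<eta>" "29/10^3 \<le> s" for s c z
  proof (rule ccontr)
    assume "\<not> ?thesis"
    then have "1/10^8 \<le> c - z" by simp
    then have "(29/10^3) * (1/10^8) \<le> s * (c - z)" using that by (intro mult_mono) auto
    then show False using that by (simp add: algebra_simps \<eta>)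
  qed
  have yy: "29/10^3 \<le> yw" "29/10^3 \<le> yx" using yw TdL by (auto simp: \<eta>)
  show l12: "T * dR - 1/10^8 \<le> l1" "T * dR - 1/10^8 \<le> l2"
    using lower[of yw "T * dR" l1] lower[of yx "T * dR" l2] l yy by (auto simp: mult.commute add.commute)
  then have ll: "29/10^3 \<le> l1" "29/10^3 \<le> l2" using TdR by auto
  show "T * dL - 1/10^8 \<le> r1" "T * dL - 1/10^8 \<le> r2"
    using lower[of l1 "T * dL" r1] lower[of l2 "T * dL" r2] r ll by auto
qed

text \<open>
Each part has at most a fraction \<open>5/8\<close> of the class on either side.  With \<open>z\<^sub>i = l\<^sub>i r\<^sub>i / (x y)\<close> the extremality of the
core bounds its edges by \<open>e z\<^sub>i powr (3/4)\<close>, and \<open>sqrt z\<^sub>1 + sqrt z\<^sub>2 \<le> T\<close> by the Cauchy-Schwarz inequality.  The total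
is at most \<open>e T sqrt (5 T / 8)\<close>, less than the \<open>T\<^sup>2 e\<close> edges of the class as soon as \<open>T > 5/8\<close>.
\<close>
lemma two_parts_too_sparse:
  fixes x y e dL dR T T' \<eta> :: real
  assumes T: "T = 62999/10^5" "T' = 63001/10^5" and \<eta>: "\<eta> = 1/10^10"
    and xy: "624/10^4 \<le> x" "624/10^4 \<le> y" and e: "1/1000 \<le> e"
    and dL: "3/8 * y \<le> dL" "468/10^4 \<le> dL" and dR: "3/8 * x \<le> dR" "468/10^4 \<le> dR"
    and m: "m \<le> 1/10^8" and l0: "l0 \<le> 1/10^7"
    and l: "T * dR - 1/10^8 \<le> l1" "T * dR - 1/10^8 \<le> l2"
    and r: "T * dL - 1/10^8 \<le> r1" "T * dL - 1/10^8 \<le> r2"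
    and ls: "l1 + l2 \<le> T' * x + m" and rs: "r1 + r2 \<le> T' * y"
    and E: "T\<^sup>2 * e \<le> E1 + E2 + 4 * \<eta> + l0"
    and E1: "E1^4 * (x * y)^3 \<le> e^4 * (l1 * r1)^3"
    and E2: "E2^4 * (x * y)^3 \<le> e^4 * (l2 * r2)^3"
  shows False
proof -
  \<comment> \<open>an upper bound for \<open>sqrt 0.3938\<close>\<close>
  define \<beta> where "\<beta> = (62754/10^5 :: real)"
  have TR: "T * (3/8 * x) \<le> T * dR" using dR by (intro mult_left_mono) (auto simp: T)
  have TL: "T * (3/8 * y) \<le> T * dL" using dL by (intro mult_left_mono) (auto simp: T)
  have lpos: "0 < l1" "0 < l2" using l dR by (auto simp: T)
  have rpos: "0 < r1" "0 < r2" using r dL by (auto simp: T)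
  have lup: "l1 \<le> 3938/10^4 * x" "l2 \<le> 3938/10^4 * x" using ls l TR m xy by (auto simp: T)
  have rup: "r1 \<le> 3938/10^4 * y" "r2 \<le> 3938/10^4 * y" using rs r TL xy by (auto simp: T)
  have xy0: "0 < x * y" using xy by simp
  have key: "F \<le> e * \<beta> * sqrt (s * t / (x * y))"
    if F: "F^4 * (x * y)^3 \<le> e^4 * (s * t)^3" and st: "0 < s" "0 < t" "s \<le> 3938/10^4 * x" "t \<le> 3938/10^4 * y" for F s t
  proof (rule ccontr)
    assume "\<not> ?thesis"
    then have lt: "e * \<beta> * sqrt (s * t / (x * y)) < F" by simp
    define z where "z = s * t / (x * y)"
    have z0: "0 < z" using st xy0 by (simp add: z_def)
    have "s * t \<le> (3938/10^4 * x) * (3938/10^4 * y)" using st xy by (intro mult_mono) auto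
    then have z1: "z \<le> (3938/10^4)\<^sup>2" using xy0 by (simp add: z_def divide_simps power2_eq_square mult_ac)
    have "s * t = s * t / P * P" if "0 < P" for P :: real using that by simp
    from this[OF xy0] have stz: "s * t = z * (x * y)" by (simp only: z_def)
    have sq: "sqrt z ^ 4 = z\<^sup>2"
    proof -
      have "sqrt z ^ 4 = (sqrt z ^ 2) ^ 2" by (simp only: power_mult[symmetric]) simp
      then show ?thesis using z0 by simp
    qed
    have "F^4 * (x * y)^3 \<le> (e^4 * z^3) * (x * y)^3" using F unfolding stz by (simp add: power_mult_distrib mult_ac)
    then have F4: "F^4 \<le> e^4 * z^3" using xy0 by simp
    also have "z^3 = z\<^sup>2 * z" by (simp add: power2_eq_square power3_eq_cube)
    also have "e^4 * (z\<^sup>2 * z) \<le> e^4 * (z\<^sup>2 * \<beta>^4)"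
    proof -
      have "z \<le> \<beta>^4" using z1 by (simp add: \<beta>_def power2_eq_square power4_eq_xxxx)
      then show ?thesis by (intro mult_left_mono) auto
    qed
    also have "\<dots> = (e * \<beta> * sqrt z)^4" by (simp only: power_mult_distrib sq) simp
    also have "\<dots> < F^4" using lt e z0 by (intro power_strict_mono) (auto simp: z_def \<beta>_def)
    finally show False by simp
  qed
  have cs: "sqrt (l1 * r1) + sqrt (l2 * r2) \<le> sqrt ((l1 + l2) * (r1 + r2))"
  proof (rule real_le_rsqrt)
    have "2 * sqrt (l1 * r2) * sqrt (l2 * r1) \<le> l1 * r2 + l2 * r1"
      using zero_le_power2[of "sqrt (l1 * r2) - sqrt (l2 * r1)"] lpos rpos by (simp add: power2_diff)
    moreover have "sqrt (l1 * r2) * sqrt (l2 * r1) = sqrt (l1 * r1) * sqrt (l2 * r2)"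
      by (simp add: real_sqrt_mult[symmetric] mult_ac)
    ultimately show "(sqrt (l1 * r1) + sqrt (l2 * r2))\<^sup>2 \<le> (l1 + l2) * (r1 + r2)"
      using lpos rpos by (simp add: power2_sum algebra_simps)
  qed
  also have "\<dots> \<le> sqrt ((63002/10^5)\<^sup>2 * (x * y))"
  proof -
    have "(l1 + l2) * (r1 + r2) \<le> (63002/10^5 * x) * (63002/10^5 * y)"
    proof (rule mult_mono)
      show "l1 + l2 \<le> 63002/10^5 * x" using ls m xy by (simp add: T)
      show "r1 + r2 \<le> 63002/10^5 * y" using rs xy by (simp add: T)
    qed (use xy rpos in auto)
    then show ?thesis by (simp add: power2_eq_square mult_ac)
  qed
  also have "\<dots> = 63002/10^5 * sqrt (x * y)" by (simp add: real_sqrt_mult)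
  finally have "sqrt (l1 * r1 / (x * y)) + sqrt (l2 * r2 / (x * y)) \<le> 63002/10^5"
    using xy0 by (simp add: real_sqrt_divide add_divide_distrib[symmetric] pos_divide_le_eq)
  then have "(e * \<beta>) * (sqrt (l1 * r1 / (x * y)) + sqrt (l2 * r2 / (x * y))) \<le> (e * \<beta>) * (63002/10^5)"
    using e by (intro mult_left_mono) (auto simp: \<beta>_def)
  then have "E1 + E2 \<le> (e * \<beta>) * (63002/10^5)"
    using key[OF E1 lpos(1) rpos(1) lup(1) rup(1)] key[OF E2 lpos(2) rpos(2) lup(2) rup(2)]
    by (simp add: algebra_simps)
  then show False using E e l0 by (simp add: \<beta>_def T \<eta> power2_eq_square)
qed

section \<open>Joining the two ends of a path inside the core\<close>

definition density :: "nat \<Rightarrow> real \<Rightarrow> (nat \<times> nat) set \<Rightarrow> nat set \<Rightarrow> nat set \<Rightarrow> real" where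
  "density n p E A B = real (card (E \<inter> A \<times> B)) / (p * (real n)\<^sup>2)"

definition proportion :: "nat \<Rightarrow> nat set \<Rightarrow> real" where
  "proportion n A = real (card A) / real n"

lemma density_le:
  assumes "uniform_above n p \<eta> W" "E \<subseteq> W" "A \<subseteq> {..<n}" "B \<subseteq> {..<n}" "0 < p" "0 < n"
  shows "density n p E A B \<le> proportion n A * proportion n B + \<eta>"
proof -
  have fin: "finite A" "finite B" using assms finite_subset by blast+
  have "real (card (E \<inter> A \<times> B)) \<le> real (card (W \<inter> A \<times> B))"
    using fin assms by (intro of_nat_mono edges_between_mono) auto
  also have "\<dots> \<le> p * real (card A) * real (card B) + \<eta> * p * (real n)\<^sup>2"
    using assms(1)[unfolded uniform_above_def, rule_format, OF assms(3,4)] .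
  also have "\<dots> = (proportion n A * proportion n B + \<eta>) * (p * (real n)\<^sup>2)"
    using assms by (simp add: proportion_def field_simps power2_eq_square)
  finally show ?thesis using assms by (simp add: density_def pos_divide_le_eq)
qed

lemma density_ge_rows:
  assumes "A \<subseteq> {..<n}" "B \<subseteq> {..<n}" "0 < p" "0 < n"
    "\<And>i. i \<in> A \<Longrightarrow> d * p * real n \<le> real (deg_row E B i)"
  shows "proportion n A * d \<le> density n p E A B"
proof -
  have "finite A" "finite B" using assms finite_subset by blast+
  then have "d * p * real n * real (card A) \<le> real (card (E \<inter> A \<times> B))"
    using assms by (intro edges_between_ge_rows) auto
  then show ?thesis using assms by (simp add: density_def proportion_def field_simps power2_eq_square)
qed

lemma density_ge_columns:
  assumes "A \<subseteq> {..<n}" "B \<subseteq> {..<n}" "0 < p" "0 < n"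
    "\<And>j. j \<in> B \<Longrightarrow> d * p * real n \<le> real (deg_col E A j)"
  shows "proportion n B * d \<le> density n p E A B"
proof -
  have "finite A" "finite B" using assms finite_subset by blast+
  then have "d * p * real n * real (card B) \<le> real (card (E \<inter> A \<times> B))"
    using assms by (intro edges_between_ge_columns) auto
  then show ?thesis using assms by (simp add: density_def proportion_def field_simps power2_eq_square)
qed

lemma density_mono:
  assumes "finite A'" "finite B'" "A \<subseteq> A'" "B \<subseteq> B'" "0 < p"
  shows "density n p E A B \<le> density n p E A' B'"
  using edges_between_mono[OF assms(1,2) subset_refl assms(3,4), of E] assms(5)
  by (simp add: density_def divide_right_mono)

lemma density_Un_rows:
  assumes "0 < p"
  shows "density n p E (A \<union> A') B \<le> density n p E A B + density n p E A' B"
proof -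
  have "E \<inter> (A \<union> A') \<times> B = E \<inter> A \<times> B \<union> E \<inter> A' \<times> B" by auto
  then have "card (E \<inter> (A \<union> A') \<times> B) \<le> card (E \<inter> A \<times> B) + card (E \<inter> A' \<times> B)"
    using card_Un_le by metis
  then have "real (card (E \<inter> (A \<union> A') \<times> B)) \<le> real (card (E \<inter> A \<times> B)) + real (card (E \<inter> A' \<times> B))" by linarith
  then show ?thesis using assms by (simp add: density_def divide_right_mono add_divide_distrib[symmetric])
qed

lemma density_Un_columns:
  assumes "0 < p"
  shows "density n p E A (B \<union> B') \<le> density n p E A B + density n p E A B'"
proof -
  have "E \<inter> A \<times> (B \<union> B') = E \<inter> A \<times> B \<union> E \<inter> A \<times> B'" by auto
  then have "card (E \<inter> A \<times> (B \<union> B')) \<le> card (E \<inter> A \<times> B) + card (E \<inter> A \<times> B')"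
    using card_Un_le by metis
  then have "real (card (E \<inter> A \<times> (B \<union> B'))) \<le> real (card (E \<inter> A \<times> B)) + real (card (E \<inter> A \<times> B'))" by linarith
  then show ?thesis using assms by (simp add: density_def divide_right_mono add_divide_distrib[symmetric])
qed

lemma proportion_le_1: "A \<subseteq> {..<n} \<Longrightarrow> proportion n A \<le> 1"
  using card_mono[of "{..<n}" A] by (cases "n = 0") (auto simp: proportion_def)

lemma proportion_nonneg: "0 \<le> proportion n A" by (simp add: proportion_def)

lemma proportion_mono: "finite B \<Longrightarrow> A \<subseteq> B \<Longrightarrow> proportion n A \<le> proportion n B"
  by (simp add: proportion_def divide_right_mono card_mono)

lemma proportion_Un_Int:
  "finite A \<Longrightarrow> finite B \<Longrightarrow> proportion n A + proportion n B = proportion n (A \<union> B) + proportion n (A \<inter> B)"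
  using card_Un_Int[of A B] by (simp add: proportion_def add_divide_distrib[symmetric] flip: of_nat_add)

lemma density_le_rows:
  assumes "A \<subseteq> {..<n}" "B \<subseteq> {..<n}" "0 < p" "0 < n" "0 \<le> k" "k \<le> \<eta> * (p * real n)"
    "\<And>i. i \<in> A \<Longrightarrow> real (deg_row E B i) \<le> k"
  shows "density n p E A B \<le> \<eta>"
proof -
  have fin: "finite A" "finite B" using assms finite_subset by blast+
  have "real (card (E \<inter> A \<times> B)) \<le> k * real (card A)"
    by (rule edges_between_le_rows) (use fin assms in auto)
  also have "\<dots> \<le> (\<eta> * (p * real n)) * real n"
    using assms card_mono[OF _ assms(1)] by (intro mult_mono) auto
  finally show ?thesis using assms by (simp add: density_def pos_divide_le_eq power2_eq_square mult_ac)
qed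

lemma density_le_columns:
  assumes "A \<subseteq> {..<n}" "B \<subseteq> {..<n}" "0 < p" "0 < n" "0 \<le> k" "k \<le> \<eta> * (p * real n)"
    "\<And>j. j \<in> B \<Longrightarrow> real (deg_col E A j) \<le> k"
  shows "density n p E A B \<le> \<eta>"
proof -
  have fin: "finite A" "finite B" using assms finite_subset by blast+
  have "real (card (E \<inter> A \<times> B)) \<le> k * real (card B)"
    by (rule edges_between_le_columns) (use fin assms in auto)
  also have "\<dots> \<le> (\<eta> * (p * real n)) * real n"
    using assms card_mono[OF _ assms(2)] by (intro mult_mono) auto
  finally show ?thesis using assms by (simp add: density_def pos_divide_le_eq power2_eq_square mult_ac)
qed

text \<open>
Everything is normalised: \<open>x\<close>, \<open>y\<close> are the proportions of the two sides, \<open>e\<close> is the number of edges in units of \<open>p n\<^sup>2\<close>, and \<open>dL\<close>, \<open>dR\<close> are degrees in units of \<open>p n\<close>.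
\<close>
locale balanced_core =
  fixes n :: nat and p \<eta> :: real and E W :: "(nat \<times> nat) set" and X Y :: "nat set"
    and x y e dL dR :: real
  assumes EW: "E \<subseteq> W" and p: "0 < p" and n: "100 \<le> n"
    and \<eta>: "\<eta> = 1 / 10^10" and uni: "uniform_above n p \<eta> W"
    and XY: "X \<subseteq> {..<n}" "Y \<subseteq> {..<n}"
    and x: "x = proportion n X" and y: "y = proportion n Y" and e: "e = density n p E X Y"
    and xy: "624/10^4 \<le> x" "624/10^4 \<le> y" and e_ge: "1/1000 \<le> e"
    and dL: "3/8 * y \<le> dL" "468/10^4 \<le> dL" and dR: "3/8 * x \<le> dR" "468/10^4 \<le> dR"
    and rows: "\<And>i. i \<in> X \<Longrightarrow> dL * p * real n \<le> real (deg_row E Y i)"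
    and cols: "\<And>j. j \<in> Y \<Longrightarrow> dR * p * real n \<le> real (deg_col E X j)"
    and max: "\<And>A B. A \<subseteq> {..<n} \<Longrightarrow> B \<subseteq> {..<n} \<Longrightarrow> 1 / 100 \<le> proportion n A \<Longrightarrow> 1 / 100 \<le> proportion n B \<Longrightarrow>
       (density n p E A B)^4 * (x * y)^3 \<le> e^4 * (proportion n A * proportion n B)^3"

text \<open>
The extremal pair in normalised form.  The degree bounds \<open>3/8 y\<close> and \<open>0.0468\<close> both follow from \<open>e^4 \<ge> (x y)^3 / 16\<close>; the first one is relative to the core, the second one absolute.
\<close>
lemma balanced_core_exists:
  fixes p \<eta> :: real
  assumes EW: "E \<subseteq> W" and W: "W \<subseteq> {..<n} \<times> {..<n}" and p: "0 < p" and n: "100 \<le> n"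
    and \<eta>: "\<eta> = 1 / 10^10" and uni: "uniform_above n p \<eta> W"
    and edges: "1/2 * p * (real n)\<^sup>2 \<le> real (card E)"
  obtains X Y x y e dL dR where "balanced_core n p \<eta> E W X Y x y e dL dR"
proof -
  obtain X Y where XY: "X \<subseteq> {..<n}" "Y \<subseteq> {..<n}"
    "62499/10^6 * real n \<le> real (card X)" "62499/10^6 * real n \<le> real (card Y)"
    and low: "(real (card X) * real (card Y))^3 * (p^4 * (real n)\<^sup>2) / 16 \<le> real (card (E \<inter> X \<times> Y))^4"
    and rows: "\<And>i. i \<in> X \<Longrightarrow> 3/4 * real (card (E \<inter> X \<times> Y)) / real (card X) \<le> real (deg_row E Y i)"
    and cols: "\<And>j. j \<in> Y \<Longrightarrow> 3/4 * real (card (E \<inter> X \<times> Y)) / real (card Y) \<le> real (deg_col E X j)"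
    and max: "\<And>A B. A \<subseteq> {..<n} \<Longrightarrow> B \<subseteq> {..<n} \<Longrightarrow> real n / 100 \<le> real (card A) \<Longrightarrow> real n / 100 \<le> real (card B) \<Longrightarrow>
       real (card (E \<inter> A \<times> B))^4 * (real (card X) * real (card Y))^3 \<le>
       real (card (E \<inter> X \<times> Y))^4 * (real (card A) * real (card B))^3"
    using scale_invariant_core[OF assms] by blast
  define N where "N = real n"
  have N: "100 \<le> N" using n by (simp add: N_def)
  define x y e where "x = proportion n X" and "y = proportion n Y" and "e = density n p E X Y"
  have cX: "real (card X) = x * N" and cY: "real (card Y) = y * N"
    using N by (auto simp: x_def y_def proportion_def N_def)
  have cA: "real (card A) = proportion n A * N" for A using N by (simp add: proportion_def N_def)
  have cE: "real (card (E \<inter> A \<times> B)) = density n p E A B * (p * N\<^sup>2)" for A B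
    using p N by (simp add: density_def N_def)
  have pN: "0 < p * N\<^sup>2" "0 < p^4 * N^8" using p N by auto
  have x_low: "62499/10^6 \<le> x" "62499/10^6 \<le> y" using XY(3,4) N by (auto simp: cX cY N_def[symmetric])
  have x_up: "x \<le> 1" "y \<le> 1" using XY by (auto simp: x_def y_def intro: proportion_le_1)
  have scale: "(s * (p * N\<^sup>2))^4 * ((t * N) * (u * N))^3 = (s^4 * (t * u)^3) * (p^4 * N^14)" for s t u :: real
    by (simp add: power_mult_distrib mult_ac flip: power_add power_mult)
  have e4: "(x * y)^3 / 16 \<le> e^4"
  proof -
    have "((x * N) * (y * N))^3 * (p^4 * N\<^sup>2) / 16 \<le> (e * (p * N\<^sup>2))^4"
      using low unfolding cX cY cE e_def[symmetric] N_def[symmetric] .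
    moreover have "((x * N) * (y * N))^3 * (p^4 * N\<^sup>2) / 16 = (x * y)^3 / 16 * (p^4 * N^8)"
      by (simp add: power_mult_distrib mult_ac flip: power_add power_mult)
    moreover have "(e * (p * N\<^sup>2))^4 = e^4 * (p^4 * N^8)" by (simp add: power_mult_distrib flip: power_mult)
    ultimately have "(x * y)^3 / 16 * (p^4 * N^8) \<le> e^4 * (p^4 * N^8)" by (simp only:)
    then show ?thesis using pN(2) by (rule mult_right_le_imp_le)
  qed
  have e0: "0 \<le> e" using p by (simp add: e_def density_def)
  have half: "1/2 * (x * y) \<le> e"
  proof (rule ccontr)
    assume "\<not> ?thesis"
    then have "e^4 < (1/2 * (x * y))^4" using e0 by (intro power_strict_mono) auto
    also have "\<dots> = (x * y)^3 / 16 * (x * y)" by (simp add: power4_eq_xxxx power3_eq_cube)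
    also have "\<dots> \<le> (x * y)^3 / 16 * 1"
      using x_low x_up mult_mono[of x 1 y 1] by (intro mult_left_mono) auto
    finally show False using e4 by simp
  qed
  have part: "624/10^4 * s \<le> e" if st: "x * y = s * t" "0 < s" "s \<le> 1" "62499/10^6 \<le> t" for s t
  proof (rule ccontr)
    assume "\<not> ?thesis"
    then have "e^4 < (624/10^4 * s)^4" using e0 by (intro power_strict_mono) auto
    also have "\<dots> = (624/10^4)^4 * s * s^3" by (simp add: power4_eq_xxxx power3_eq_cube)
    also have "\<dots> \<le> ((62499/10^6)^3 / 16) * s^3"
      using st by (intro mult_right_mono) (auto simp: power4_eq_xxxx power3_eq_cube)
    also have "\<dots> \<le> (t^3 / 16) * s^3" using st by (intro mult_right_mono divide_right_mono power_mono) auto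
    also have "\<dots> = (x * y)^3 / 16" unfolding st(1) by (simp add: power_mult_distrib)
    finally show False using e4 by simp
  qed
  define dL dR where "dL = 3/4 * e / x" and "dR = 3/4 * e / y"
  show ?thesis
  proof (rule that, unfold_locales)
    show "x = proportion n X" "y = proportion n Y" "e = density n p E X Y" by (simp_all add: x_def y_def e_def)
    show "624/10^4 \<le> x" "624/10^4 \<le> y" using x_low by auto
    have ex: "624/10^4 * x \<le> e" by (rule part[of x y]) (use x_low x_up in auto)
    have ey: "624/10^4 * y \<le> e" by (rule part[of y x]) (use x_low x_up in auto)
    show "1/1000 \<le> e" using ex x_low by simp
    show "3/8 * y \<le> dL" "468/10^4 \<le> dL" "3/8 * x \<le> dR" "468/10^4 \<le> dR"
      using half ex ey x_low by (simp_all add: dL_def dR_def pos_le_divide_eq mult_ac)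
    show "dL * p * real n \<le> real (deg_row E Y i)" if "i \<in> X" for i
      using rows[OF that] x_low N unfolding cX cE e_def[symmetric]
      by (simp add: dL_def N_def[symmetric] power2_eq_square mult_ac)
    show "dR * p * real n \<le> real (deg_col E X j)" if "j \<in> Y" for j
      using cols[OF that] x_low N unfolding cY cE e_def[symmetric]
      by (simp add: dR_def N_def[symmetric] power2_eq_square mult_ac)
    show "(density n p E A B)^4 * (x * y)^3 \<le> e^4 * (proportion n A * proportion n B)^3"
      if "A \<subseteq> {..<n}" "B \<subseteq> {..<n}" "1 / 100 \<le> proportion n A" "1 / 100 \<le> proportion n B" for A B
    proof -
      have "(density n p E A B * (p * N\<^sup>2))^4 * ((x * N) * (y * N))^3 \<le>
        (e * (p * N\<^sup>2))^4 * ((proportion n A * N) * (proportion n B * N))^3"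
        using max[OF that(1,2)] that(3,4) N
        unfolding cX cY cE cA[of A] cA[of B] e_def[symmetric] by (simp add: N_def)
      then have "(density n p E A B)^4 * (x * y)^3 * (p^4 * N^14) \<le> e^4 * (proportion n A * proportion n B)^3 * (p^4 * N^14)"
        unfolding scale .
      moreover have "0 < p^4 * N^14" using p N by simp
      ultimately show ?thesis by (rule mult_right_le_imp_le)
    qed
  qed (use assms XY in auto)
qed

context balanced_core
begin

text \<open>
Let \<open>L1\<close> and \<open>L2\<close> be the vertices with several neighbours in \<open>Yw\<close> and in \<open>Yx\<close>, respectively.  If no vertex of \<open>YC\<close> has neighbours in
both, then the neighbourhood \<open>R1\<close> of \<open>L1\<close> and its complement \<open>R2\<close> split the class, with hardly any edges
between \<open>(L1, R1)\<close> and \<open>(L2, R2)\<close>; this contradicts the extremality of the core.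
\<close>
lemma closing_vertex_exists:
  fixes T T' :: real
  assumes T: "T = 62999/10^5" "T' = 63001/10^5" and pn: "2 * 10^10 \<le> p * real n"
    and C: "XC \<subseteq> X" "YC \<subseteq> Y" "proportion n XC \<le> T' * x" "proportion n YC \<le> T' * y"
    and rowC: "\<And>i. i \<in> X \<Longrightarrow> T * real (deg_row E Y i) \<le> real (deg_row E YC i)"
    and colC: "\<And>j. j \<in> Y \<Longrightarrow> T * real (deg_col E X j) \<le> real (deg_col E XC j)"
    and Yw: "Yw \<subseteq> YC" "T * dL - \<eta> \<le> proportion n Yw" and Yx: "Yx \<subseteq> YC" "T * dL - \<eta> \<le> proportion n Yx"
  shows "\<exists>y1\<in>Yw. \<exists>y2\<in>Yx. \<exists>v\<in>YC. \<exists>u1\<in>XC. \<exists>u2\<in>XC. y1 \<noteq> y2 \<and> y1 \<noteq> v \<and> y2 \<noteq> v \<and> u1 \<noteq> u2 \<and>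
    (u1, y1) \<in> E \<and> (u1, v) \<in> E \<and> (u2, v) \<in> E \<and> (u2, y2) \<in> E"
proof (rule ccontr)
  assume no: "\<not> ?thesis"
  have n0: "0 < n" using n by simp
  have sub: "XC \<subseteq> {..<n}" "YC \<subseteq> {..<n}" "Yw \<subseteq> {..<n}" "Yx \<subseteq> {..<n}" using XY C Yw Yx by auto
  have fin: "finite XC" "finite YC" "finite Yw" "finite Yx" "finite X" "finite Y"
    using sub XY finite_subset by blast+
  have k\<eta>: "2 \<le> \<eta> * (p * real n)" using pn by (simp add: \<eta>)
  have D: "density n p E A B \<le> proportion n A * proportion n B + \<eta>" if "A \<subseteq> {..<n}" "B \<subseteq> {..<n}" for A B
    by (rule density_le[OF uni EW that p n0])
  \<comment> \<open>three neighbours, because two of them may have to be avoided when the path is assembled\<close>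
  define L1 where "L1 = {u\<in>XC. 3 \<le> deg_row E Yw u}"
  define L2 where "L2 = {u\<in>XC. 3 \<le> deg_row E Yx u}"
  have L: "L1 \<subseteq> XC" "L2 \<subseteq> XC" by (auto simp: L1_def L2_def)
  have Ln: "L1 \<subseteq> {..<n}" "L2 \<subseteq> {..<n}" using L sub by auto
  have finL: "finite L1" "finite L2" using L fin finite_subset by blast+
  have pick: "\<exists>z\<in>S. z \<noteq> a \<and> z \<noteq> b" if "3 \<le> card S" for S :: "nat set" and a b
  proof (rule ccontr)
    assume "\<not> ?thesis"
    then have "S \<subseteq> {a, b}" by auto
    then have "card S \<le> card {a, b}" by (intro card_mono) auto
    also have "\<dots> \<le> 2" by (simp add: card_insert_if)
    finally show False using that by simp
  qed
  have nc: "u1 = u2" if h: "v \<in> YC" "u1 \<in> L1" "u2 \<in> L2" "(u1, v) \<in> E" "(u2, v) \<in> E" for v u1 u2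
  proof (rule ccontr)
    assume ne: "u1 \<noteq> u2"
    have "3 \<le> deg_row E Yw u1" "3 \<le> deg_row E Yx u2" using h by (auto simp: L1_def L2_def)
    note many = this
    obtain y1 where y1: "y1 \<in> Yw" "(u1, y1) \<in> E" "y1 \<noteq> v" using pick[OF many(1), of v v] by auto
    obtain y2 where y2: "y2 \<in> Yx" "(u2, y2) \<in> E" "y2 \<noteq> v" "y2 \<noteq> y1" using pick[OF many(2), of v y1] by auto
    have u: "u1 \<in> XC" "u2 \<in> XC" using h L by auto
    show False
      by (rule notE[OF no], rule bexI[OF _ y1(1)], rule bexI[OF _ y2(1)], rule bexI[OF _ h(1)],
          rule bexI[OF _ u(1)], rule bexI[OF _ u(2)]) (use y1 y2 h ne in simp)
  qed
  have rowT: "T * dL * p * real n \<le> real (deg_row E YC i)" if "i \<in> X" for i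
  proof -
    have "T * (dL * p * real n) \<le> T * real (deg_row E Y i)"
      using rows[OF that] by (intro mult_left_mono) (auto simp: T)
    then show ?thesis using rowC[OF that] by (simp add: mult_ac)
  qed
  have colT: "T * dR * p * real n \<le> real (deg_col E XC j)" if "j \<in> Y" for j
  proof -
    have "T * (dR * p * real n) \<le> T * real (deg_col E X j)"
      using cols[OF that] by (intro mult_left_mono) (auto simp: T)
    then show ?thesis using colC[OF that] by (simp add: mult_ac)
  qed
  have DL: "proportion n A * (T * dL) \<le> density n p E A YC" if "A \<subseteq> XC" for A
    by (rule density_ge_rows) (use that sub C rowT p n0 in auto)
  have DR: "proportion n B * (T * dR) \<le> density n p E XC B" if "B \<subseteq> YC" for B
    by (rule density_ge_columns) (use that sub C colT p n0 in auto)
  have few1: "density n p E (XC - L1) Yw \<le> \<eta>"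
    by (rule density_le_rows[where k = 2]) (use sub p n0 k\<eta> in \<open>auto simp: L1_def\<close>)
  have few2: "density n p E (XC - L2) Yx \<le> \<eta>"
    by (rule density_le_rows[where k = 2]) (use sub p n0 k\<eta> in \<open>auto simp: L2_def\<close>)
  define m w l0 where "m = proportion n (L1 \<inter> L2)" and "w = proportion n (Yw \<inter> Yx)"
    and "l0 = proportion n (XC - (L1 \<union> L2))"
  define l1 l2 yw yx where "l1 = proportion n L1" and "l2 = proportion n L2"
    and "yw = proportion n Yw" and "yx = proportion n Yx"
  \<comment> \<open>two neighbours in \<open>L1\<close>, because one of them may coincide with the neighbour in \<open>L2\<close>\<close>
  define R1 where "R1 = {v\<in>YC. 2 \<le> deg_col E L1 v}"
  define R2 where "R2 = YC - R1"
  define r1 r2 where "r1 = proportion n R1" and "r2 = proportion n R2"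
  have R: "R1 \<subseteq> YC" "R2 \<subseteq> YC" "R1 \<union> R2 = YC" "R1 \<inter> R2 = {}" by (auto simp: R1_def R2_def)
  have Rn: "R1 \<subseteq> {..<n}" "R2 \<subseteq> {..<n}" using R sub by auto
  have finR: "finite R1" "finite R2" using R fin finite_subset by blast+
  have m_ineq: "m * (T * dL) \<le> \<eta>"
  proof -
    have "density n p E (L1 \<inter> L2) YC \<le> \<eta>"
    proof (rule density_le_columns[where k = 1])
      fix j assume j: "j \<in> YC"
      have "u = u'" if "u \<in> {i\<in>L1 \<inter> L2. (i, j) \<in> E}" "u' \<in> {i\<in>L1 \<inter> L2. (i, j) \<in> E}" for u u'
        using nc[OF j, of u u'] that by auto
      moreover have "finite {i\<in>L1 \<inter> L2. (i, j) \<in> E}" using finL by auto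
      ultimately have "card {i\<in>L1 \<inter> L2. (i, j) \<in> E} \<le> 1" unfolding One_nat_def by (subst card_le_Suc0_iff_eq) blast+
      then show "real (card {i\<in>L1 \<inter> L2. (i, j) \<in> E}) \<le> 1" by simp
    qed (use Ln sub p n0 k\<eta> in auto)
    moreover have "m * (T * dL) \<le> density n p E (L1 \<inter> L2) YC" unfolding m_def using L by (intro DL) auto
    ultimately show ?thesis by linarith
  qed
  have w_ineq: "w * (T * dR) \<le> 3 * \<eta> + m * w"
  proof -
    have "w * (T * dR) \<le> density n p E XC (Yw \<inter> Yx)" unfolding w_def using Yw by (intro DR) auto
    also have "\<dots> \<le> density n p E ((XC - L1) \<union> ((XC - L2) \<union> (L1 \<inter> L2))) (Yw \<inter> Yx)"
      using fin finL p by (intro density_mono) auto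
    also have "\<dots> \<le> density n p E (XC - L1) (Yw \<inter> Yx) +
        (density n p E (XC - L2) (Yw \<inter> Yx) + density n p E (L1 \<inter> L2) (Yw \<inter> Yx))"
      using density_Un_rows[OF p, of n E "XC - L1" "(XC - L2) \<union> (L1 \<inter> L2)" "Yw \<inter> Yx"]
        density_Un_rows[OF p, of n E "XC - L2" "L1 \<inter> L2" "Yw \<inter> Yx"] by linarith
    also have "density n p E (XC - L1) (Yw \<inter> Yx) \<le> density n p E (XC - L1) Yw"
      using fin p by (intro density_mono) auto
    also have "density n p E (XC - L2) (Yw \<inter> Yx) \<le> density n p E (XC - L2) Yx"
      using fin p by (intro density_mono) auto
    also have "density n p E (L1 \<inter> L2) (Yw \<inter> Yx) \<le> m * w + \<eta>"
      unfolding m_def w_def using Ln sub by (intro D) auto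
    finally show ?thesis using few1 few2 by simp
  qed
  have l0_ineq: "l0 * (T * dL) \<le> 3 * \<eta> + l0 * (T' * y - yw - yx + w)"
  proof -
    let ?L0 = "XC - (L1 \<union> L2)" and ?R = "YC - (Yw \<union> Yx)"
    have "l0 * (T * dL) \<le> density n p E ?L0 YC" unfolding l0_def by (rule DL) auto
    also have "\<dots> \<le> density n p E ?L0 (Yw \<union> (Yx \<union> ?R))" using fin p by (intro density_mono) auto
    also have "\<dots> \<le> density n p E ?L0 Yw + (density n p E ?L0 Yx + density n p E ?L0 ?R)"
      using density_Un_columns[OF p, of n E ?L0 Yw "Yx \<union> ?R"] density_Un_columns[OF p, of n E ?L0 Yx ?R] by linarith
    also have "density n p E ?L0 Yw \<le> density n p E (XC - L1) Yw" using fin p by (intro density_mono) auto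
    also have "density n p E ?L0 Yx \<le> density n p E (XC - L2) Yx" using fin p by (intro density_mono) auto
    also have "density n p E ?L0 ?R \<le> l0 * proportion n ?R + \<eta>"
      unfolding l0_def using sub by (intro D) auto
    also have "proportion n ?R \<le> T' * y - yw - yx + w"
    proof -
      have "proportion n ?R + proportion n (Yw \<union> Yx) = proportion n YC"
        using proportion_Un_Int[of ?R "Yw \<union> Yx" n] fin Yw Yx
        by (simp add: proportion_def Un_absorb2 Diff_partition Int_commute)
      moreover have "yw + yx = proportion n (Yw \<union> Yx) + w"
        unfolding yw_def yx_def w_def using fin by (intro proportion_Un_Int) auto
      ultimately show ?thesis using C by linarith
    qed
    finally show ?thesis using few1 few2 by (simp add: l0_def mult_left_mono proportion_nonneg)
  qed
  have l_ineq: "yw * (T * dR) \<le> 2 * \<eta> + l1 * yw" "yx * (T * dR) \<le> 2 * \<eta> + l2 * yx"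
  proof -
    have "yw * (T * dR) \<le> density n p E XC Yw" unfolding yw_def using Yw by (intro DR) auto
    also have "\<dots> \<le> density n p E ((XC - L1) \<union> L1) Yw" using fin finL p by (intro density_mono) auto
    also have "\<dots> \<le> density n p E (XC - L1) Yw + density n p E L1 Yw" by (rule density_Un_rows[OF p])
    also have "density n p E L1 Yw \<le> l1 * yw + \<eta>" unfolding l1_def yw_def using Ln sub by (intro D) auto
    finally show "yw * (T * dR) \<le> 2 * \<eta> + l1 * yw" using few1 by simp
    have "yx * (T * dR) \<le> density n p E XC Yx" unfolding yx_def using Yx by (intro DR) auto
    also have "\<dots> \<le> density n p E ((XC - L2) \<union> L2) Yx" using fin finL p by (intro density_mono) auto
    also have "\<dots> \<le> density n p E (XC - L2) Yx + density n p E L2 Yx" by (rule density_Un_rows[OF p])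
    also have "density n p E L2 Yx \<le> l2 * yx + \<eta>" unfolding l2_def yx_def using Ln sub by (intro D) auto
    finally show "yx * (T * dR) \<le> 2 * \<eta> + l2 * yx" using few2 by simp
  qed
  have cross1: "density n p E L1 R2 \<le> \<eta>"
    by (rule density_le_columns[where k = 1]) (use Ln Rn p n0 k\<eta> in \<open>auto simp: R2_def R1_def\<close>)
  have cross2: "density n p E L2 R1 \<le> 0"
  proof -
    have "(u2, v) \<notin> E" if u: "u2 \<in> L2" and v: "v \<in> R1" for u2 v
    proof
      assume e: "(u2, v) \<in> E"
      have "{u\<in>L1. (u, v) \<in> E} \<subseteq> {u2}" using nc[of v _ u2] u v e by (auto simp: R1_def)
      then have "deg_col E L1 v \<le> card {u2}" by (intro card_mono) auto
      then show False using v by (simp add: R1_def)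
    qed
    then have "E \<inter> L2 \<times> R1 = {}" by auto
    then show ?thesis by (simp add: density_def)
  qed
  have r_ineq: "l1 * (T * dL) \<le> l1 * r1 + 2 * \<eta>" "l2 * (T * dL) \<le> l2 * r2 + 2 * \<eta>"
  proof -
    have "l1 * (T * dL) \<le> density n p E L1 YC" unfolding l1_def by (rule DL) (rule L)
    also have "\<dots> \<le> density n p E L1 R1 + density n p E L1 R2"
      using density_Un_columns[OF p, of n E L1 R1 R2] R by simp
    also have "density n p E L1 R1 \<le> l1 * r1 + \<eta>" unfolding l1_def r1_def using Ln Rn by (intro D)
    finally show "l1 * (T * dL) \<le> l1 * r1 + 2 * \<eta>" using cross1 by simp
    have "l2 * (T * dL) \<le> density n p E L2 YC" unfolding l2_def by (rule DL) (rule L)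
    also have "\<dots> \<le> density n p E L2 R1 + density n p E L2 R2"
      using density_Un_columns[OF p, of n E L2 R1 R2] R by simp
    also have "density n p E L2 R2 \<le> l2 * r2 + \<eta>" unfolding l2_def r2_def using Ln Rn by (intro D)
    finally show "l2 * (T * dL) \<le> l2 * r2 + 2 * \<eta>" using cross2 by (simp add: \<eta>)
  qed
  have ls: "l1 + l2 \<le> T' * x + m"
  proof -
    have "l1 + l2 = proportion n (L1 \<union> L2) + m"
      unfolding l1_def l2_def m_def using finL by (intro proportion_Un_Int)
    moreover have "proportion n (L1 \<union> L2) \<le> proportion n XC" using fin L by (intro proportion_mono) auto
    ultimately show ?thesis using C by linarith
  qed
  have rs: "r1 + r2 \<le> T' * y"
    using proportion_Un_Int[OF finR, of n] R C by (simp add: r1_def r2_def proportion_def)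
  have total: "T\<^sup>2 * e \<le> density n p E L1 R1 + density n p E L2 R2 + 4 * \<eta> + l0"
  proof -
    have "T * real (card (E \<inter> X \<times> Y)) = (\<Sum>j\<in>Y. T * real (deg_col E X j))"
      using fin by (simp add: edges_between_by_columns sum_distrib_left)
    also have "\<dots> \<le> (\<Sum>j\<in>Y. real (deg_col E XC j))" by (rule sum_mono) (rule colC)
    also have "\<dots> = real (card (E \<inter> XC \<times> Y))" using fin by (simp add: edges_between_by_columns)
    finally have 1: "T * real (card (E \<inter> X \<times> Y)) \<le> real (card (E \<inter> XC \<times> Y))" .
    have "T * real (card (E \<inter> XC \<times> Y)) = (\<Sum>i\<in>XC. T * real (deg_row E Y i))"
      using fin by (simp add: edges_between_by_rows sum_distrib_left)
    also have "\<dots> \<le> (\<Sum>i\<in>XC. real (deg_row E YC i))" by (rule sum_mono) (use rowC C in auto)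
    also have "\<dots> = real (card (E \<inter> XC \<times> YC))" using fin by (simp add: edges_between_by_rows)
    finally have 2: "T * real (card (E \<inter> XC \<times> Y)) \<le> real (card (E \<inter> XC \<times> YC))" .
    have "T * (T * real (card (E \<inter> X \<times> Y))) \<le> T * real (card (E \<inter> XC \<times> Y))"
      using 1 by (intro mult_left_mono) (auto simp: T)
    then have "T\<^sup>2 * real (card (E \<inter> X \<times> Y)) \<le> real (card (E \<inter> XC \<times> YC))"
      using 2 by (simp add: power2_eq_square)
    then have "T\<^sup>2 * e \<le> density n p E XC YC"
      using p by (simp add: e density_def divide_right_mono)
    also have "\<dots> \<le> density n p E ((XC - (L1 \<union> L2)) \<union> (L1 \<union> L2)) YC" using fin finL p by (intro density_mono) auto
    also have "\<dots> \<le> density n p E (XC - (L1 \<union> L2)) YC + (density n p E L1 YC + density n p E L2 YC)"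
      using density_Un_rows[OF p, of n E "XC - (L1 \<union> L2)" "L1 \<union> L2" YC] density_Un_rows[OF p, of n E L1 L2 YC] by linarith
    also have "density n p E (XC - (L1 \<union> L2)) YC \<le> l0 * proportion n YC + \<eta>"
      unfolding l0_def using sub by (intro D) auto
    also have "l0 * proportion n YC \<le> l0 * 1"
      using proportion_le_1[OF sub(2)] by (intro mult_left_mono) (auto simp: l0_def proportion_nonneg)
    also have "density n p E L1 YC \<le> density n p E L1 R1 + density n p E L1 R2"
      using density_Un_columns[OF p, of n E L1 R1 R2] R by simp
    also have "density n p E L2 YC \<le> density n p E L2 R1 + density n p E L2 R2"
      using density_Un_columns[OF p, of n E L2 R1 R2] R by simp
    finally show ?thesis using cross1 cross2 by (simp add: \<eta>)
  qed
  note sizes = two_part_sizes[OF T \<eta> xy dL dR(2) Yw(2)[folded yw_def] Yx(2)[folded yx_def] _ _ _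
      m_ineq w_ineq l0_ineq l_ineq r_ineq]
  have nn: "0 \<le> w" "0 \<le> m" "0 \<le> l0" by (auto simp: w_def m_def l0_def proportion_nonneg)
  note sizes = sizes[OF nn]
  have "294/10^4 \<le> T * dL" "294/10^4 \<le> T * dR" using dL dR by (auto simp: T)
  then have big: "1/100 \<le> l1" "1/100 \<le> l2" "1/100 \<le> r1" "1/100 \<le> r2" using sizes by auto
  show False
  proof (rule two_parts_too_sparse[OF T \<eta> xy e_ge dL dR sizes(1,2,3,4,5,6) ls rs total])
    show "density n p E L1 R1 ^ 4 * (x * y) ^ 3 \<le> e ^ 4 * (l1 * r1) ^ 3"
      unfolding l1_def r1_def using big Ln Rn by (intro max) (auto simp: l1_def r1_def)
    show "density n p E L2 R2 ^ 4 * (x * y) ^ 3 \<le> e ^ 4 * (l2 * r2) ^ 3"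
      unfolding l2_def r2_def using big Ln Rn by (intro max) (auto simp: l2_def r2_def)
  qed
qed

end

section \<open>Cycles of length at least ten\<close>

text \<open>
A set of linear size with minimum degree \<open>d p n\<close> has a neighbourhood of size almost \<open>d n\<close>, because fewer endpoints could not absorb all the edges.
\<close>
lemma linear_neighbourhood_rows:
  assumes uni: "uniform_above n p \<eta> W" and EW: "E \<subseteq> W" and p: "0 < p" and n: "0 < n" and \<eta>: "\<eta> = 1 / 10^10"
    and AZ: "A \<subseteq> {..<n}" "Z \<subseteq> {..<n}" and A: "real n / 10^5 \<le> real (card A)"
    and deg: "\<And>i. i \<in> A \<Longrightarrow> d * p * real n \<le> real (deg_row E Z i)"
  shows "(d - 1/10^5) * real n \<le> real (card {j\<in>Z. \<exists>i\<in>A. (i, j) \<in> E})"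
proof -
  let ?B = "{j\<in>Z. \<exists>i\<in>A. (i, j) \<in> E}"
  have B: "?B \<subseteq> {..<n}" using AZ by auto
  have "proportion n A * d \<le> density n p E A ?B"
  proof (rule density_ge_rows[OF AZ(1) B p n])
    fix i assume i: "i \<in> A"
    then have "{j\<in>Z. (i, j) \<in> E} = {j\<in>?B. (i, j) \<in> E}" by auto
    then show "d * p * real n \<le> real (deg_row E ?B i)" using deg[OF i] by simp
  qed
  also have "\<dots> \<le> proportion n A * proportion n ?B + \<eta>" by (rule density_le[OF uni EW AZ(1) B p n])
  finally have 1: "proportion n A * (d - proportion n ?B) \<le> \<eta>" by (simp add: algebra_simps)
  have a: "1 / 10^5 \<le> proportion n A" using A n by (simp add: proportion_def field_simps)
  have "d - proportion n ?B \<le> 1/10^5"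
  proof (rule ccontr)
    assume "\<not> ?thesis"
    then have "1/10^5 < d - proportion n ?B" by simp
    then have "(1 / 10^5) * (1/10^5) < proportion n A * (d - proportion n ?B)"
      using a by (intro mult_le_less_imp_less) auto
    then show False using 1 by (simp add: \<eta>)
  qed
  then have "d - 1/10^5 \<le> proportion n ?B" by simp
  then have "(d - 1/10^5) * real n \<le> proportion n ?B * real n" by (intro mult_right_mono) auto
  then show ?thesis using n by (simp add: proportion_def)
qed

lemma uniform_above_converse:
  assumes "uniform_above n p \<eta> W"
  shows "uniform_above n p \<eta> (W\<inverse>)"
proof -
  have "W\<inverse> \<inter> A \<times> B = prod.swap ` (W \<inter> B \<times> A)" for A B by force
  then have swap: "card (W\<inverse> \<inter> A \<times> B) = card (W \<inter> B \<times> A)" for A B by (simp add: card_image)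
  show ?thesis unfolding uniform_above_def swap
  proof (intro allI impI)
    fix A B assume "A \<subseteq> {..<n}" "B \<subseteq> {..<n}"
    then have "real (card (W \<inter> B \<times> A)) \<le> p * real (card B) * real (card A) + \<eta> * p * (real n)\<^sup>2"
      using assms[unfolded uniform_above_def, rule_format] by blast
    then show "real (card (W \<inter> B \<times> A)) \<le> p * real (card A) * real (card B) + \<eta> * p * (real n)\<^sup>2"
      by (simp add: mult_ac)
  qed
qed

lemma linear_neighbourhood_columns:
  assumes uni: "uniform_above n p \<eta> W" and EW: "E \<subseteq> W" and p: "0 < p" and n: "0 < n" and \<eta>: "\<eta> = 1 / 10^10"
    and BZ: "B \<subseteq> {..<n}" "Z \<subseteq> {..<n}" and B: "real n / 10^5 \<le> real (card B)"
    and deg: "\<And>j. j \<in> B \<Longrightarrow> d * p * real n \<le> real (deg_col E Z j)"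
  shows "(d - 1/10^5) * real n \<le> real (card {i\<in>Z. \<exists>j\<in>B. (i, j) \<in> E})"
  using linear_neighbourhood_rows[OF uniform_above_converse[OF uni] _ p n \<eta> BZ B, of "E\<inverse>" d] EW deg by auto

text \<open>
When the depth-first search has abandoned a small linear set on one side, the neighbourhood of this set must lie in
the path, up to another small set; so the path is as long as the expansion permits.
\<close>
lemma long_path_exists:
  fixes d :: real
  assumes uni: "uniform_above n p \<eta> W" and EW: "E \<subseteq> W" and p: "0 < p" and n: "10^6 \<le> n" and \<eta>: "\<eta> = 1 / 10^10"
    and AB: "A \<subseteq> {..<n}" "B \<subseteq> {..<n}" and A: "real n / 10^4 \<le> real (card A)"
    and degA: "\<And>i. i \<in> A \<Longrightarrow> d * p * real n \<le> real (deg_row E B i)"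
    and degB: "\<And>j. j \<in> B \<Longrightarrow> d * p * real n \<le> real (deg_col E A j)"
  shows "\<exists>q. successively (bip_adj E) q \<and> distinct q \<and> set q \<subseteq> Inl ` A \<union> Inr ` B \<and>
     2 * ((d - 3/10^5) * real n) \<le> real (length q) + 1"
proof -
  define s where "s = nat \<lceil>real n / 10^5\<rceil>"
  have s: "real n / 10^5 \<le> real s" "real s \<le> real n / 10^5 + 1" 
  proof -
    have "0 \<le> real n / 10^5" by simp
    then show "real n / 10^5 \<le> real s" "real s \<le> real n / 10^5 + 1" unfolding s_def by linarith+
  qed
  have s2: "real s \<le> 2 * (real n / 10^5)"
  proof -
    have "10^6 \<le> real n" using n by (metis of_nat_le_iff of_nat_numeral of_nat_power)
    then show ?thesis using s(2) by simp
  qed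
  have n0: "0 < n" using n by simp
  have fin: "finite A" "finite B" using AB finite_subset by blast+
  have "real s \<le> real (card A)" using s2 A by simp
  then have sA: "s \<le> card (Inl ` A :: (nat + nat) set)" by (simp add: card_image)
  have finI: "finite (Inl ` A :: (nat + nat) set)" "finite (Inr ` B :: (nat + nat) set)" using fin by auto
  from maximal_search_path[OF finI, of "bip_adj E" s, OF bip_adj_sym sA]
  obtain q S where q: "distinct q" "set q \<subseteq> Inl ` A \<union> Inr ` B" "successively (bip_adj E) q"
    and S: "S \<subseteq> Inl ` A \<union> Inr ` B" and sep: "\<forall>z\<in>S. \<forall>z'\<in>Inl ` A \<union> Inr ` B - S - set q. \<not> bip_adj E z z'"
    and size: "card (S \<inter> Inl ` A) = s \<and> card (S \<inter> Inr ` B) \<le> s \<or> card (S \<inter> Inr ` B) = s \<and> card (S \<inter> Inl ` A) \<le> s"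
    by auto
  define SA SB where "SA = {i. Inl i \<in> S}" and "SB = {j. Inr j \<in> S}"
  have SAB: "SA \<subseteq> A" "SB \<subseteq> B" using S by (auto simp: SA_def SB_def)
  have "S \<inter> Inl ` A = Inl ` SA" "S \<inter> Inr ` B = Inr ` SB" using SAB by (auto simp: SA_def SB_def)
  then have sizes: "card (S \<inter> Inl ` A) = card SA" "card (S \<inter> Inr ` B) = card SB"
    by (simp_all add: card_image)
  have finS: "finite SA" "finite SB" using SAB fin finite_subset by blast+
  define PA PB where "PA = {i. Inl i \<in> set q}" and "PB = {j. Inr j \<in> set q}"
  have PAB: "PA \<subseteq> A" "PB \<subseteq> B" using q(2) by (auto simp: PA_def PB_def)
  have finP: "finite PA" "finite PB" using PAB fin finite_subset by blast+
  have len: "2 * card PA \<le> length q + 1" "2 * card PB \<le> length q + 1"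
    using bip_path_length_ge[OF q(3,1)] by (auto simp: PA_def PB_def)
  have "(d - 3/10^5) * real n \<le> real (card PA) \<or> (d - 3/10^5) * real n \<le> real (card PB)"
    using size unfolding sizes
  proof (elim disjE conjE)
    assume h: "card SA = s" "card SB \<le> s"
    have "(d - 1/10^5) * real n \<le> real (card {j\<in>B. \<exists>i\<in>SA. (i, j) \<in> E})"
      by (rule linear_neighbourhood_rows[OF uni EW p n0 \<eta>]) (use SAB AB s h degA in auto)
    also have "card {j\<in>B. \<exists>i\<in>SA. (i, j) \<in> E} \<le> card (SB \<union> PB)"
    proof (rule card_mono)
      show "{j\<in>B. \<exists>i\<in>SA. (i, j) \<in> E} \<subseteq> SB \<union> PB"
      proof
        fix j assume "j \<in> {j\<in>B. \<exists>i\<in>SA. (i, j) \<in> E}"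
        then obtain i where i: "j \<in> B" "Inl i \<in> S" "(i, j) \<in> E" by (auto simp: SA_def)
        show "j \<in> SB \<union> PB"
        proof (rule ccontr)
          assume "j \<notin> SB \<union> PB"
          then have "Inr j \<in> Inl ` A \<union> Inr ` B - S - set q" using i by (auto simp: SB_def PB_def)
          then show False using sep i by force
        qed
      qed
    qed (use finS finP in auto)
    also have "card (SB \<union> PB) \<le> card SB + card PB" by (rule card_Un_le)
    finally have "(d - 1/10^5) * real n \<le> real s + real (card PB)" using h by linarith
    then have "(d - 3/10^5) * real n \<le> real (card PB)" using s2 by (simp add: algebra_simps)
    then show ?thesis ..
  next
    assume h: "card SB = s" "card SA \<le> s"
    have "(d - 1/10^5) * real n \<le> real (card {i\<in>A. \<exists>j\<in>SB. (i, j) \<in> E})"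
      by (rule linear_neighbourhood_columns[OF uni EW p n0 \<eta>]) (use SAB AB s h degB in auto)
    also have "card {i\<in>A. \<exists>j\<in>SB. (i, j) \<in> E} \<le> card (SA \<union> PA)"
    proof (rule card_mono)
      show "{i\<in>A. \<exists>j\<in>SB. (i, j) \<in> E} \<subseteq> SA \<union> PA"
      proof
        fix i assume "i \<in> {i\<in>A. \<exists>j\<in>SB. (i, j) \<in> E}"
        then obtain j where j: "i \<in> A" "Inr j \<in> S" "(i, j) \<in> E" by (auto simp: SB_def)
        show "i \<in> SA \<union> PA"
        proof (rule ccontr)
          assume "i \<notin> SA \<union> PA"
          then have "Inl i \<in> Inl ` A \<union> Inr ` B - S - set q" using j by (auto simp: SA_def PA_def)
          then show False using sep j by force
        qed
      qed
    qed (use finS finP in auto)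
    also have "card (SA \<union> PA) \<le> card SA + card PA" by (rule card_Un_le)
    finally have "(d - 1/10^5) * real n \<le> real s + real (card PA)" using h by linarith
    then have "(d - 3/10^5) * real n \<le> real (card PA)" using s2 by (simp add: algebra_simps)
    then show ?thesis ..
  qed
  moreover have "2 * real (card PA) \<le> real (length q) + 1" "2 * real (card PB) \<le> real (length q) + 1"
    using len by linarith+
  ultimately have "2 * ((d - 3/10^5) * real n) \<le> real (length q) + 1" by auto
  then show ?thesis using q by blast
qed

text \<open>
Class 0 serves for closing the path and has to exceed \<open>5/8\<close>; class 3 hosts the path and has to exceed
\<open>64/180\<close>, since degrees of at least \<open>3/64 p n\<close> should yield \<open>n / 60\<close> path vertices on each side.  Classes 1 and
2 are reserved for leaving the two ends of the path, and a fifth class absorbs the rest.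
\<close>
lemma path_colours:
  obtains M :: "nat pmf" where "pmf M 0 = 63/100" "pmf M 1 = 2/1000" "pmf M 2 = 2/1000" "pmf M 3 = 36/100"
proof -
  define xs where "xs = [(0::nat, 63/100 :: real), (1, 2/1000), (2, 2/1000), (3, 36/100), (4, 6/1000)]"
  have wf: "pmf_of_list_wf xs" by (intro pmf_of_list_wfI) (auto simp: xs_def)
  show ?thesis
    by (rule that[of "pmf_of_list xs"]) (auto simp: pmf_pmf_of_list[OF wf], auto simp: xs_def)
qed

text \<open>
The cycle consists of a path of length \<open>t - 10\<close> in class 3 with ends \<open>w\<close> and \<open>z\<close>, two paths of length three that leave
these ends through the classes 1 and 2, and a path of length four in class 0 joining them.
\<close>
lemma long_cycle:
  fixes p \<eta> c K :: real
  assumes G: "simple_graph G" and E: "E = bip_rel G" and EW: "E \<subseteq> W" and W: "W \<subseteq> {..<n} \<times> {..<n}"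
    and edges: "1/2 * p * (real n)\<^sup>2 \<le> real (card E)"
    and p: "0 < p" "p \<le> 1" and K: "0 \<le> K" and \<eta>: "\<eta> = 1/10^10" and c: "c = 9/10^5"
    and uni: "uniform_above n p \<eta> W" and sub: "sublinear_uniform_above n p K \<eta> W"
    and exp: "small_sets_expand n p c K W"
    and small: "8 * (real n + 1) * exp (- ((1/10^5)\<^sup>2 * (468/10^4 * p * real n) / 4)) < 1"
    and pn: "2 * 10^10 \<le> p * real n" and n: "10^6 \<le> n"
    and t: "even t" "10 \<le> t" "real t \<le> real n / 30"
  shows "has_cycle_of_length G t"
proof -
  have n100: "100 \<le> n" "0 < n" using n by simp_all
  define N where "N = real n"
  have N: "10^6 \<le> N" unfolding N_def using n by (metis of_nat_le_iff of_nat_numeral of_nat_power)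
  obtain X Y x y e dL dR where core: "balanced_core n p \<eta> E W X Y x y e dL dR"
    using balanced_core_exists[OF EW W p(1) n100(1) \<eta> uni edges] by blast
  note p_le = p(2) and n_large = n
  interpret balanced_core n p \<eta> E W X Y x y e dL dR by (rule core)
  have fin: "finite X" "finite Y" using XY finite_subset by blast+
  have cX: "real (card X) = x * N" and cY: "real (card Y) = y * N"
    using n100 x y by (simp_all add: proportion_def N_def)
  have pN: "0 < p * N" using p N by simp
  have degL: "468/10^4 * p * N \<le> real (deg_row E Y i)" if "i \<in> X" for i
  proof -
    have "468/10^4 * (p * N) \<le> dL * (p * N)" using dL pN by (intro mult_right_mono) auto
    then show ?thesis using rows[OF that] by (simp add: N_def)
  qed
  have degR: "468/10^4 * p * N \<le> real (deg_col E X j)" if "j \<in> Y" for j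
  proof -
    have "468/10^4 * (p * N) \<le> dR * (p * N)" using dR pN by (intro mult_right_mono) auto
    then show ?thesis using cols[OF that] by (simp add: N_def)
  qed
  have size_large: "468/10^4 * p * N \<le> s * N" if "624/10^4 \<le> s" for s
  proof -
    have "468/10^4 * p \<le> s" using p_le that by simp
    then show ?thesis using N by (intro mult_right_mono) auto
  qed
  obtain M :: "nat pmf" where M: "pmf M 0 = 63/100" "pmf M 1 = 2/1000" "pmf M 2 = 2/1000" "pmf M 3 = 36/100"
    by (rule path_colours)
  obtain f g where fg: "balanced_classes E X Y M (1/10^5) f g"
  proof (rule balanced_classes_exist[OF XY])
    show "468/10^4 * p * real n \<le> real (deg_row E Y i)" if "i \<in> X" for i
      using degL[OF that] by (simp add: N_def)
    show "468/10^4 * p * real n \<le> real (deg_col E X j)" if "j \<in> Y" for j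
      using degR[OF that] by (simp add: N_def)
    show "468/10^4 * p * real n \<le> real (card X)" "468/10^4 * p * real n \<le> real (card Y)"
      using size_large[OF xy(1)] size_large[OF xy(2)] by (simp_all add: cX cY N_def)
  qed (use small in auto)
  note cl = balanced_classesD[OF fg]
  define X' Y' where "X' k = {i\<in>X. f i = k}" and "Y' k = {j\<in>Y. g j = k}" for k
  have XYk: "X' k \<subseteq> X" "Y' k \<subseteq> Y" for k by (auto simp: X'_def Y'_def)
  then have sub': "X' k \<subseteq> {..<n}" "Y' k \<subseteq> {..<n}" for k using XY by blast+
  note rowk = cl(1)[folded Y'_def] and colk = cl(2)[folded X'_def]
  have cnp: "c * real n * p = 9/10^5 * (p * N)" by (simp add: c N_def)
  have row_res: "c * real n * p \<le> real (deg_row E (Y' k) i)" if "i \<in> X" "k \<in> {1,2}" for i k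
  proof -
    have k: "pmf M k = 2/1000" "k \<le> 3" using that M by auto
    have "(2/1000 - 1/10^5) * (468/10^4 * p * N) \<le> (2/1000 - 1/10^5) * real (deg_row E Y i)"
      using degL[OF that(1)] by (intro mult_left_mono) auto
    then show ?thesis unfolding cnp using rowk[OF k(2) that(1)] k pN by (simp add: mult_ac)
  qed
  have col_res: "c * real n * p \<le> real (deg_col E (X' k) j)" if "j \<in> Y" "k \<in> {1,2}" for j k
  proof -
    have k: "pmf M k = 2/1000" "k \<le> 3" using that M by auto
    have "(2/1000 - 1/10^5) * (468/10^4 * p * N) \<le> (2/1000 - 1/10^5) * real (deg_col E X j)"
      using degR[OF that(1)] by (intro mult_left_mono) auto
    then show ?thesis unfolding cnp using colk[OF k(2) that(1)] k pN by (simp add: mult_ac)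
  qed
  have row_path: "16847/10^6 * p * real n \<le> real (deg_row E (Y' 3) i)" if "i \<in> X" for i
  proof -
    have "(36/100 - 1/10^5) * (468/10^4 * p * N) \<le> (36/100 - 1/10^5) * real (deg_row E Y i)"
      using degL[OF that(1)] by (intro mult_left_mono) auto
    then show ?thesis using rowk[OF _ that(1), of 3] M pN by (simp add: N_def mult_ac)
  qed
  have col_path: "16847/10^6 * p * real n \<le> real (deg_col E (X' 3) j)" if "j \<in> Y" for j
  proof -
    have "(36/100 - 1/10^5) * (468/10^4 * p * N) \<le> (36/100 - 1/10^5) * real (deg_col E X j)"
      using degR[OF that(1)] by (intro mult_left_mono) auto
    then show ?thesis using colk[OF _ that(1), of 3] M pN by (simp add: N_def mult_ac)
  qed
  have "\<exists>q. successively (bip_adj E) q \<and> distinct q \<and> set q \<subseteq> Inl ` X' 3 \<union> Inr ` Y' 3 \<and>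
     2 * ((16847/10^6 - 3/10^5) * real n) \<le> real (length q) + 1"
  proof (rule long_path_exists[OF uni EW p n_large \<eta> sub'])
    have "(36/100 - 1/10^5) * real (card X) \<le> real (card (X' 3))"
      using cl(3)[of 3] M unfolding X'_def by simp
    moreover have "624/10^4 * N \<le> real (card X)" unfolding cX using xy N by (intro mult_right_mono) auto
    ultimately show "real n / 10^4 \<le> real (card (X' 3))" using N by (simp add: N_def)
    show "16847/10^6 * p * real n \<le> real (deg_row E (Y' 3) i)" if "i \<in> X' 3" for i
      using row_path that XYk(1) by blast
    show "16847/10^6 * p * real n \<le> real (deg_col E (X' 3) j)" if "j \<in> Y' 3" for j
      using col_path that XYk(2) by blast
  qed
  then obtain q0 where q0: "successively (bip_adj E) q0" "distinct q0" "set q0 \<subseteq> Inl ` X' 3 \<union> Inr ` Y' 3"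
    "2 * ((16847/10^6 - 3/10^5) * N) \<le> real (length q0) + 1" by (auto simp: N_def)
  have "real (t - 10 + 2) \<le> real (length q0)"
    using q0(4) t N by (simp add: N_def of_nat_diff)
  then have "t - 10 + 2 \<le> length q0" by linarith
  moreover have "even (t - 10)" using t(1) by simp
  ultimately obtain q where q': "successively (bip_adj E) q" "distinct q"
    "set q \<subseteq> set q0" "length q = t - 10 + 1" "isl (hd q)" "isl (last q)"
    using bip_subpath[OF q0(1,2)] by blast
  note q = q'(1,2) subset_trans[OF q'(3) q0(3)] q'(4-6)
  have qne: "q \<noteq> []" using q(4) by auto
  have "hd q \<in> Inl ` X' 3" "last q \<in> Inl ` X' 3"
    using hd_in_set[OF qne] last_in_set[OF qne] q(3,5,6) by auto
  then obtain w z where w: "hd q = Inl w" "w \<in> X' 3" and z: "last q = Inl z" "z \<in> X' 3" by blast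
  define T T' :: real where "T = 62999/10^5" and "T' = 63001/10^5"
  have growth: "(T * dL - \<eta>) * real n \<le> real (card {v\<in>Y' 0. \<exists>b\<in>Y' k. \<exists>a\<in>X' k. (u, b) \<in> E \<and> (a, b) \<in> E \<and> (a, v) \<in> E})"
    if "u \<in> X" "k \<in> {1,2}" for u k
  proof (rule third_neighbourhood_large[OF EW sub exp p K sub'(1) sub'(2) sub'(2)])
    show "c * real n * p \<le> real (deg_row E (Y' k) u)" using that by (rule row_res)
    show "c * real n * p \<le> real (deg_col E (X' k) b)" if "b \<in> Y' k" for b
      using that XYk \<open>k \<in> {1,2}\<close> by (intro col_res) auto
    show "T * dL * p * real n \<le> real (deg_row E (Y' 0) a)" if "a \<in> X' k" for a
    proof -
      have a: "a \<in> X" using that XYk by auto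
      have "T * (dL * p * real n) \<le> T * real (deg_row E Y a)"
        using rows[OF a] by (intro mult_left_mono) (auto simp: T_def)
      then show ?thesis using rowk[OF _ a, of 0] M by (simp add: T_def mult_ac)
    qed
  qed
  define Yw where "Yw = {v\<in>Y' 0. \<exists>b\<in>Y' 1. \<exists>a\<in>X' 1. (w, b) \<in> E \<and> (a, b) \<in> E \<and> (a, v) \<in> E}"
  define Yz where "Yz = {v\<in>Y' 0. \<exists>b\<in>Y' 2. \<exists>a\<in>X' 2. (z, b) \<in> E \<and> (a, b) \<in> E \<and> (a, v) \<in> E}"
  have wz: "w \<in> X" "z \<in> X" using w z XYk by auto
  have "\<exists>y1\<in>Yw. \<exists>y2\<in>Yz. \<exists>v\<in>Y' 0. \<exists>u1\<in>X' 0. \<exists>u2\<in>X' 0. y1 \<noteq> y2 \<and> y1 \<noteq> v \<and> y2 \<noteq> v \<and> u1 \<noteq> u2 \<and>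
    (u1, y1) \<in> E \<and> (u1, v) \<in> E \<and> (u2, v) \<in> E \<and> (u2, y2) \<in> E"
  proof (rule closing_vertex_exists[OF T_def T'_def pn XYk])
    have "real (card (X' 0)) \<le> (63/100 + 1/10^5) * real (card X)"
      using cl(4)[of 0] M unfolding X'_def by simp
    then show "proportion n (X' 0) \<le> T' * x"
      using n100 unfolding x proportion_def T'_def by (simp add: divide_right_mono field_simps)
    have "real (card (Y' 0)) \<le> (63/100 + 1/10^5) * real (card Y)"
      using cl(5)[of 0] M unfolding Y'_def by simp
    then show "proportion n (Y' 0) \<le> T' * y"
      using n100 unfolding y proportion_def T'_def by (simp add: divide_right_mono field_simps)
    show "T * real (deg_row E Y i) \<le> real (deg_row E (Y' 0) i)" if "i \<in> X" for i
      using rowk[OF _ that, of 0] M by (simp add: T_def)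
    show "T * real (deg_col E X j) \<le> real (deg_col E (X' 0) j)" if "j \<in> Y" for j
      using colk[OF _ that, of 0] M by (simp add: T_def)
    show "Yw \<subseteq> Y' 0" "Yz \<subseteq> Y' 0" by (auto simp: Yw_def Yz_def)
    show "T * dL - \<eta> \<le> proportion n Yw" "T * dL - \<eta> \<le> proportion n Yz"
      using growth[OF wz(1), of 1] growth[OF wz(2), of 2] n100
      unfolding Yw_def Yz_def proportion_def by (simp_all add: pos_le_divide_eq)
  qed
  then obtain y1 y2 v u1 u2 where cl: "y1 \<in> Yw" "y2 \<in> Yz" "v \<in> Y' 0" "u1 \<in> X' 0" "u2 \<in> X' 0"
    "y1 \<noteq> y2" "y1 \<noteq> v" "y2 \<noteq> v" "u1 \<noteq> u2" "(u1, y1) \<in> E" "(u1, v) \<in> E" "(u2, v) \<in> E" "(u2, y2) \<in> E" by auto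
  obtain b1 a1 where s1: "y1 \<in> Y' 0" "b1 \<in> Y' 1" "a1 \<in> X' 1" "(w, b1) \<in> E" "(a1, b1) \<in> E" "(a1, y1) \<in> E"
    using cl(1) by (auto simp: Yw_def)
  obtain b2 a2 where s2: "y2 \<in> Y' 0" "b2 \<in> Y' 2" "a2 \<in> X' 2" "(z, b2) \<in> E" "(a2, b2) \<in> E" "(a2, y2) \<in> E"
    using cl(2) by (auto simp: Yz_def)
  define r where "r = [Inr b2, Inl a2, Inr y2, Inl u2, Inr v, Inl u1, Inr y1, Inl a1, Inr b1]"
  have col: "f a1 = 1" "f a2 = 2" "f u1 = 0" "f u2 = 0" "g b1 = 1" "g b2 = 2" "g y1 = 0" "g y2 = 0" "g v = 0"
    using s1 s2 cl by (auto simp: X'_def Y'_def)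
  have dr: "distinct r" using cl(6-9) col by (auto simp: r_def)
  have sr: "successively (bip_adj E) r" using cl s1 s2 by (simp add: r_def)
  have qr: "set q \<inter> set r = {}"
  proof -
    have "f i = 3" if "Inl i \<in> set q" for i using q(3) that by (auto simp: X'_def)
    moreover have "g j = 3" if "Inr j \<in> set q" for j using q(3) that by (auto simp: Y'_def)
    ultimately show ?thesis using col by (auto simp: r_def)
  qed
  have len: "length (q @ r) = t" using q(4) t(2) by (simp add: r_def)
  have "has_cycle_of_length G (length (q @ r))"
  proof (rule bip_cycle[OF G], unfold E[symmetric])
    show "3 \<le> length (q @ r)" unfolding len using t by simp
    show "distinct (q @ r)" using q dr qr by auto
    show "successively (bip_adj E) (q @ r)"
      unfolding successively_append_iff using q(1) sr z(1) s2 by (simp add: r_def)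
    show "bip_adj E (last (q @ r)) (hd (q @ r))" using w s1 qne by (simp add: r_def)
  qed
  then show ?thesis unfolding len .
qed

section \<open>The resilience theorem\<close>

text \<open>
Choose \<open>\<epsilon>\<close> roughly as the reciprocal of the largest \<open>k \<le> n\<close> for which the limit is known to be almost attained from \<open>n\<close> on.
\<close>
lemma diagonal_parameter:
  fixes h :: "real \<Rightarrow> nat \<Rightarrow> real"
  assumes lim: "\<And>\<epsilon>. 0 < \<epsilon> \<Longrightarrow> \<epsilon> \<le> 1/2 \<Longrightarrow> h \<epsilon> \<longlonglongrightarrow> 1" and le: "\<And>\<epsilon> n. h \<epsilon> n \<le> 1"
  shows "\<exists>e. e \<longlonglongrightarrow> 0 \<and> (\<lambda>n. h (e n) n) \<longlonglongrightarrow> 1"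
proof -
  define a where "a k = 1 / (real k + 2)" for k
  have a: "0 < a k" "a k \<le> 1/2" for k by (auto simp: a_def)
  have a0: "a \<longlonglongrightarrow> 0" unfolding a_def by real_asymp
  have "\<exists>N. \<forall>n\<ge>N. 1 - a k < h (a k) n" for k
    using order_tendstoD(1)[OF lim[OF a], of "1 - a k" k] a[of k] by (auto simp: eventually_sequentially)
  then obtain N where N: "\<And>k n. N k \<le> n \<Longrightarrow> 1 - a k < h (a k) n" by metis
  define S where "S n = insert 0 {k. k \<le> n \<and> N k \<le> n}" for n
  define K where "K n = Max (S n)" for n
  have finS: "finite (S n)" for n unfolding S_def by (rule finite.insertI, rule finite_subset[of _ "{..n}"]) auto
  have K: "filterlim K at_top sequentially"
    unfolding filterlim_at_top
  proof
    fix m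
    have "m \<le> K n" if "max m (N m) \<le> n" for n
      unfolding K_def using that finS by (intro Max_ge) (auto simp: S_def)
    then show "\<forall>\<^sub>F n in sequentially. m \<le> K n" unfolding eventually_sequentially by blast
  qed
  have aK: "(\<lambda>n. a (K n)) \<longlonglongrightarrow> 0" by (rule filterlim_compose[OF a0 K])
  have lower: "\<forall>\<^sub>F n in sequentially. 1 - a (K n) \<le> h (a (K n)) n"
    unfolding eventually_sequentially
  proof (intro exI allI impI)
    fix n assume n: "N 0 \<le> n"
    have "K n \<in> S n" unfolding K_def using finS by (intro Max_in) (auto simp: S_def)
    then have "N (K n) \<le> n" using n by (auto simp: S_def)
    then show "1 - a (K n) \<le> h (a (K n)) n" using N by (simp add: less_imp_le)
  qed
  have low_lim: "(\<lambda>n. 1 - a (K n)) \<longlonglongrightarrow> 1" using tendsto_diff[OF tendsto_const[of 1] aK] by simp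
  have "(\<lambda>n. h (a (K n)) n) \<longlonglongrightarrow> 1"
    by (rule tendsto_sandwich[OF lower _ low_lim tendsto_const]) (auto simp: le)
  then show ?thesis using aK by blast
qed

lemma polynomial_times_exp_small:
  fixes C :: real and p :: "nat \<Rightarrow> real"
  assumes C: "0 < C" and p: "\<forall>\<^sub>F n in sequentially. real n powr (1/3) \<le> real n * p n"
  shows "\<forall>\<^sub>F n in sequentially. 8 * (real n + 1) * exp (- (C * (real n * p n))) < 1"
proof -
  have "(\<lambda>n. 8 * (real n + 1) * exp (- (C * real n powr (1/3)))) \<longlonglongrightarrow> 0" using C by real_asymp
  from order_tendstoD(2)[OF this, of 1]
  have "\<forall>\<^sub>F n in sequentially. 8 * (real n + 1) * exp (- (C * real n powr (1/3))) < 1" by simp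
  then show ?thesis using p
  proof eventually_elim
    case (elim n)
    have "C * real n powr (1/3) \<le> C * (real n * p n)" using elim C by (intro mult_left_mono) auto
    then have "8 * (real n + 1) * exp (- (C * (real n * p n))) \<le> 8 * (real n + 1) * exp (- (C * real n powr (1/3)))"
      by (intro mult_left_mono) auto
    then show ?case using elim by linarith
  qed
qed

text \<open>
The only consequences of \<open>p \<gg> n powr (-2/3)\<close> that the argument uses.
\<close>
lemma density_growth:
  fixes p :: "nat \<Rightarrow> real"
  assumes p: "\<And>n. 0 \<le> p n \<and> p n \<le> 1"
    and lim: "filterlim (\<lambda>n. p n * real n powr (2 / 3)) at_top sequentially"
  shows "filterlim (\<lambda>n. real n * p n) at_top sequentially"
    and "filterlim (\<lambda>n. (real n)\<^sup>2 * p n ^ 3) at_top sequentially"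
    and "\<forall>\<^sub>F n in sequentially. real n powr (1/3) \<le> real n * p n"
    and "\<forall>\<^sub>F n in sequentially. ln (real n + 1) \<le> 4 * ln (real n * p n)"
proof -
  have pos: "\<forall>\<^sub>F n in sequentially. 0 < n" by (rule eventually_gt_at_top)
  show "filterlim (\<lambda>n. real n * p n) at_top sequentially"
  proof (rule filterlim_at_top_mono[OF lim])
    show "\<forall>\<^sub>F n in sequentially. p n * real n powr (2/3) \<le> real n * p n"
      using pos
    proof eventually_elim
      case (elim n)
      have "real n powr (2/3) \<le> real n powr 1" using elim by (intro powr_mono) auto
      then have "p n * real n powr (2/3) \<le> p n * real n powr 1" using p by (intro mult_left_mono) auto
      then show ?case using elim by (simp add: mult.commute)
    qed
  qed
  have "filterlim (\<lambda>n. (p n * real n powr (2 / 3)) ^ 3) at_top sequentially"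
    by (rule filterlim_pow_at_top[OF _ lim]) simp
  moreover have "\<forall>\<^sub>F n in sequentially. (p n * real n powr (2 / 3)) ^ 3 = (real n)\<^sup>2 * p n ^ 3"
    using pos
  proof eventually_elim
    case (elim n)
    have "(real n powr (2/3)) ^ 3 = real n powr (real 3 * (2/3))" using elim
      by (simp only: powr_realpow[symmetric] powr_gt_zero powr_powr) simp
    also have "\<dots> = (real n)\<^sup>2" using elim by (simp add: powr_numeral)
    finally show ?case by (simp add: power_mult_distrib)
  qed
  ultimately show "filterlim (\<lambda>n. (real n)\<^sup>2 * p n ^ 3) at_top sequentially"
    using filterlim_cong[OF refl refl] by fastforce
  have "\<forall>\<^sub>F n in sequentially. 1 \<le> p n * real n powr (2 / 3)" using lim by (simp add: filterlim_at_top)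
  then show root: "\<forall>\<^sub>F n in sequentially. real n powr (1/3) \<le> real n * p n"
    using pos
  proof eventually_elim
    case (elim n)
    have "real n powr (1/3) * 1 \<le> real n powr (1/3) * (p n * real n powr (2/3))"
      using elim by (intro mult_left_mono) auto
    also have "\<dots> = p n * real n powr (1/3 + 2/3)" by (simp only: powr_add mult_ac)
    finally show ?case using elim by (simp add: mult.commute)
  qed
  have "\<forall>\<^sub>F n in sequentially. ln (real n + 1) \<le> 4 / 3 * ln (real n)" by real_asymp
  then show "\<forall>\<^sub>F n in sequentially. ln (real n + 1) \<le> 4 * ln (real n * p n)"
    using root pos
  proof eventually_elim
    case (elim n)
    have "ln (real n powr (1/3)) \<le> ln (real n * p n)"
      using elim by (intro ln_mono) auto
    then show ?case using elim by (simp add: ln_powr)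
  qed
qed

text \<open>
The factor 2 makes the excess over half of the expected number of edges equal to \<open>\<epsilon> p n\<^sup>2\<close>.
\<close>
definition resilient :: "nat \<Rightarrow> real \<Rightarrow> real \<Rightarrow> (nat + nat) ugraph \<Rightarrow> bool" where
  "resilient n p \<epsilon> G \<longleftrightarrow> (\<forall>G'. subgraph G' G \<and> real (card (edges G')) > (1 + 2 * \<epsilon>) * (real n)\<^sup>2 * p / 2 \<longrightarrow>
     (\<forall>t::nat. even t \<and> 4 \<le> t \<and> real t \<le> real n / 30 \<longrightarrow> has_cycle_of_length G' t))"

lemma subgraph_bip_rel:
  assumes "subgraph G' (UGraph V (bip_edge ` W))"
  shows "bip_rel G' \<subseteq> W" "card (bip_rel G') = card (edges G')" "simple_graph G'"
proof -
  have inj: "inj bip_edge" by (rule injI) (auto simp: doubleton_eq_iff prod_eq_iff)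
  have sub: "edges G' \<subseteq> bip_edge ` W" and "simple_graph G'" using assms by (auto simp: subgraph_def)
  then show "simple_graph G'" by simp
  have rel: "(i, j) \<in> bip_rel G' \<longleftrightarrow> bip_edge (i, j) \<in> edges G'" for i j by (simp add: bip_rel_def)
  show "bip_rel G' \<subseteq> W"
  proof (rule subrelI)
    fix i j assume "(i, j) \<in> bip_rel G'"
    then have "bip_edge (i, j) \<in> bip_edge ` W" using sub rel by blast
    then show "(i, j) \<in> W" by (rule inj_image_mem_iff[OF inj, THEN iffD1])
  qed
  have "edges G' = bip_edge ` bip_rel G'"
  proof
    show "edges G' \<subseteq> bip_edge ` bip_rel G'"
    proof
      fix e assume e: "e \<in> edges G'"
      then obtain z where "z \<in> W" "e = bip_edge z" using sub by blast
      then show "e \<in> bip_edge ` bip_rel G'" using e rel[of "fst z" "snd z"] by force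
    qed
    show "bip_edge ` bip_rel G' \<subseteq> edges G'" using rel by auto
  qed
  then show "card (bip_rel G') = card (edges G')" 
    using card_image[OF inj_on_subset[OF inj subset_UNIV], of "bip_rel G'"] by simp
qed

text \<open>
The seven exceptional events are those of the short cycles, with constants depending on \<open>\<epsilon>\<close>, and those of the long cycles, with absolute constants.
\<close>
lemma resilient_whp:
  fixes p :: "nat \<Rightarrow> real" and \<epsilon> :: real
  assumes p: "\<And>n. 0 \<le> p n \<and> p n \<le> 1"
    and lim: "filterlim (\<lambda>n. p n * real n powr (2 / 3)) at_top sequentially"
    and \<epsilon>: "0 < \<epsilon>" "\<epsilon> \<le> 1/2"
  shows "(\<lambda>n. measure_pmf.prob (random_bipartite n (p n)) {G. resilient n (p n) \<epsilon> G}) \<longlonglongrightarrow> 1"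
proof -
  note np = density_growth(1)[OF p lim] and n2p3 = density_growth(2)[OF p lim]
    and root = density_growth(3)[OF p lim] and lnnp = density_growth(4)[OF p lim]
  define \<gamma> \<eta> c K where "\<gamma> = \<epsilon>^4 / 24576" and "\<eta> = \<epsilon>\<^sup>2 / 16" and "c = \<gamma> * \<epsilon> / 8" and "K = 16 / \<eta>\<^sup>2"
  define \<eta>' c' K' :: real where "\<eta>' = 1/10^10" and "c' = 9/10^5" and "K' = 16 / \<eta>'\<^sup>2"
  have pos: "0 < \<gamma>" "0 < \<eta>" "0 < c" "0 < K" "0 < \<eta>'" "0 < c'" "0 < K'"
    using \<epsilon> by (auto simp: \<gamma>_def \<eta>_def c_def K_def \<eta>'_def c'_def K'_def)
  have \<eta>1: "\<eta> \<le> 1" "\<eta>' \<le> 1"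
  proof -
    have "\<epsilon>\<^sup>2 \<le> 1" using \<epsilon> by (simp add: power_le_one)
    then show "\<eta> \<le> 1" "\<eta>' \<le> 1" by (auto simp: \<eta>_def \<eta>'_def)
  qed
  have \<rho>: "6 * \<gamma> \<le> \<eta>\<^sup>2 / 16" by (simp add: \<gamma>_def \<eta>_def power_divide flip: power_mult)
  let ?P = "\<lambda>n. random_relation n (p n)"
  define bad where "bad n =
    [{W. \<not> uniform_above n (p n) \<eta> W}, {W. \<not> sublinear_uniform_above n (p n) K \<eta> W},
     {W. \<not> small_sets_expand n (p n) c K W}, {W. \<not> unlinked_uniform_above n (p n) (6 * \<gamma>) \<eta> W},
     {W. \<not> uniform_above n (p n) \<eta>' W}, {W. \<not> sublinear_uniform_above n (p n) K' \<eta>' W},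
     {W. \<not> small_sets_expand n (p n) c' K' W}]" for n
  have bad_lim: "(\<lambda>n. \<Sum>i<7. measure_pmf.prob (?P n) (bad n ! i)) \<longlonglongrightarrow> 0"
  proof (rule tendsto_null_sum)
    fix i :: nat assume "i \<in> {..<7}"
    then have "i \<in> {0,1,2,3,4,5,6}" by auto
    then show "(\<lambda>n. measure_pmf.prob (?P n) (bad n ! i)) \<longlonglongrightarrow> 0"
      using uniform_above_whp[OF p np pos(2) \<eta>1(1)] uniform_above_whp[OF p np pos(5) \<eta>1(2)]
        sublinear_uniform_above_whp[OF p pos(2) \<eta>1(1), of K] sublinear_uniform_above_whp[OF p pos(5) \<eta>1(2), of K']
        small_sets_expand_whp[OF p np n2p3 lnnp pos(3,4)] small_sets_expand_whp[OF p np n2p3 lnnp pos(6,7)]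
        unlinked_uniform_above_whp[OF p np pos(2) \<eta>1(1) _ \<rho>] pos
      by (auto simp: bad_def K_def K'_def)
  qed
  have "0 < (\<gamma> / 2)\<^sup>2 * (\<epsilon> / 4) / 4" using pos \<epsilon> by simp
  from polynomial_times_exp_small[OF this root]
  have small1: "\<forall>\<^sub>F n in sequentially. 8 * (real n + 1) * exp (- ((\<gamma> / 2)\<^sup>2 * (\<epsilon> / 4 * p n * real n) / 4)) < 1"
    by (simp add: mult_ac)
  have "0 < (1/10^5)\<^sup>2 * (468/10^4) / (4 :: real)" by simp
  from polynomial_times_exp_small[OF this root]
  have small2: "\<forall>\<^sub>F n in sequentially. 8 * (real n + 1) * exp (- ((1/10^5)\<^sup>2 * (468/10^4 * p n * real n) / 4)) < 1"
    by (simp add: mult_ac)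
  have pn: "\<forall>\<^sub>F n in sequentially. 2 * 10^10 \<le> real n * p n" using np unfolding filterlim_at_top by blast
  have nbig: "\<forall>\<^sub>F n in sequentially. 10^6 \<le> n" by (rule eventually_ge_at_top)
  have lower: "\<forall>\<^sub>F n in sequentially. 1 - (\<Sum>i<7. measure_pmf.prob (?P n) (bad n ! i)) \<le>
      measure_pmf.prob (random_bipartite n (p n)) {G. resilient n (p n) \<epsilon> G}"
    using small1 small2 pn nbig
  proof eventually_elim
    case (elim n)
    let ?I = "{..<n} \<times> {..<n}"
    let ?V = "Inl ` {..<n} \<union> Inr ` {..<n} :: (nat + nat) set"
    define Good where "Good = {W. resilient n (p n) \<epsilon> (UGraph ?V (bip_edge ` W))}"
    have p0: "0 < p n" using elim(3) p[of n] by (cases "p n = 0") auto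
    have good: "W \<in> Good" if W: "W \<subseteq> ?I" and nb: "\<And>i. i < 7 \<Longrightarrow> W \<notin> bad n ! i" for W
      unfolding Good_def mem_Collect_eq resilient_def
    proof (intro allI impI, elim conjE)
      fix G' :: "(nat + nat) ugraph" and t :: nat
      assume sub: "subgraph G' (UGraph ?V (bip_edge ` W))"
        and edges: "(1 + 2 * \<epsilon>) * (real n)\<^sup>2 * p n / 2 < real (card (edges G'))"
        and t: "even t" "4 \<le> t" "real t \<le> real n / 30"
      note G' = subgraph_bip_rel[OF sub]
      have ev: "uniform_above n (p n) \<eta> W" "sublinear_uniform_above n (p n) K \<eta> W"
        "small_sets_expand n (p n) c K W" "unlinked_uniform_above n (p n) (6 * \<gamma>) \<eta> W"
        "uniform_above n (p n) \<eta>' W" "sublinear_uniform_above n (p n) K' \<eta>' W" "small_sets_expand n (p n) c' K' W"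
        using nb[of 0] nb[of 1] nb[of 2] nb[of 3] nb[of 4] nb[of 5] nb[of 6] by (simp_all add: bad_def)
      have edges': "(1/2 + \<epsilon>) * p n * (real n)\<^sup>2 < real (card (bip_rel G'))"
        using edges unfolding G'(2) by (simp add: algebra_simps)
      show "has_cycle_of_length G' t"
      proof (cases "10 \<le> t")
        case True
        have "0 \<le> \<epsilon> * (p n * (real n)\<^sup>2)" using \<epsilon> p0 by simp
        then have half: "1/2 * p n * (real n)\<^sup>2 \<le> real (card (bip_rel G'))"
          using edges' by (simp add: algebra_simps)
        have pn': "2 * 10^10 \<le> p n * real n" using elim(3) by (simp add: mult.commute)
        show ?thesis
          by (rule long_cycle[OF G'(3) refl G'(1) W half p0 p[THEN conjunct2] less_imp_le[OF pos(7)] \<eta>'_def c'_def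
              ev(5) ev(6) ev(7) elim(2) pn' elim(4) t(1) True t(3)])
      next
        case False
        have "t = 4 \<or> t = 6 \<or> t = 8" using t False by presburger
        then obtain r where r: "r \<in> {1,2,3::nat}" "t = 2 * r + 2" by auto
        have \<gamma>': "\<gamma> \<le> \<epsilon>^4 / 24576" by (simp add: \<gamma>_def)
        show ?thesis unfolding r(2)
          by (rule short_cycle[OF G'(3) refl G'(1) W edges' \<epsilon> p0 p[THEN conjunct2] less_imp_le[OF pos(4)] pos(1) \<gamma>'
              \<eta>_def c_def ev(1) ev(2) ev(3) ev(4) elim(1) r(1)])
      qed
    qed
    have "measure_pmf.prob (?P n) (- Good) \<le> measure_pmf.prob (?P n) ({W. \<not> W \<subseteq> ?I} \<union> (\<Union>i\<in>{..<7}. bad n ! i))"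
    proof (rule measure_pmf.finite_measure_mono, rule subsetI)
      fix W assume W: "W \<in> - Good"
      show "W \<in> {W. \<not> W \<subseteq> ?I} \<union> (\<Union>i\<in>{..<7}. bad n ! i)"
      proof (rule ccontr)
        assume "W \<notin> {W. \<not> W \<subseteq> ?I} \<union> (\<Union>i\<in>{..<7}. bad n ! i)"
        then have "W \<subseteq> ?I" "\<And>i. i < 7 \<Longrightarrow> W \<notin> bad n ! i" by auto
        then show False using good[of W] W by simp
      qed
    qed simp
    also have "\<dots> \<le> measure_pmf.prob (?P n) {W. \<not> W \<subseteq> ?I} + measure_pmf.prob (?P n) (\<Union>i\<in>{..<7}. bad n ! i)"
      by (rule measure_Un_le) auto
    also have "measure_pmf.prob (?P n) {W. \<not> W \<subseteq> ?I} = 0"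
      by (subst measure_pmf_zero_iff) (auto simp: random_relation_def)
    also have "measure_pmf.prob (?P n) (\<Union>i\<in>{..<7}. bad n ! i) \<le> (\<Sum>i<7. measure_pmf.prob (?P n) (bad n ! i))"
      by (rule measure_pmf.finite_measure_subadditive_finite) auto
    finally have "measure_pmf.prob (?P n) (- Good) \<le> (\<Sum>i<7. measure_pmf.prob (?P n) (bad n ! i))" by simp
    moreover have "measure_pmf.prob (?P n) (- Good) = 1 - measure_pmf.prob (?P n) Good"
      using measure_pmf.prob_compl[of Good "?P n"] by (simp add: Compl_eq_Diff_UNIV)
    moreover have "measure_pmf.prob (random_bipartite n (p n)) {G. resilient n (p n) \<epsilon> G} = measure_pmf.prob (?P n) Good"
      by (simp add: random_bipartite_conv Good_def vimage_def)
    ultimately show ?case by linarith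
  qed
  have low_lim: "(\<lambda>n. 1 - (\<Sum>i<7. measure_pmf.prob (?P n) (bad n ! i))) \<longlonglongrightarrow> 1"
    using tendsto_diff[OF tendsto_const[of 1] bad_lim] by simp
  show ?thesis by (rule tendsto_sandwich[OF lower _ low_lim tendsto_const]) auto
qed

theorem theorem2:
  fixes p :: "nat \<Rightarrow> real"
  assumes "\<And>n. 0 \<le> p n \<and> p n \<le> 1"
    and "filterlim (\<lambda>n. p n * real n powr (2 / 3)) at_top sequentially"
  shows "\<exists>\<epsilon> \<delta> :: nat \<Rightarrow> real. \<epsilon> \<longlonglongrightarrow> 0 \<and> \<delta> \<longlonglongrightarrow> 0 \<and>
    asymptotically_almost_surely (\<lambda>n. random_bipartite n (p n))
      (\<lambda>n G. \<forall>G'. subgraph G' G \<and>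
           real (card (edges G')) > (1 + \<epsilon> n) * (real n)\<^sup>2 * p n / 2 \<longrightarrow>
         (\<forall>t::nat. even t \<and> 4 \<le> t \<and> real t \<le> (1 + \<delta> n) * real n / 30 \<longrightarrow>
            has_cycle_of_length G' t))"
proof -
  have "\<exists>e. e \<longlonglongrightarrow> 0 \<and> (\<lambda>n. measure_pmf.prob (random_bipartite n (p n)) {G. resilient n (p n) (e n) G}) \<longlonglongrightarrow> 1"
    by (rule diagonal_parameter) (use resilient_whp[OF assms] in auto)
  then obtain e where e: "e \<longlonglongrightarrow> 0"
    "(\<lambda>n. measure_pmf.prob (random_bipartite n (p n)) {G. resilient n (p n) (e n) G}) \<longlonglongrightarrow> 1" by blast
  have "(\<lambda>n. 2 * e n) \<longlonglongrightarrow> 0" using tendsto_mult_right_zero[OF e(1), of 2] by simp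
  then show ?thesis using e(2)
    by (intro exI[of _ "\<lambda>n. 2 * e n"] exI[of _ "\<lambda>_. 0"])
      (simp add: asymptotically_almost_surely_def resilient_def)
qed

end
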